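(* Let $\mathcal{E}$ be a locally cartesian closed category with a terminal object, let $I,J$ be objects of $\mathcal{E}$, and let $P:\mathcal{E}|I\to\mathcal{E}|J$ be a fibered functor between the fibered slices. Then $P$ is polynomial (i.e. isomorphic, as a fibered functor, to $t_!\circ p_*\circ s^*$ for some diagram $I\xleftarrow{s}E\xrightarrow{p}B\xrightarrow{t}J$ in $\mathcal{E}$) if and only if $P$ is a local fibered right adjoint.
   Context: Fibered categories are categories fibered over $\mathcal{E}$ (Grothendieck fibrations). They form a 2-category $\mathbf{Fib}_{\mathcal{E}}$: 1-cells are fibered functors (functors commuting with the structure functors to $\mathcal{E}$ and preserving cartesian arrows); 2-cells are fibered natural transformations (natural transformations all of whose components are vertical). A fibered adjunction is an adjunction in $\mathbf{Fib}_{\mathcal{E}}$; a fibered right (left) adjoint is a right (left) adjoint in this 2-category. The notion "isomorphic as a fibered functor" means isomorphic via a fibered natural isomorphism. Fibered slice: for $I\in\mathcal{E}$, $\mathcal{E}|I$ is the category whose objects are spans $I\xleftarrow{p}M\xrightarrow{q}K$ in $\mathcal{E}$, and whose morphisms from $I\xleftarrow{p'}M'\xrightarrow{q'}K'$ to $I\xleftarrow{p}M\xrightarrow{q}K$ are pairs $(v:M'\to M,\ w:K'\to K)$ with $p\circ v=p'$ and $q\circ v=w\circ q'$. The structure functor $\mathcal{E}|I\to\mathcal{E}$ sends a span to its right-most object $K$ and a morphism $(v,w)$ to $w$; it is a fibration, with cartesian arrows those for which the square $q v=w q'$ is a pullback. The fiber over $K$ is $\mathcal{E}/(I\times K)$.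 The category $\mathcal{E}|I$ has a terminal object $1_I=(I\xleftarrow{\mathrm{id}}I\to 1)$, which lies in the fiber over $1$. Each arrow $f:J\to I$ in $\mathcal{E}$ induces fibered functors $f_!:\mathcal{E}|J\to\mathcal{E}|I$, $f^*:\mathcal{E}|I\to\mathcal{E}|J$, $f_*:\mathcal{E}|J\to\mathcal{E}|I$ with fibered adjunctions $f_!\dashv f^*\dashv f_*$. On the fiber over $K$ they are respectively postcomposition with $f\times\mathrm{id}_K$, pullback along $f\times\mathrm{id}_K$, and the right adjoint $(f\times\mathrm{id}_K)_*$ of this pullback functor, between $\mathcal{E}/(J\times K)$ and $\mathcal{E}/(I\times K)$. Local fibered right adjoint: let $\mathcal{F},\mathcal{G}$ be fibered over $\mathcal{E}$, let $\mathcal{F}$ have a terminal object $1_{\mathcal{F}}$, and let $R:\mathcal{F}\to\mathcal{G}$ be a fibered functor. Then $R$ factors through fibered functors as $\mathcal{F}\xrightarrow{\overline R}\mathcal{G}/R(1_{\mathcal{F}})\xrightarrow{\mathrm{dom}}\mathcal{G}$, where $\overline R(A)=R(A\to 1_{\mathcal{F}})$ and the slice $\mathcal{G}/R(1_{\mathcal{F}})$ is fibered over $\mathcal{E}$ via $\mathrm{dom}$ followed by the structure functor $\mathcal{G}\to\mathcal{E}$. One calls $R$ a local fibered right adjoint if $\overline R$ is a fibered right adjoint. *)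

theory Defs
  imports Main
begin

section \<open>Categories, functors, natural transformations\<close>

text \<open>Composition is written in applicative order: \<open>g \<cdot>\<^bsub>C\<^esub> f\<close> is \<open>g\<close> after \<open>f\<close>. Everything is
  relative to the carriers \<open>Obj\<close> and \<open>Arr\<close>; values outside are irrelevant.\<close>

record ('o, 'm) cat =
  Obj :: "'o set"
  Arr :: "'m set"
  Src :: "'m \<Rightarrow> 'o"
  Tgt :: "'m \<Rightarrow> 'o"
  Ide :: "'o \<Rightarrow> 'm"
  Cmp :: "'m \<Rightarrow> 'm \<Rightarrow> 'm" (infixl "\<cdot>\<index>" 70)

definition Hom :: "('o, 'm) cat \<Rightarrow> 'o \<Rightarrow> 'o \<Rightarrow> 'm set" where
  "Hom C x y = {f \<in> Arr C. Src C f = x \<and> Tgt C f = y}"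

locale category =
  fixes C :: "('o, 'm) cat" (structure)
  assumes Src_in_Obj: "f \<in> Arr C \<Longrightarrow> Src C f \<in> Obj C"
    and Tgt_in_Obj: "f \<in> Arr C \<Longrightarrow> Tgt C f \<in> Obj C"
    and Ide_in_Hom: "x \<in> Obj C \<Longrightarrow> Ide C x \<in> Hom C x x"
    and Cmp_in_Hom: "\<lbrakk>f \<in> Hom C x y; g \<in> Hom C y z\<rbrakk> \<Longrightarrow> g \<cdot> f \<in> Hom C x z"
    and Cmp_Ide: "f \<in> Hom C x y \<Longrightarrow> f \<cdot> Ide C x = f"
    and Ide_Cmp: "f \<in> Hom C x y \<Longrightarrow> Ide C y \<cdot> f = f"
    and Cmp_assoc: "\<lbrakk>f \<in> Hom C w x; g \<in> Hom C x y; h \<in> Hom C y z\<rbrakk> \<Longrightarrow> (h \<cdot> g) \<cdot> f = h \<cdot> (g \<cdot> f)"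

definition iso_arr :: "('o, 'm) cat \<Rightarrow> 'm \<Rightarrow> bool" where
  "iso_arr C f \<longleftrightarrow> f \<in> Arr C \<and>
     (\<exists>g \<in> Hom C (Tgt C f) (Src C f).
        g \<cdot>\<^bsub>C\<^esub> f = Ide C (Src C f) \<and> f \<cdot>\<^bsub>C\<^esub> g = Ide C (Tgt C f))"

record ('o, 'm, 'p, 'n) fun_data =
  omap :: "'o \<Rightarrow> 'p"
  amap :: "'m \<Rightarrow> 'n"

definition is_functor ::
  "('o, 'm) cat \<Rightarrow> ('p, 'n) cat \<Rightarrow> ('o, 'm, 'p, 'n) fun_data \<Rightarrow> bool" where
  "is_functor C D F \<longleftrightarrow>
     (\<forall>x \<in> Obj C. omap F x \<in> Obj D \<and> amap F (Ide C x) = Ide D (omap F x)) \<and>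
     (\<forall>f \<in> Arr C. amap F f \<in> Hom D (omap F (Src C f)) (omap F (Tgt C f))) \<and>
     (\<forall>f \<in> Arr C. \<forall>g \<in> Arr C. Src C g = Tgt C f \<longrightarrow>
        amap F (g \<cdot>\<^bsub>C\<^esub> f) = amap F g \<cdot>\<^bsub>D\<^esub> amap F f)"

definition idF :: "('o, 'm, 'o, 'm) fun_data" where
  "idF = \<lparr>omap = (\<lambda>x. x), amap = (\<lambda>f. f)\<rparr>"

definition compF :: "('p, 'n, 'q, 'l) fun_data \<Rightarrow> ('o, 'm, 'p, 'n) fun_data \<Rightarrow> ('o, 'm, 'q, 'l) fun_data"
    (infixr "\<odot>" 75) where
  "G \<odot> F = \<lparr>omap = omap G \<circ> omap F, amap = amap G \<circ> amap F\<rparr>"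

definition nat_trans ::
  "('o, 'm) cat \<Rightarrow> ('p, 'n) cat \<Rightarrow> ('o, 'm, 'p, 'n) fun_data \<Rightarrow> ('o, 'm, 'p, 'n) fun_data
     \<Rightarrow> ('o \<Rightarrow> 'n) \<Rightarrow> bool" where
  "nat_trans C D F G \<eta> \<longleftrightarrow>
     (\<forall>x \<in> Obj C. \<eta> x \<in> Hom D (omap F x) (omap G x)) \<and>
     (\<forall>f \<in> Arr C. amap G f \<cdot>\<^bsub>D\<^esub> \<eta> (Src C f) = \<eta> (Tgt C f) \<cdot>\<^bsub>D\<^esub> amap F f)"


section \<open>Limits, slices, local cartesian closedness\<close>

definition terminal :: "('o, 'm) cat \<Rightarrow> 'o \<Rightarrow> bool" where
  "terminal C t \<longleftrightarrow> t \<in> Obj C \<and> (\<forall>x \<in> Obj C. \<exists>!f. f \<in> Hom C x t)"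

definition term_arr :: "('o, 'm) cat \<Rightarrow> 'o \<Rightarrow> 'o \<Rightarrow> 'm" where
  "term_arr C t x = (THE f. f \<in> Hom C x t)"

definition is_product :: "('o, 'm) cat \<Rightarrow> 'o \<Rightarrow> 'o \<Rightarrow> 'o \<Rightarrow> 'm \<Rightarrow> 'm \<Rightarrow> bool" where
  "is_product C x y p a b \<longleftrightarrow> p \<in> Obj C \<and> a \<in> Hom C p x \<and> b \<in> Hom C p y \<and>
     (\<forall>z \<in> Obj C. \<forall>f \<in> Hom C z x. \<forall>g \<in> Hom C z y.
        \<exists>!u. u \<in> Hom C z p \<and> a \<cdot>\<^bsub>C\<^esub> u = f \<and> b \<cdot>\<^bsub>C\<^esub> u = g)"

text \<open>\<open>e\<close> is an exponential \<open>y\<^sup>x\<close>: \<open>(p, a, b)\<close> is a product of \<open>e\<close> and \<open>x\<close>, and \<open>ev : p \<rightarrow> y\<close>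
  is the evaluation. The arrow \<open>k\<close> below is \<open>h \<times> x\<close>.\<close>

definition is_exponential ::
  "('o, 'm) cat \<Rightarrow> 'o \<Rightarrow> 'o \<Rightarrow> 'o \<Rightarrow> 'o \<Rightarrow> 'm \<Rightarrow> 'm \<Rightarrow> 'm \<Rightarrow> bool" where
  "is_exponential C x y e p a b ev \<longleftrightarrow>
     e \<in> Obj C \<and> is_product C e x p a b \<and> ev \<in> Hom C p y \<and>
     (\<forall>z q c d. z \<in> Obj C \<and> is_product C z x q c d \<longrightarrow>
        (\<forall>g \<in> Hom C q y. \<exists>!h. h \<in> Hom C z e \<and>
           (\<exists>k \<in> Hom C q p. a \<cdot>\<^bsub>C\<^esub> k = h \<cdot>\<^bsub>C\<^esub> c \<and> b \<cdot>\<^bsub>C\<^esub> k = d \<and> ev \<cdot>\<^bsub>C\<^esub> k = g)))"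

definition cartesian_closed :: "('o, 'm) cat \<Rightarrow> bool" where
  "cartesian_closed C \<longleftrightarrow> category C \<and> (\<exists>t. terminal C t) \<and>
     (\<forall>x \<in> Obj C. \<forall>y \<in> Obj C. \<exists>p a b. is_product C x y p a b) \<and>
     (\<forall>x \<in> Obj C. \<forall>y \<in> Obj C. \<exists>e p a b ev. is_exponential C x y e p a b ev)"

text \<open>Arrows of categories built from a given one are triples (source, target, underlying data).\<close>

definition slice :: "('o, 'm) cat \<Rightarrow> 'o \<Rightarrow> ('m, 'm \<times> 'm \<times> 'm) cat" where
  "slice C x =
     \<lparr>Obj = {f \<in> Arr C. Tgt C f = x},
      Arr = {(f, g, u). f \<in> Arr C \<and> Tgt C f = x \<and> g \<in> Arr C \<and> Tgt C g = x \<and>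
                        u \<in> Hom C (Src C f) (Src C g) \<and> g \<cdot>\<^bsub>C\<^esub> u = f},
      Src = (\<lambda>(f, g, u). f),
      Tgt = (\<lambda>(f, g, u). g),
      Ide = (\<lambda>f. (f, f, Ide C (Src C f))),
      Cmp = (\<lambda>(g, h, v) (f, g', u). (f, h, v \<cdot>\<^bsub>C\<^esub> u))\<rparr>"

definition locally_cartesian_closed :: "('o, 'm) cat \<Rightarrow> bool" where
  "locally_cartesian_closed C \<longleftrightarrow> category C \<and> (\<forall>x \<in> Obj C. cartesian_closed (slice C x))"

definition is_pullback :: "('o, 'm) cat \<Rightarrow> 'm \<Rightarrow> 'm \<Rightarrow> 'm \<Rightarrow> 'm \<Rightarrow> bool" where
  "is_pullback C f g a b \<longleftrightarrow>
     f \<in> Arr C \<and> g \<in> Arr C \<and> a \<in> Arr C \<and> b \<in> Arr C \<and>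
     Tgt C f = Tgt C g \<and> Src C a = Src C b \<and> Tgt C a = Src C f \<and> Tgt C b = Src C g \<and>
     f \<cdot>\<^bsub>C\<^esub> a = g \<cdot>\<^bsub>C\<^esub> b \<and>
     (\<forall>z \<in> Obj C. \<forall>c \<in> Hom C z (Src C f). \<forall>d \<in> Hom C z (Src C g). f \<cdot>\<^bsub>C\<^esub> c = g \<cdot>\<^bsub>C\<^esub> d \<longrightarrow>
        (\<exists>!u. u \<in> Hom C z (Src C a) \<and> a \<cdot>\<^bsub>C\<^esub> u = c \<and> b \<cdot>\<^bsub>C\<^esub> u = d))"

definition pb :: "('o, 'm) cat \<Rightarrow> 'm \<Rightarrow> 'm \<Rightarrow> 'm \<times> 'm" where
  "pb C f g = (SOME (a, b). is_pullback C f g a b)"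


section \<open>The 2-category of fibered categories\<close>

record ('o, 'm, 'bo, 'bm) fib_data =
  total :: "('o, 'm) cat"
  proj :: "('o, 'm, 'bo, 'bm) fun_data"

definition cartesian_arr :: "('bo, 'bm) cat \<Rightarrow> ('o, 'm, 'bo, 'bm) fib_data \<Rightarrow> 'm \<Rightarrow> bool" where
  "cartesian_arr E \<F> f \<longleftrightarrow> (let F = total \<F>; \<pi> = proj \<F> in
     f \<in> Arr F \<and>
     (\<forall>g \<in> Arr F. \<forall>w \<in> Hom E (omap \<pi> (Src F g)) (omap \<pi> (Src F f)).
        Tgt F g = Tgt F f \<and> amap \<pi> f \<cdot>\<^bsub>E\<^esub> w = amap \<pi> g \<longrightarrow>
        (\<exists>!h. h \<in> Hom F (Src F g) (Src F f) \<and> f \<cdot>\<^bsub>F\<^esub> h = g \<and> amap \<pi> h = w)))"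

definition fibered_category :: "('bo, 'bm) cat \<Rightarrow> ('o, 'm, 'bo, 'bm) fib_data \<Rightarrow> bool" where
  "fibered_category E \<F> \<longleftrightarrow>
     category E \<and> category (total \<F>) \<and> is_functor (total \<F>) E (proj \<F>) \<and>
     (\<forall>x \<in> Obj (total \<F>). \<forall>u \<in> Arr E. Tgt E u = omap (proj \<F>) x \<longrightarrow>
        (\<exists>f. cartesian_arr E \<F> f \<and> Tgt (total \<F>) f = x \<and> amap (proj \<F>) f = u))"

definition fibered_functor ::
  "('bo, 'bm) cat \<Rightarrow> ('o, 'm, 'bo, 'bm) fib_data \<Rightarrow> ('p, 'n, 'bo, 'bm) fib_data
     \<Rightarrow> ('o, 'm, 'p, 'n) fun_data \<Rightarrow> bool" where
  "fibered_functor E \<F> \<G> R \<longleftrightarrow>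
     fibered_category E \<F> \<and> fibered_category E \<G> \<and> is_functor (total \<F>) (total \<G>) R \<and>
     (\<forall>x \<in> Obj (total \<F>). omap (proj \<G>) (omap R x) = omap (proj \<F>) x) \<and>
     (\<forall>f \<in> Arr (total \<F>). amap (proj \<G>) (amap R f) = amap (proj \<F>) f) \<and>
     (\<forall>f. cartesian_arr E \<F> f \<longrightarrow> cartesian_arr E \<G> (amap R f))"

definition fibered_nat_trans ::
  "('bo, 'bm) cat \<Rightarrow> ('o, 'm, 'bo, 'bm) fib_data \<Rightarrow> ('p, 'n, 'bo, 'bm) fib_data
     \<Rightarrow> ('o, 'm, 'p, 'n) fun_data \<Rightarrow> ('o, 'm, 'p, 'n) fun_data \<Rightarrow> ('o \<Rightarrow> 'n) \<Rightarrow> bool" where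
  "fibered_nat_trans E \<F> \<G> R S \<eta> \<longleftrightarrow> nat_trans (total \<F>) (total \<G>) R S \<eta> \<and>
     (\<forall>x \<in> Obj (total \<F>). amap (proj \<G>) (\<eta> x) = Ide E (omap (proj \<F>) x))"

definition fibered_iso ::
  "('bo, 'bm) cat \<Rightarrow> ('o, 'm, 'bo, 'bm) fib_data \<Rightarrow> ('p, 'n, 'bo, 'bm) fib_data
     \<Rightarrow> ('o, 'm, 'p, 'n) fun_data \<Rightarrow> ('o, 'm, 'p, 'n) fun_data \<Rightarrow> bool" where
  "fibered_iso E \<F> \<G> R S \<longleftrightarrow>
     fibered_functor E \<F> \<G> R \<and> fibered_functor E \<F> \<G> S \<and>
     (\<exists>\<eta>. fibered_nat_trans E \<F> \<G> R S \<eta> \<and> (\<forall>x \<in> Obj (total \<F>). iso_arr (total \<G>) (\<eta> x)))"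

text \<open>\<open>L : \<G> \<rightarrow> \<F>\<close> is fibered left adjoint to \<open>R : \<F> \<rightarrow> \<G>\<close>, with unit \<open>\<eta>\<close> and counit \<open>\<epsilon>\<close>.\<close>

definition fibered_adjunction ::
  "('bo, 'bm) cat \<Rightarrow> ('p, 'n, 'bo, 'bm) fib_data \<Rightarrow> ('o, 'm, 'bo, 'bm) fib_data
     \<Rightarrow> ('p, 'n, 'o, 'm) fun_data \<Rightarrow> ('o, 'm, 'p, 'n) fun_data \<Rightarrow> ('p \<Rightarrow> 'n) \<Rightarrow> ('o \<Rightarrow> 'm) \<Rightarrow> bool" where
  "fibered_adjunction E \<G> \<F> L R \<eta> \<epsilon> \<longleftrightarrow>
     fibered_functor E \<G> \<F> L \<and> fibered_functor E \<F> \<G> R \<and>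
     fibered_nat_trans E \<G> \<G> idF (R \<odot> L) \<eta> \<and> fibered_nat_trans E \<F> \<F> (L \<odot> R) idF \<epsilon> \<and>
     (\<forall>y \<in> Obj (total \<G>). \<epsilon> (omap L y) \<cdot>\<^bsub>total \<F>\<^esub> amap L (\<eta> y) = Ide (total \<F>) (omap L y)) \<and>
     (\<forall>x \<in> Obj (total \<F>). amap R (\<epsilon> x) \<cdot>\<^bsub>total \<G>\<^esub> \<eta> (omap R x) = Ide (total \<G>) (omap R x))"

definition fibered_right_adjoint ::
  "('bo, 'bm) cat \<Rightarrow> ('o, 'm, 'bo, 'bm) fib_data \<Rightarrow> ('p, 'n, 'bo, 'bm) fib_data
     \<Rightarrow> ('o, 'm, 'p, 'n) fun_data \<Rightarrow> bool" where
  "fibered_right_adjoint E \<F> \<G> R \<longleftrightarrow> (\<exists>L \<eta> \<epsilon>. fibered_adjunction E \<G> \<F> L R \<eta> \<epsilon>)"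


section \<open>Local fibered right adjoints\<close>

definition slice_fib ::
  "('o, 'm, 'bo, 'bm) fib_data \<Rightarrow> 'o \<Rightarrow> ('m, 'm \<times> 'm \<times> 'm, 'bo, 'bm) fib_data" where
  "slice_fib \<G> x =
     \<lparr>total = slice (total \<G>) x,
      proj = proj \<G> \<odot> \<lparr>omap = Src (total \<G>), amap = (\<lambda>(f, g, u). u)\<rparr>\<rparr>"

definition slice_lift ::
  "('o, 'm, 'bo, 'bm) fib_data \<Rightarrow> 'o \<Rightarrow> ('o, 'm, 'p, 'n) fun_data
     \<Rightarrow> ('o, 'm, 'n, 'n \<times> 'n \<times> 'n) fun_data" where
  "slice_lift \<F> t R = (let F = total \<F>; r = (\<lambda>x. amap R (term_arr F t x)) in
     \<lparr>omap = r, amap = (\<lambda>f. (r (Src F f), r (Tgt F f), amap R f))\<rparr>)"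

definition local_fibered_right_adjoint ::
  "('bo, 'bm) cat \<Rightarrow> ('o, 'm, 'bo, 'bm) fib_data \<Rightarrow> 'o \<Rightarrow> ('p, 'n, 'bo, 'bm) fib_data
     \<Rightarrow> ('o, 'm, 'p, 'n) fun_data \<Rightarrow> bool" where
  "local_fibered_right_adjoint E \<F> t \<G> R \<longleftrightarrow>
     terminal (total \<F>) t \<and> fibered_functor E \<F> \<G> R \<and>
     fibered_right_adjoint E \<F> (slice_fib \<G> (omap R t)) (slice_lift \<F> t R)"


section \<open>Fibered slices and polynomial functors\<close>

text \<open>The span \<open>I \<leftarrow> M \<rightarrow> K\<close> with legs \<open>p\<close> and \<open>q\<close> is the pair \<open>(p, q)\<close>.\<close>

type_synonym 'm span = "'m \<times> 'm"
type_synonym 'm span_arr = "'m span \<times> 'm span \<times> ('m \<times> 'm)"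

definition spans :: "('o, 'm) cat \<Rightarrow> 'o \<Rightarrow> 'm span set" where
  "spans E I = {(p, q). p \<in> Arr E \<and> q \<in> Arr E \<and> Src E p = Src E q \<and> Tgt E p = I}"

definition fslice_cat :: "('o, 'm) cat \<Rightarrow> 'o \<Rightarrow> ('m span, 'm span_arr) cat" where
  "fslice_cat E I =
     \<lparr>Obj = spans E I,
      Arr = {((p', q'), (p, q), (v, w)). (p', q') \<in> spans E I \<and> (p, q) \<in> spans E I \<and>
               v \<in> Hom E (Src E p') (Src E p) \<and> w \<in> Hom E (Tgt E q') (Tgt E q) \<and>
               p \<cdot>\<^bsub>E\<^esub> v = p' \<and> q \<cdot>\<^bsub>E\<^esub> v = w \<cdot>\<^bsub>E\<^esub> q'},
      Src = (\<lambda>(X, Y, f). X),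
      Tgt = (\<lambda>(X, Y, f). Y),
      Ide = (\<lambda>(p, q). ((p, q), (p, q), (Ide E (Src E p), Ide E (Tgt E q)))),
      Cmp = (\<lambda>(Y, Z, (v', w')) (X, Y', (v, w)). (X, Z, (v' \<cdot>\<^bsub>E\<^esub> v, w' \<cdot>\<^bsub>E\<^esub> w)))\<rparr>"

definition fslice :: "('o, 'm) cat \<Rightarrow> 'o \<Rightarrow> ('m span, 'm span_arr, 'o, 'm) fib_data" where
  "fslice E I =
     \<lparr>total = fslice_cat E I,
      proj = \<lparr>omap = (\<lambda>(p, q). Tgt E q), amap = (\<lambda>(X, Y, (v, w)). w)\<rparr>\<rparr>"

definition fslice_one :: "('o, 'm) cat \<Rightarrow> 'o \<Rightarrow> 'o \<Rightarrow> 'm span" where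
  "fslice_one E one I = (Ide E I, term_arr E one I)"

definition lower_shriek ::
  "('o, 'm) cat \<Rightarrow> 'm \<Rightarrow> ('m span, 'm span_arr, 'm span, 'm span_arr) fun_data" where
  "lower_shriek E f = (let r = (\<lambda>(p, q). (f \<cdot>\<^bsub>E\<^esub> p, q)) in
     \<lparr>omap = r, amap = (\<lambda>(X, Y, vw). (r X, r Y, vw))\<rparr>)"

text \<open>For \<open>f : J \<rightarrow> I\<close> and a span \<open>(p, q)\<close> from \<open>I\<close> to \<open>K\<close>, the pullback of \<open>\<langle>p, q\<rangle> : M \<rightarrow> I \<times> K\<close>
  along \<open>f \<times> K\<close> is the span formed by \<open>a : J \<times>\<^sub>I M \<rightarrow> J\<close> and \<open>q\<close> after \<open>b : J \<times>\<^sub>I M \<rightarrow> M\<close>,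
  where \<open>a, b\<close> are the projections of the pullback of \<open>p\<close> along \<open>f\<close>.\<close>

definition upper_star ::
  "('o, 'm) cat \<Rightarrow> 'm \<Rightarrow> ('m span, 'm span_arr, 'm span, 'm span_arr) fun_data" where
  "upper_star E f =
     (let a = (\<lambda>(p, q). fst (pb E f p)); b = (\<lambda>(p, q). snd (pb E f p));
          r = (\<lambda>(p, q). (a (p, q), q \<cdot>\<^bsub>E\<^esub> b (p, q)))
      in \<lparr>omap = r,
          amap = (\<lambda>(X, Y, (v, w)).
            (r X, r Y,
             (THE u. u \<in> Hom E (Src E (a X)) (Src E (a Y)) \<and>
                     a Y \<cdot>\<^bsub>E\<^esub> u = a X \<and> b Y \<cdot>\<^bsub>E\<^esub> u = v \<cdot>\<^bsub>E\<^esub> b X), w))\<rparr>)"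

text \<open>\<open>f\<^sub>*\<close> is a chosen fibered right adjoint of \<open>f\<^sup>*\<close>. It is determined up to fibered isomorphism, and
  since unit and counit are vertical it restricts on the fiber over \<open>K\<close> to a right adjoint of
  pullback along \<open>f \<times> K\<close>.\<close>

definition lower_star ::
  "('o, 'm) cat \<Rightarrow> 'm \<Rightarrow> ('m span, 'm span_arr, 'm span, 'm span_arr) fun_data" where
  "lower_star E f =
     (SOME R. \<exists>\<eta> \<epsilon>. fibered_adjunction E (fslice E (Tgt E f)) (fslice E (Src E f))
                       (upper_star E f) R \<eta> \<epsilon>)"

definition polynomial_functor ::
  "('o, 'm) cat \<Rightarrow> 'o \<Rightarrow> 'o \<Rightarrow> ('m span, 'm span_arr, 'm span, 'm span_arr) fun_data \<Rightarrow> bool" where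
  "polynomial_functor E I J P \<longleftrightarrow>
     (\<exists>M B s p t. s \<in> Hom E M I \<and> p \<in> Hom E M B \<and> t \<in> Hom E B J \<and>
        fibered_iso E (fslice E I) (fslice E J) P
          (lower_shriek E t \<odot> lower_star E p \<odot> upper_star E s))"

end

theory Submission
  imports Defs
begin

text \<open>Write \<open>E|I\<close> for the fibered slice over \<open>I\<close>. The argument rests on three facts.

  First, for \<open>t : B \<rightarrow> J\<close> the slice of \<open>E|J\<close> over the span \<open>J \<leftarrow> B \<rightarrow> 1\<close> is \<open>E|B\<close> again, and the domain
  projection becomes \<open>t\<^sub>!\<close> (locale \<open>span_slice\<close>). A fibered functor \<open>P : E|I \<rightarrow> E|J\<close> sends the terminal object
  to such a span, so it factors as \<open>t\<^sub>!\<close> after a functor \<open>E|I \<rightarrow> E|B\<close>, and \<open>P\<close> is a local fibered right adjoint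
  if and only if this functor is a fibered right adjoint.

  Second, the functors \<open>p\<^sub>* s\<^sup>*\<close> are fibered right adjoints: \<open>s\<^sub>! \<stileturn> s\<^sup>*\<close> is elementary (\<open>shriek_star_adj\<close>), and
  \<open>p\<^sup>* \<stileturn> p\<^sub>*\<close> comes from dependent products of spans, which local cartesian closedness provides
  (\<open>dependent_product_ex\<close>, \<open>lower_star_adj\<close>). Their couniversal property is established against all arrows
  of the total category, not only against vertical ones, and a right adjoint in this sense preserves cartesian
  arrows automatically (\<open>pointwise_right_adjoint\<close>); this is the Beck-Chevalley condition for \<open>p\<^sub>*\<close>.

  Third, conversely, every fibered left adjoint \<open>L : E|B \<rightarrow> E|I\<close> is of the form \<open>s\<^sub>! p\<^sup>*\<close>
  (\<open>left_adjoint_polynomial\<close>). This is a Yoneda argument: each object of \<open>E|B\<close> is reached from the diagonal span by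
  a cartesian arrow followed by an opcartesian one, and \<open>L\<close> preserves both, so \<open>(s, p)\<close> is the value at the
  diagonal. By uniqueness of adjoints every fibered right adjoint \<open>E|I \<rightarrow> E|B\<close> is then isomorphic to
  \<open>p\<^sub>* s\<^sup>*\<close>.\<close>

section \<open>Composition calculus\<close>

lemma Hom_iff: "f \<in> Hom C a b \<longleftrightarrow> f \<in> Arr C \<and> Src C f = a \<and> Tgt C f = b"
  by (auto simp: Hom_def)

context category
begin

lemma Cmp_arr [simp]:
  assumes "f \<in> Arr C" "g \<in> Arr C" "Src C g = Tgt C f"
  shows "g \<cdot> f \<in> Arr C" "Src C (g \<cdot> f) = Src C f" "Tgt C (g \<cdot> f) = Tgt C g"
  using Cmp_in_Hom[of f "Src C f" "Tgt C f" g "Tgt C g"] assms by (auto simp: Hom_iff)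

lemma Ide_arr [simp]:
  assumes "x \<in> Obj C"
  shows "Ide C x \<in> Arr C" "Src C (Ide C x) = x" "Tgt C (Ide C x) = x"
  using Ide_in_Hom[OF assms] by (auto simp: Hom_iff)

lemma Src_Tgt_Obj [simp]: "f \<in> Arr C \<Longrightarrow> Src C f \<in> Obj C" "f \<in> Arr C \<Longrightarrow> Tgt C f \<in> Obj C"
  by (auto intro: Src_in_Obj Tgt_in_Obj)

lemma Cmp_Ide' [simp]: "f \<in> Arr C \<Longrightarrow> x = Src C f \<Longrightarrow> f \<cdot> Ide C x = f"
  using Cmp_Ide[of f "Src C f" "Tgt C f"] by (auto simp: Hom_iff)

lemma Ide_Cmp' [simp]: "f \<in> Arr C \<Longrightarrow> x = Tgt C f \<Longrightarrow> Ide C x \<cdot> f = f"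
  using Ide_Cmp[of f "Src C f" "Tgt C f"] by (auto simp: Hom_iff)

lemma assoc [simp]:
  "\<lbrakk>f \<in> Arr C; g \<in> Arr C; h \<in> Arr C; Src C g = Tgt C f; Src C h = Tgt C g\<rbrakk>
    \<Longrightarrow> (h \<cdot> g) \<cdot> f = h \<cdot> (g \<cdot> f)"
  by (rule Cmp_assoc) (auto simp: Hom_iff)

text \<open>The form in which an equation between composites applies inside a longer composite
  that is bracketed to the right.\<close>

lemma extend:
  "\<lbrakk>g \<cdot> f = c; f \<in> Arr C; g \<in> Arr C; Src C g = Tgt C f; u \<in> Arr C; Tgt C u = Src C f\<rbrakk>
    \<Longrightarrow> g \<cdot> (f \<cdot> u) = c \<cdot> u"
  by (metis assoc)

end

locale cat_functor = A: category A + B: category B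
  for A :: "('o, 'm) cat" and B :: "('p, 'n) cat" +
  fixes F :: "('o, 'm, 'p, 'n) fun_data"
  assumes is_functor: "is_functor A B F"
begin

lemma omap_Obj [simp]: "x \<in> Obj A \<Longrightarrow> omap F x \<in> Obj B"
  and amap_Ide [simp]: "x \<in> Obj A \<Longrightarrow> amap F (Ide A x) = Ide B (omap F x)"
  and amap_Arr [simp]: "f \<in> Arr A \<Longrightarrow> amap F f \<in> Arr B"
  and Src_amap [simp]: "f \<in> Arr A \<Longrightarrow> Src B (amap F f) = omap F (Src A f)"
  and Tgt_amap [simp]: "f \<in> Arr A \<Longrightarrow> Tgt B (amap F f) = omap F (Tgt A f)"
  and amap_Cmp [simp]: "\<lbrakk>f \<in> Arr A; g \<in> Arr A; Src A g = Tgt A f\<rbrakk>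
    \<Longrightarrow> amap F (g \<cdot>\<^bsub>A\<^esub> f) = amap F g \<cdot>\<^bsub>B\<^esub> amap F f"
  using is_functor by (auto simp: is_functor_def Hom_iff)

end

lemma omap_compF [simp]: "omap (G \<odot> F) x = omap G (omap F x)"
  and amap_compF [simp]: "amap (G \<odot> F) f = amap G (amap F f)"
  and omap_idF [simp]: "omap idF x = x" and amap_idF [simp]: "amap idF f = f"
  by (simp_all add: compF_def idF_def)

locale fib_cat =
  fixes E :: "('bo, 'bm) cat" and F :: "('o, 'm, 'bo, 'bm) fib_data"
  assumes fib: "fibered_category E F"
begin
sublocale E: category E using fib by (simp add: fibered_category_def)
sublocale T: category "total F" using fib by (simp add: fibered_category_def)
sublocale p: cat_functor "total F" E "proj F"
  by unfold_locales (use fib in \<open>simp add: fibered_category_def\<close>)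
end

locale fib_functor =
  fixes E :: "('bo, 'bm) cat" and F :: "('o, 'm, 'bo, 'bm) fib_data"
    and G :: "('p, 'n, 'bo, 'bm) fib_data" and R
  assumes fibf: "fibered_functor E F G R"
begin
sublocale F: fib_cat E F by unfold_locales (use fibf in \<open>simp add: fibered_functor_def\<close>)
sublocale G: fib_cat E G by unfold_locales (use fibf in \<open>simp add: fibered_functor_def\<close>)
sublocale f: cat_functor "total F" "total G" R
  by unfold_locales (use fibf in \<open>simp add: fibered_functor_def\<close>)

lemma proj_omap [simp]: "x \<in> Obj (total F) \<Longrightarrow> omap (proj G) (omap R x) = omap (proj F) x"
  and proj_amap [simp]: "f \<in> Arr (total F) \<Longrightarrow> amap (proj G) (amap R f) = amap (proj F) f"
  and cartesian: "cartesian_arr E F f \<Longrightarrow> cartesian_arr E G (amap R f)"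
  using fibf by (auto simp: fibered_functor_def)

end

lemma fib_functorI: "fibered_functor E F G R \<Longrightarrow> fib_functor E F G R"
  by (simp add: fib_functor_def)

lemma fibered_functor_comp:
  assumes "fibered_functor E F G R" "fibered_functor E G H S"
  shows "fibered_functor E F H (S \<odot> R)"
proof -
  interpret R: fib_functor E F G R using assms(1) by (rule fib_functorI)
  interpret S: fib_functor E G H S using assms(2) by (rule fib_functorI)
  show ?thesis unfolding fibered_functor_def is_functor_def
    by (auto simp: R.F.fib S.G.fib Hom_iff R.cartesian S.cartesian)
qed

section \<open>Adjunctions presented by a couniversal counit\<close>

text \<open>Adjunctions are handled through the couniversal property of the counit, with the unit eliminated:
  a transpose is then a unique solution of an equation in one category, and equalities of arrows into
  \<open>R x\<close> are proved by comparing their images under \<open>L\<close> after \<open>\<epsilon> x\<close>.\<close>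

definition counit_adj ::
  "('bo, 'bm) cat \<Rightarrow> ('p, 'n, 'bo, 'bm) fib_data \<Rightarrow> ('o, 'm, 'bo, 'bm) fib_data
     \<Rightarrow> ('p, 'n, 'o, 'm) fun_data \<Rightarrow> ('o, 'm, 'p, 'n) fun_data \<Rightarrow> ('o \<Rightarrow> 'm) \<Rightarrow> bool" where
  "counit_adj E G F L R \<epsilon> \<longleftrightarrow>
     fibered_functor E G F L \<and> fibered_functor E F G R \<and>
     fibered_nat_trans E F F (L \<odot> R) idF \<epsilon> \<and>
     (\<forall>x \<in> Obj (total F). \<forall>y \<in> Obj (total G). \<forall>g \<in> Hom (total F) (omap L y) x.
        \<exists>!h. h \<in> Hom (total G) y (omap R x) \<and> \<epsilon> x \<cdot>\<^bsub>total F\<^esub> amap L h = g)"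

locale adj =
  fixes E :: "('bo, 'bm) cat" and G :: "('p, 'n, 'bo, 'bm) fib_data"
    and F :: "('o, 'm, 'bo, 'bm) fib_data" and L R \<epsilon>
  assumes adj: "counit_adj E G F L R \<epsilon>"
begin
sublocale L: fib_functor E G F L by unfold_locales (use adj in \<open>simp add: counit_adj_def\<close>)
sublocale R: fib_functor E F G R by unfold_locales (use adj in \<open>simp add: counit_adj_def\<close>)

lemma counit [simp]:
  assumes "x \<in> Obj (total F)"
  shows "\<epsilon> x \<in> Arr (total F)" "Src (total F) (\<epsilon> x) = omap L (omap R x)" "Tgt (total F) (\<epsilon> x) = x"
    "amap (proj F) (\<epsilon> x) = Ide E (omap (proj F) x)"
  using adj assms by (auto simp: counit_adj_def fibered_nat_trans_def nat_trans_def Hom_iff)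

lemma counit_nat:
  "f \<in> Arr (total F) \<Longrightarrow>
    \<epsilon> (Tgt (total F) f) \<cdot>\<^bsub>total F\<^esub> amap L (amap R f) = f \<cdot>\<^bsub>total F\<^esub> \<epsilon> (Src (total F) f)"
  using adj by (auto simp: counit_adj_def fibered_nat_trans_def nat_trans_def)

lemma counit_nat':
  assumes "f \<in> Arr (total F)" "x = Tgt (total F) f" "u \<in> Arr (total F)"
    "Tgt (total F) u = omap L (omap R (Src (total F) f))"
  shows "\<epsilon> x \<cdot>\<^bsub>total F\<^esub> (amap L (amap R f) \<cdot>\<^bsub>total F\<^esub> u)
    = f \<cdot>\<^bsub>total F\<^esub> (\<epsilon> (Src (total F) f) \<cdot>\<^bsub>total F\<^esub> u)"
  using L.G.T.extend[OF counit_nat[OF assms(1)], of u] assms by simp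

lemma transpose:
  assumes "x \<in> Obj (total F)" "y \<in> Obj (total G)" "g \<in> Arr (total F)"
    "Src (total F) g = omap L y" "Tgt (total F) g = x"
  shows "\<exists>h. h \<in> Arr (total G) \<and> Src (total G) h = y \<and> Tgt (total G) h = omap R x \<and>
    \<epsilon> x \<cdot>\<^bsub>total F\<^esub> amap L h = g"
proof -
  have "\<exists>!h. h \<in> Hom (total G) y (omap R x) \<and> \<epsilon> x \<cdot>\<^bsub>total F\<^esub> amap L h = g"
    using adj assms unfolding counit_adj_def by (simp add: Hom_iff)
  then show ?thesis by (auto simp: Hom_iff)
qed

lemma transposeE:
  assumes "x \<in> Obj (total F)" "y \<in> Obj (total G)" "g \<in> Arr (total F)"
    "Src (total F) g = omap L y" "Tgt (total F) g = x"
  obtains h where "h \<in> Arr (total G)" "Src (total G) h = y" "Tgt (total G) h = omap R x"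
    "\<epsilon> x \<cdot>\<^bsub>total F\<^esub> amap L h = g"
  using transpose[OF assms] by blast

lemma transpose_eqI:
  assumes "\<epsilon> x \<cdot>\<^bsub>total F\<^esub> amap L h = \<epsilon> x \<cdot>\<^bsub>total F\<^esub> amap L k"
    "x \<in> Obj (total F)" "h \<in> Arr (total G)" "k \<in> Arr (total G)"
    "Src (total G) h = Src (total G) k"
    "Tgt (total G) h = omap R x" "Tgt (total G) k = omap R x"
  shows "h = k"
proof -
  have "\<exists>!j. j \<in> Hom (total G) (Src (total G) h) (omap R x)
      \<and> \<epsilon> x \<cdot>\<^bsub>total F\<^esub> amap L j = \<epsilon> x \<cdot>\<^bsub>total F\<^esub> amap L k"
    using adj assms unfolding counit_adj_def by (simp add: Hom_iff)
  then show ?thesis using assms by (auto simp: Hom_iff)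
qed

text \<open>Because the counit is vertical, transposition does not change the image in the base. Hence
  an arrow is vertical as soon as the arrow it transposes is.\<close>

lemma proj_transpose:
  assumes "x \<in> Obj (total F)" "h \<in> Arr (total G)" "Tgt (total G) h = omap R x"
  shows "amap (proj F) (\<epsilon> x \<cdot>\<^bsub>total F\<^esub> amap L h) = amap (proj G) h"
  using assms by simp

end

lemma adjI: "counit_adj E G F L R \<epsilon> \<Longrightarrow> adj E G F L R \<epsilon>"
  by (simp add: adj_def)

lemma fibered_adjunction_counit:
  assumes "fibered_adjunction E G F L R \<eta> \<epsilon>"
  shows "counit_adj E G F L R \<epsilon>"
proof -
  interpret L: fib_functor E G F L
    by unfold_locales (use assms in \<open>simp add: fibered_adjunction_def\<close>)
  interpret R: fib_functor E F G R
    by unfold_locales (use assms in \<open>simp add: fibered_adjunction_def\<close>)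
  have eps: "fibered_nat_trans E F F (L \<odot> R) idF \<epsilon>" and eta: "fibered_nat_trans E G G idF (R \<odot> L) \<eta>"
    using assms by (auto simp: fibered_adjunction_def)
  have e [simp]: "\<epsilon> x \<in> Arr (total F)" "Src (total F) (\<epsilon> x) = omap L (omap R x)" "Tgt (total F) (\<epsilon> x) = x"
    if "x \<in> Obj (total F)" for x
    using eps that by (auto simp: fibered_nat_trans_def nat_trans_def Hom_iff)
  have n [simp]: "\<eta> y \<in> Arr (total G)" "Src (total G) (\<eta> y) = y" "Tgt (total G) (\<eta> y) = omap R (omap L y)"
    if "y \<in> Obj (total G)" for y
    using eta that by (auto simp: fibered_nat_trans_def nat_trans_def Hom_iff)
  have en: "\<epsilon> (Tgt (total F) f) \<cdot>\<^bsub>total F\<^esub> amap L (amap R f) = f \<cdot>\<^bsub>total F\<^esub> \<epsilon> (Src (total F) f)"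
    if "f \<in> Arr (total F)" for f
    using eps that by (auto simp: fibered_nat_trans_def nat_trans_def)
  have nn: "amap R (amap L f) \<cdot>\<^bsub>total G\<^esub> \<eta> (Src (total G) f) = \<eta> (Tgt (total G) f) \<cdot>\<^bsub>total G\<^esub> f"
    if "f \<in> Arr (total G)" for f
    using eta that by (auto simp: fibered_nat_trans_def nat_trans_def)
  have t1: "\<epsilon> (omap L y) \<cdot>\<^bsub>total F\<^esub> amap L (\<eta> y) = Ide (total F) (omap L y)" if "y \<in> Obj (total G)" for y
    using assms that by (simp add: fibered_adjunction_def)
  have t2: "amap R (\<epsilon> x) \<cdot>\<^bsub>total G\<^esub> \<eta> (omap R x) = Ide (total G) (omap R x)" if "x \<in> Obj (total F)" for x
    using assms that by (simp add: fibered_adjunction_def)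
  show ?thesis unfolding counit_adj_def
  proof (intro conjI ballI L.fibf R.fibf eps)
    fix x y g assume x: "x \<in> Obj (total F)" and y: "y \<in> Obj (total G)"
      and "g \<in> Hom (total F) (omap L y) x"
    then have g: "g \<in> Arr (total F)" "Src (total F) g = omap L y" "Tgt (total F) g = x"
      by (auto simp: Hom_iff)
    show "\<exists>!h. h \<in> Hom (total G) y (omap R x) \<and> \<epsilon> x \<cdot>\<^bsub>total F\<^esub> amap L h = g"
    proof (rule ex1I[of _ "amap R g \<cdot>\<^bsub>total G\<^esub> \<eta> y"], intro conjI)
      show "amap R g \<cdot>\<^bsub>total G\<^esub> \<eta> y \<in> Hom (total G) y (omap R x)"
        using x y g by (simp add: Hom_iff)
      have "\<epsilon> x \<cdot>\<^bsub>total F\<^esub> (amap L (amap R g) \<cdot>\<^bsub>total F\<^esub> amap L (\<eta> y))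
          = g \<cdot>\<^bsub>total F\<^esub> (\<epsilon> (omap L y) \<cdot>\<^bsub>total F\<^esub> amap L (\<eta> y))"
        using L.G.T.extend[OF en[OF g(1)], of "amap L (\<eta> y)"] x y g by simp
      then show "\<epsilon> x \<cdot>\<^bsub>total F\<^esub> amap L (amap R g \<cdot>\<^bsub>total G\<^esub> \<eta> y) = g"
        using x y g t1 by simp
    next
      fix h assume "h \<in> Hom (total G) y (omap R x) \<and> \<epsilon> x \<cdot>\<^bsub>total F\<^esub> amap L h = g"
      then have h: "h \<in> Arr (total G)" "Src (total G) h = y" "Tgt (total G) h = omap R x"
        and hg: "g = \<epsilon> x \<cdot>\<^bsub>total F\<^esub> amap L h" by (auto simp: Hom_iff)
      have "amap R g \<cdot>\<^bsub>total G\<^esub> \<eta> y = amap R (\<epsilon> x) \<cdot>\<^bsub>total G\<^esub> (amap R (amap L h) \<cdot>\<^bsub>total G\<^esub> \<eta> y)"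
        using h x y by (simp add: hg)
      also have "\<dots> = (amap R (\<epsilon> x) \<cdot>\<^bsub>total G\<^esub> \<eta> (omap R x)) \<cdot>\<^bsub>total G\<^esub> h"
        using nn[OF h(1)] h x y by simp
      finally show "h = amap R g \<cdot>\<^bsub>total G\<^esub> \<eta> y" using t2 h x by simp
    qed
  qed
qed

context adj
begin

lemma fibered_adjunction: "\<exists>\<eta>. fibered_adjunction E G F L R \<eta> \<epsilon>"
proof -
  have "\<forall>y \<in> Obj (total G). \<exists>h. h \<in> Arr (total G) \<and> Src (total G) h = y \<and> Tgt (total G) h = omap R (omap L y) \<and>
    \<epsilon> (omap L y) \<cdot>\<^bsub>total F\<^esub> amap L h = Ide (total F) (omap L y)"
    by (intro ballI transpose) auto
  then obtain \<eta> where \<eta> [simp]: "\<And>y. y \<in> Obj (total G) \<Longrightarrow> \<eta> y \<in> Arr (total G)"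
      "\<And>y. y \<in> Obj (total G) \<Longrightarrow> Src (total G) (\<eta> y) = y"
      "\<And>y. y \<in> Obj (total G) \<Longrightarrow> Tgt (total G) (\<eta> y) = omap R (omap L y)"
      "\<And>y. y \<in> Obj (total G) \<Longrightarrow> \<epsilon> (omap L y) \<cdot>\<^bsub>total F\<^esub> amap L (\<eta> y) = Ide (total F) (omap L y)"
    unfolding bchoice_iff by blast
  have [simp]: "\<epsilon> (omap L y) \<cdot>\<^bsub>total F\<^esub> (amap L (\<eta> y) \<cdot>\<^bsub>total F\<^esub> u) = u"
    if "y \<in> Obj (total G)" "u \<in> Arr (total F)" "Tgt (total F) u = omap L y" for y u
    using L.G.T.extend[OF \<eta>(4)[OF that(1)], of u] that by simp
  have "fibered_adjunction E G F L R \<eta> \<epsilon>"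
    unfolding fibered_adjunction_def fibered_nat_trans_def nat_trans_def
  proof (intro conjI ballI L.fibf R.fibf)
    fix f assume f: "f \<in> Arr (total G)"
    show "amap (R \<odot> L) f \<cdot>\<^bsub>total G\<^esub> \<eta> (Src (total G) f) = \<eta> (Tgt (total G) f) \<cdot>\<^bsub>total G\<^esub> amap idF f"
      by (rule transpose_eqI[of "omap L (Tgt (total G) f)"]) (use f in \<open>simp_all add: counit_nat'\<close>)
  next
    fix y assume y: "y \<in> Obj (total G)"
    show "amap (proj G) (\<eta> y) = Ide E (omap (proj G) y)"
      using proj_transpose[of "omap L y" "\<eta> y"] y by simp
  next
    fix x assume x: "x \<in> Obj (total F)"
    show "amap R (\<epsilon> x) \<cdot>\<^bsub>total G\<^esub> \<eta> (omap R x) = Ide (total G) (omap R x)"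
      by (rule transpose_eqI[of x]) (use x in \<open>simp_all add: counit_nat'\<close>)
  qed (simp_all add: Hom_iff counit_nat)
  then show ?thesis by (intro exI)
qed

end

text \<open>The unit consists of the transposes of the identities, so the two presentations determine the
  same class of right adjoints.\<close>

lemma fibered_right_adjoint_iff:
  "fibered_right_adjoint E F G R \<longleftrightarrow> (\<exists>L \<epsilon>. counit_adj E G F L R \<epsilon>)"
proof
  assume "fibered_right_adjoint E F G R"
  then obtain L \<eta> \<epsilon> where "fibered_adjunction E G F L R \<eta> \<epsilon>"
    unfolding fibered_right_adjoint_def by (elim exE)
  then show "\<exists>L \<epsilon>. counit_adj E G F L R \<epsilon>" by (intro exI) (rule fibered_adjunction_counit)
next
  assume "\<exists>L \<epsilon>. counit_adj E G F L R \<epsilon>"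
  then obtain L \<epsilon> where "counit_adj E G F L R \<epsilon>" by (elim exE)
  then have "\<exists>\<eta>. fibered_adjunction E G F L R \<eta> \<epsilon>" by (intro adj.fibered_adjunction adjI)
  then show "fibered_right_adjoint E F G R"
    unfolding fibered_right_adjoint_def by (elim exE) (intro exI)
qed

lemma counit_adj_comp:
  assumes "counit_adj E G F L1 R1 \<epsilon>1" "counit_adj E H G L2 R2 \<epsilon>2"
  shows "counit_adj E H F (L1 \<odot> L2) (R2 \<odot> R1)
    (\<lambda>x. \<epsilon>1 x \<cdot>\<^bsub>total F\<^esub> amap L1 (\<epsilon>2 (omap R1 x)))"
proof -
  interpret a: adj E G F L1 R1 \<epsilon>1 using assms(1) by (rule adjI)
  interpret b: adj E H G L2 R2 \<epsilon>2 using assms(2) by (rule adjI)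
  show ?thesis unfolding counit_adj_def fibered_nat_trans_def nat_trans_def
  proof (intro conjI ballI)
    show "fibered_functor E H F (L1 \<odot> L2)" "fibered_functor E F H (R2 \<odot> R1)"
      by (auto intro: fibered_functor_comp a.L.fibf a.R.fibf b.L.fibf b.R.fibf)
  next
    fix f assume f: "f \<in> Arr (total F)"
    have "amap L1 (\<epsilon>2 (omap R1 (Tgt (total F) f))) \<cdot>\<^bsub>total F\<^esub> amap L1 (amap L2 (amap R2 (amap R1 f)))
      = amap L1 (amap R1 f \<cdot>\<^bsub>total G\<^esub> \<epsilon>2 (omap R1 (Src (total F) f)))"
      using f b.counit_nat[of "amap R1 f"] by (simp flip: a.L.f.amap_Cmp)
    then show "amap idF f \<cdot>\<^bsub>total F\<^esub> (\<epsilon>1 (Src (total F) f) \<cdot>\<^bsub>total F\<^esub> amap L1 (\<epsilon>2 (omap R1 (Src (total F) f)))) =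
         \<epsilon>1 (Tgt (total F) f) \<cdot>\<^bsub>total F\<^esub> amap L1 (\<epsilon>2 (omap R1 (Tgt (total F) f))) \<cdot>\<^bsub>total F\<^esub>
         amap ((L1 \<odot> L2) \<odot> R2 \<odot> R1) f"
      using f by (simp add: a.counit_nat')
  next
    fix x y g assume x: "x \<in> Obj (total F)" and y: "y \<in> Obj (total H)"
      and g0: "g \<in> Hom (total F) (omap (L1 \<odot> L2) y) x"
    then have g: "g \<in> Arr (total F)" "Src (total F) g = omap L1 (omap L2 y)" "Tgt (total F) g = x"
      by (auto simp: Hom_iff)
    obtain k where k: "k \<in> Arr (total G)" "Src (total G) k = omap L2 y" "Tgt (total G) k = omap R1 x"
      "\<epsilon>1 x \<cdot>\<^bsub>total F\<^esub> amap L1 k = g" using a.transpose[of x "omap L2 y" g] x y g by auto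
    obtain h where h: "h \<in> Arr (total H)" "Src (total H) h = y" "Tgt (total H) h = omap R2 (omap R1 x)"
      "\<epsilon>2 (omap R1 x) \<cdot>\<^bsub>total G\<^esub> amap L2 h = k" using b.transpose[of "omap R1 x" y k] x y k by auto
    show "\<exists>!h. h \<in> Hom (total H) y (omap (R2 \<odot> R1) x) \<and>
      (\<epsilon>1 x \<cdot>\<^bsub>total F\<^esub> amap L1 (\<epsilon>2 (omap R1 x))) \<cdot>\<^bsub>total F\<^esub> amap (L1 \<odot> L2) h = g"
    proof (rule ex1I[of _ h])
      have "amap L1 (\<epsilon>2 (omap R1 x)) \<cdot>\<^bsub>total F\<^esub> amap L1 (amap L2 h) = amap L1 k"
        using h x by (simp flip: a.L.f.amap_Cmp)
      then show "h \<in> Hom (total H) y (omap (R2 \<odot> R1) x) \<and>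
      (\<epsilon>1 x \<cdot>\<^bsub>total F\<^esub> amap L1 (\<epsilon>2 (omap R1 x))) \<cdot>\<^bsub>total F\<^esub> amap (L1 \<odot> L2) h = g"
        using x h k by (simp add: Hom_iff)
    next
      fix h' assume A: "h' \<in> Hom (total H) y (omap (R2 \<odot> R1) x) \<and>
      (\<epsilon>1 x \<cdot>\<^bsub>total F\<^esub> amap L1 (\<epsilon>2 (omap R1 x))) \<cdot>\<^bsub>total F\<^esub> amap (L1 \<odot> L2) h' = g"
      then have h': "h' \<in> Arr (total H)" "Src (total H) h' = y" "Tgt (total H) h' = omap R2 (omap R1 x)"
        by (auto simp: Hom_iff)
      have "\<epsilon>2 (omap R1 x) \<cdot>\<^bsub>total G\<^esub> amap L2 h' = k"
        by (rule a.transpose_eqI[of x]) (use A h' h k x in auto)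
      then show "h' = h"
        by (intro b.transpose_eqI[of "omap R1 x"]) (use h' h x in auto)
    qed
  qed (simp_all add: Hom_iff)
qed

text \<open>The witness hidden in \<open>fibered_iso\<close>, kept explicit so that it can be composed with counits.\<close>

definition vertical_iso where
  "vertical_iso E F G R S \<alpha> \<longleftrightarrow> fibered_nat_trans E F G R S \<alpha> \<and>
    (\<forall>x \<in> Obj (total F). iso_arr (total G) (\<alpha> x))"

lemma vertical_isoD:
  assumes "vertical_iso E F G R S \<alpha>" "x \<in> Obj (total F)"
  shows "\<alpha> x \<in> Arr (total G)" "Src (total G) (\<alpha> x) = omap R x" "Tgt (total G) (\<alpha> x) = omap S x"
    "amap (proj G) (\<alpha> x) = Ide E (omap (proj F) x)"
    "\<exists>\<beta>. \<beta> \<in> Arr (total G) \<and> Src (total G) \<beta> = omap S x \<and> Tgt (total G) \<beta> = omap R x \<and>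
      \<beta> \<cdot>\<^bsub>total G\<^esub> \<alpha> x = Ide (total G) (omap R x) \<and> \<alpha> x \<cdot>\<^bsub>total G\<^esub> \<beta> = Ide (total G) (omap S x)"
proof -
  show *: "\<alpha> x \<in> Arr (total G)" "Src (total G) (\<alpha> x) = omap R x" "Tgt (total G) (\<alpha> x) = omap S x"
    "amap (proj G) (\<alpha> x) = Ide E (omap (proj F) x)"
    using assms unfolding vertical_iso_def fibered_nat_trans_def nat_trans_def by (simp_all add: Hom_iff)
  have "iso_arr (total G) (\<alpha> x)" using assms by (simp add: vertical_iso_def)
  then show "\<exists>\<beta>. \<beta> \<in> Arr (total G) \<and> Src (total G) \<beta> = omap S x \<and> Tgt (total G) \<beta> = omap R x \<and>
      \<beta> \<cdot>\<^bsub>total G\<^esub> \<alpha> x = Ide (total G) (omap R x) \<and> \<alpha> x \<cdot>\<^bsub>total G\<^esub> \<beta> = Ide (total G) (omap S x)"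
    unfolding iso_arr_def *(2,3) Bex_def Hom_iff by blast
qed

lemma vertical_iso_nat:
  assumes "vertical_iso E F G R S \<alpha>" "f \<in> Arr (total F)"
  shows "amap S f \<cdot>\<^bsub>total G\<^esub> \<alpha> (Src (total F) f) = \<alpha> (Tgt (total F) f) \<cdot>\<^bsub>total G\<^esub> amap R f"
  using assms unfolding vertical_iso_def fibered_nat_trans_def nat_trans_def by simp

context adj
begin

text \<open>The isomorphism \<open>R' x \<cong> R x\<close> matches the solutions of the two transposition problems, so the new
  counit is the old one precomposed with its image under \<open>L\<close>.\<close>

lemma transfer_right:
  assumes R': "fibered_functor E F G R'" and iso: "vertical_iso E F G R' R \<alpha>"
  shows "counit_adj E G F L R' (\<lambda>x. \<epsilon> x \<cdot>\<^bsub>total F\<^esub> amap L (\<alpha> x))"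
proof -
  interpret R': fib_functor E F G R' using R' by (rule fib_functorI)
  note \<alpha> [simp] = vertical_isoD(1-4)[OF iso]
  show ?thesis unfolding counit_adj_def fibered_nat_trans_def nat_trans_def
  proof (intro conjI ballI L.fibf R')
    fix f assume f: "f \<in> Arr (total F)"
    have "amap L (\<alpha> (Tgt (total F) f)) \<cdot>\<^bsub>total F\<^esub> amap L (amap R' f) = amap L (amap R f \<cdot>\<^bsub>total G\<^esub> \<alpha> (Src (total F) f))"
      using f vertical_iso_nat[OF iso f] by (simp flip: L.f.amap_Cmp)
    then show "amap idF f \<cdot>\<^bsub>total F\<^esub> (\<epsilon> (Src (total F) f) \<cdot>\<^bsub>total F\<^esub> amap L (\<alpha> (Src (total F) f))) =
         \<epsilon> (Tgt (total F) f) \<cdot>\<^bsub>total F\<^esub> amap L (\<alpha> (Tgt (total F) f)) \<cdot>\<^bsub>total F\<^esub> amap (L \<odot> R') f"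
      using f by (simp add: counit_nat')
  next
    fix x y g assume x: "x \<in> Obj (total F)" and y: "y \<in> Obj (total G)"
      and g0: "g \<in> Hom (total F) (omap L y) x"
    then have g: "g \<in> Arr (total F)" "Src (total F) g = omap L y" "Tgt (total F) g = x"
      by (auto simp: Hom_iff)
    obtain k where k: "k \<in> Arr (total G)" "Src (total G) k = y" "Tgt (total G) k = omap R x"
      "\<epsilon> x \<cdot>\<^bsub>total F\<^esub> amap L k = g" using transpose[of x y g] x y g by auto
    obtain \<beta> where b: "\<beta> \<in> Arr (total G)" "Src (total G) \<beta> = omap R x" "Tgt (total G) \<beta> = omap R' x"
      "\<beta> \<cdot>\<^bsub>total G\<^esub> \<alpha> x = Ide (total G) (omap R' x)" "\<alpha> x \<cdot>\<^bsub>total G\<^esub> \<beta> = Ide (total G) (omap R x)"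
      using vertical_isoD(5)[OF iso x] by auto
    show "\<exists>!h. h \<in> Hom (total G) y (omap R' x) \<and>
      (\<epsilon> x \<cdot>\<^bsub>total F\<^esub> amap L (\<alpha> x)) \<cdot>\<^bsub>total F\<^esub> amap L h = g"
    proof (rule ex1I[of _ "\<beta> \<cdot>\<^bsub>total G\<^esub> k"])
      have "\<alpha> x \<cdot>\<^bsub>total G\<^esub> (\<beta> \<cdot>\<^bsub>total G\<^esub> k) = k"
        using L.F.T.extend[OF b(5), of k] b k x by simp
      moreover have "amap L (\<alpha> x) \<cdot>\<^bsub>total F\<^esub> (amap L \<beta> \<cdot>\<^bsub>total F\<^esub> amap L k) = amap L (\<alpha> x \<cdot>\<^bsub>total G\<^esub> (\<beta> \<cdot>\<^bsub>total G\<^esub> k))"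
        using b k x by simp
      ultimately show "\<beta> \<cdot>\<^bsub>total G\<^esub> k \<in> Hom (total G) y (omap R' x) \<and>
      (\<epsilon> x \<cdot>\<^bsub>total F\<^esub> amap L (\<alpha> x)) \<cdot>\<^bsub>total F\<^esub> amap L (\<beta> \<cdot>\<^bsub>total G\<^esub> k) = g"
        using x b k by (simp add: Hom_iff)
    next
      fix h assume A: "h \<in> Hom (total G) y (omap R' x) \<and>
      (\<epsilon> x \<cdot>\<^bsub>total F\<^esub> amap L (\<alpha> x)) \<cdot>\<^bsub>total F\<^esub> amap L h = g"
      then have h: "h \<in> Arr (total G)" "Src (total G) h = y" "Tgt (total G) h = omap R' x"
        by (auto simp: Hom_iff)
      have "\<alpha> x \<cdot>\<^bsub>total G\<^esub> h = k"
        by (rule transpose_eqI[of x]) (use A h k x in auto)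
      then show "h = \<beta> \<cdot>\<^bsub>total G\<^esub> k" using L.F.T.extend[OF b(4), of h] b h x by simp
    qed
  qed (simp_all add: Hom_iff)
qed

lemma transfer_left:
  assumes L': "fibered_functor E G F L'" and iso: "vertical_iso E G F L' L \<theta>"
  shows "counit_adj E G F L' R (\<lambda>x. \<epsilon> x \<cdot>\<^bsub>total F\<^esub> \<theta> (omap R x))"
proof -
  interpret L': fib_functor E G F L' using L' by (rule fib_functorI)
  note \<theta> [simp] = vertical_isoD(1-4)[OF iso]
  have nat: "\<theta> z \<cdot>\<^bsub>total F\<^esub> amap L' h = amap L h \<cdot>\<^bsub>total F\<^esub> \<theta> (Src (total G) h)"
    if "h \<in> Arr (total G)" "z = Tgt (total G) h" for h z
    using vertical_iso_nat[OF iso] that by simp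
  show ?thesis unfolding counit_adj_def fibered_nat_trans_def nat_trans_def
  proof (intro conjI ballI R.fibf L')
    fix f assume f: "f \<in> Arr (total F)"
    then show "amap idF f \<cdot>\<^bsub>total F\<^esub> (\<epsilon> (Src (total F) f) \<cdot>\<^bsub>total F\<^esub> \<theta> (omap R (Src (total F) f))) =
         \<epsilon> (Tgt (total F) f) \<cdot>\<^bsub>total F\<^esub> \<theta> (omap R (Tgt (total F) f)) \<cdot>\<^bsub>total F\<^esub> amap (L' \<odot> R) f"
      by (simp add: counit_nat' nat)
  next
    fix x y g assume x: "x \<in> Obj (total F)" and y: "y \<in> Obj (total G)"
      and g0: "g \<in> Hom (total F) (omap L' y) x"
    then have g: "g \<in> Arr (total F)" "Src (total F) g = omap L' y" "Tgt (total F) g = x"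
      by (auto simp: Hom_iff)
    obtain \<beta> where b: "\<beta> \<in> Arr (total F)" "Src (total F) \<beta> = omap L y" "Tgt (total F) \<beta> = omap L' y"
      "\<beta> \<cdot>\<^bsub>total F\<^esub> \<theta> y = Ide (total F) (omap L' y)" "\<theta> y \<cdot>\<^bsub>total F\<^esub> \<beta> = Ide (total F) (omap L y)"
      using vertical_isoD(5)[OF iso y] by auto
    obtain k where k: "k \<in> Arr (total G)" "Src (total G) k = y" "Tgt (total G) k = omap R x"
      "\<epsilon> x \<cdot>\<^bsub>total F\<^esub> amap L k = g \<cdot>\<^bsub>total F\<^esub> \<beta>" using transpose[of x y "g \<cdot>\<^bsub>total F\<^esub> \<beta>"] x y g b by auto
    show "\<exists>!h. h \<in> Hom (total G) y (omap R x) \<and>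
      (\<epsilon> x \<cdot>\<^bsub>total F\<^esub> \<theta> (omap R x)) \<cdot>\<^bsub>total F\<^esub> amap L' h = g"
    proof (rule ex1I[of _ k])
      have "\<epsilon> x \<cdot>\<^bsub>total F\<^esub> (amap L k \<cdot>\<^bsub>total F\<^esub> \<theta> y) = g"
        using L.G.T.extend[OF k(4), of "\<theta> y"] k b x y g by simp
      then show "k \<in> Hom (total G) y (omap R x) \<and>
      (\<epsilon> x \<cdot>\<^bsub>total F\<^esub> \<theta> (omap R x)) \<cdot>\<^bsub>total F\<^esub> amap L' k = g"
        using x k y by (simp add: Hom_iff nat)
    next
      fix h assume A: "h \<in> Hom (total G) y (omap R x) \<and>
      (\<epsilon> x \<cdot>\<^bsub>total F\<^esub> \<theta> (omap R x)) \<cdot>\<^bsub>total F\<^esub> amap L' h = g"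
      then have h: "h \<in> Arr (total G)" "Src (total G) h = y" "Tgt (total G) h = omap R x"
        by (auto simp: Hom_iff)
      have "g = \<epsilon> x \<cdot>\<^bsub>total F\<^esub> (amap L h \<cdot>\<^bsub>total F\<^esub> \<theta> y)"
        using A h x y by (simp add: nat)
      then have "\<epsilon> x \<cdot>\<^bsub>total F\<^esub> amap L h = g \<cdot>\<^bsub>total F\<^esub> \<beta>" using h b x y by simp
      then show "h = k"
        by (intro transpose_eqI[of x]) (use h k x in auto)
    qed
  qed (simp_all add: Hom_iff)
qed

end

lemma right_adjoint_unique:
  assumes "counit_adj E G F L R \<epsilon>" "counit_adj E G F L R' \<epsilon>'"
  shows "\<exists>\<kappa>. vertical_iso E F G R R' \<kappa>"
proof -
  interpret a: adj E G F L R \<epsilon> using assms(1) by (rule adjI)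
  interpret b: adj E G F L R' \<epsilon>' using assms(2) by (rule adjI)
  have "\<forall>x \<in> Obj (total F). \<exists>k. k \<in> Arr (total G) \<and> Src (total G) k = omap R x \<and> Tgt (total G) k = omap R' x \<and>
      \<epsilon>' x \<cdot>\<^bsub>total F\<^esub> amap L k = \<epsilon> x"
    by (intro ballI b.transpose) auto
  then obtain k where k [simp]: "\<And>x. x \<in> Obj (total F) \<Longrightarrow> k x \<in> Arr (total G)"
      "\<And>x. x \<in> Obj (total F) \<Longrightarrow> Src (total G) (k x) = omap R x"
      "\<And>x. x \<in> Obj (total F) \<Longrightarrow> Tgt (total G) (k x) = omap R' x"
      "\<And>x. x \<in> Obj (total F) \<Longrightarrow> \<epsilon>' x \<cdot>\<^bsub>total F\<^esub> amap L (k x) = \<epsilon> x"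
    unfolding bchoice_iff by blast
  have "\<forall>x \<in> Obj (total F). \<exists>k. k \<in> Arr (total G) \<and> Src (total G) k = omap R' x \<and> Tgt (total G) k = omap R x \<and>
      \<epsilon> x \<cdot>\<^bsub>total F\<^esub> amap L k = \<epsilon>' x"
    by (intro ballI a.transpose) auto
  then obtain j where j [simp]: "\<And>x. x \<in> Obj (total F) \<Longrightarrow> j x \<in> Arr (total G)"
      "\<And>x. x \<in> Obj (total F) \<Longrightarrow> Src (total G) (j x) = omap R' x"
      "\<And>x. x \<in> Obj (total F) \<Longrightarrow> Tgt (total G) (j x) = omap R x"
      "\<And>x. x \<in> Obj (total F) \<Longrightarrow> \<epsilon> x \<cdot>\<^bsub>total F\<^esub> amap L (j x) = \<epsilon>' x"
    unfolding bchoice_iff by blast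
  have k': "\<epsilon>' x \<cdot>\<^bsub>total F\<^esub> (amap L (k x) \<cdot>\<^bsub>total F\<^esub> u) = \<epsilon> x \<cdot>\<^bsub>total F\<^esub> u"
    and j': "\<epsilon> x \<cdot>\<^bsub>total F\<^esub> (amap L (j x) \<cdot>\<^bsub>total F\<^esub> v) = \<epsilon>' x \<cdot>\<^bsub>total F\<^esub> v"
    if "x \<in> Obj (total F)" "u \<in> Arr (total F)" "Tgt (total F) u = omap L (omap R x)"
       "v \<in> Arr (total F)" "Tgt (total F) v = omap L (omap R' x)" for x u v
    using a.L.G.T.extend[OF k(4)[OF that(1)], of u] a.L.G.T.extend[OF j(4)[OF that(1)], of v] that by simp_all
  have "vertical_iso E F G R R' k"
    unfolding vertical_iso_def fibered_nat_trans_def nat_trans_def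
  proof (intro conjI ballI)
    fix f assume f: "f \<in> Arr (total F)"
    show "amap R' f \<cdot>\<^bsub>total G\<^esub> k (Src (total F) f) = k (Tgt (total F) f) \<cdot>\<^bsub>total G\<^esub> amap R f"
      by (rule b.transpose_eqI[of "Tgt (total F) f"])
        (use f in \<open>simp_all add: b.counit_nat' a.counit_nat k'[where v = "amap L (amap R' f)"]\<close>)
  next
    fix x assume x: "x \<in> Obj (total F)"
    show "amap (proj G) (k x) = Ide E (omap (proj F) x)"
      using b.proj_transpose[of x "k x"] x by simp
    have "j x \<cdot>\<^bsub>total G\<^esub> k x = Ide (total G) (omap R x)"
      by (rule a.transpose_eqI[of x]) (use x in \<open>simp_all add: j'[where u = "amap L (Ide (total G) (omap R x))"]\<close>)
    moreover have "k x \<cdot>\<^bsub>total G\<^esub> j x = Ide (total G) (omap R' x)"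
      by (rule b.transpose_eqI[of x]) (use x in \<open>simp_all add: k'[where v = "amap L (Ide (total G) (omap R' x))"]\<close>)
    ultimately show "iso_arr (total G) (k x)"
      unfolding iso_arr_def using x by (intro conjI bexI[of _ "j x"]) (auto simp: Hom_iff)
  qed (simp_all add: Hom_iff)
  then show ?thesis by (intro exI)
qed

lemma cartesian_arrD:
  assumes "cartesian_arr E F f" "g \<in> Arr (total F)" "Tgt (total F) g = Tgt (total F) f"
    "w \<in> Arr E" "Src E w = omap (proj F) (Src (total F) g)" "Tgt E w = omap (proj F) (Src (total F) f)"
    "amap (proj F) f \<cdot>\<^bsub>E\<^esub> w = amap (proj F) g"
  shows "\<exists>!h. h \<in> Hom (total F) (Src (total F) g) (Src (total F) f) \<and>
    f \<cdot>\<^bsub>total F\<^esub> h = g \<and> amap (proj F) h = w"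
proof -
  have "w \<in> Hom E (omap (proj F) (Src (total F) g)) (omap (proj F) (Src (total F) f))"
    using assms by (simp add: Hom_iff)
  with assms show ?thesis unfolding cartesian_arr_def Let_def by simp
qed

text \<open>The value \<open>r\<close> of a right adjoint at a single object \<open>x\<close>, with its counit component \<open>e\<close> lying
  over an identity.\<close>

definition couniversal ::
  "('bo, 'bm) cat \<Rightarrow> ('p, 'n, 'bo, 'bm) fib_data \<Rightarrow> ('o, 'm, 'bo, 'bm) fib_data
     \<Rightarrow> ('p, 'n, 'o, 'm) fun_data \<Rightarrow> 'o \<Rightarrow> 'p \<Rightarrow> 'm \<Rightarrow> bool" where
  "couniversal E G F L x r e \<longleftrightarrow>
     r \<in> Obj (total G) \<and> e \<in> Hom (total F) (omap L r) x \<and>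
     omap (proj G) r = omap (proj F) x \<and> amap (proj F) e = Ide E (omap (proj F) x) \<and>
     (\<forall>y \<in> Obj (total G). \<forall>g \<in> Hom (total F) (omap L y) x.
        \<exists>!h. h \<in> Hom (total G) y r \<and> e \<cdot>\<^bsub>total F\<^esub> amap L h = g)"

text \<open>A right adjoint is assembled from its values, as in ordinary category theory; what is special
  to the fibered setting is that it preserves cartesian arrows. An arrow into the target of \<open>R f\<close> that
  factors in the base transposes to an arrow into the target of \<open>f\<close> with the same image in the base,
  the latter factors through the cartesian \<open>f\<close>, and the factor is transposed back.\<close>

lemma pointwise_right_adjoint:
  fixes E :: "('bo, 'bm) cat" and G :: "('p, 'n, 'bo, 'bm) fib_data"
    and F :: "('o, 'm, 'bo, 'bm) fib_data"
  assumes L: "fibered_functor E G F L"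
    and ex: "\<And>x. x \<in> Obj (total F) \<Longrightarrow> \<exists>r e. couniversal E G F L x r e"
  shows "\<exists>R \<epsilon>. counit_adj E G F L R \<epsilon>"
proof -
  interpret L: fib_functor E G F L using L by (rule fib_functorI)
  obtain r e where re: "\<And>x. x \<in> Obj (total F) \<Longrightarrow> couniversal E G F L x (r x) (e x)"
    using ex by metis
  have r [simp]: "r x \<in> Obj (total G)" "omap (proj G) (r x) = omap (proj F) x"
    and e [simp]: "e x \<in> Arr (total F)" "Src (total F) (e x) = omap L (r x)" "Tgt (total F) (e x) = x"
      "amap (proj F) (e x) = Ide E (omap (proj F) x)"
    and univ: "\<And>y g. \<lbrakk>y \<in> Obj (total G); g \<in> Hom (total F) (omap L y) x\<rbrakk> \<Longrightarrow>
       \<exists>!h. h \<in> Hom (total G) y (r x) \<and> e x \<cdot>\<^bsub>total F\<^esub> amap L h = g"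
    if "x \<in> Obj (total F)" for x
    using re[OF that] unfolding couniversal_def by (simp_all add: Hom_iff)
  have cancel: "h = k" if "e x \<cdot>\<^bsub>total F\<^esub> amap L h = e x \<cdot>\<^bsub>total F\<^esub> amap L k" "x \<in> Obj (total F)"
      "h \<in> Arr (total G)" "k \<in> Arr (total G)" "Src (total G) h = Src (total G) k"
      "Tgt (total G) h = r x" "Tgt (total G) k = r x" for h k x
  proof -
    have "e x \<cdot>\<^bsub>total F\<^esub> amap L k \<in> Hom (total F) (omap L (Src (total G) k)) x"
      using that by (simp add: Hom_iff)
    from univ[OF that(2) _ this] that show ?thesis by (auto simp: Hom_iff)
  qed
  have ex_h: "\<exists>h. h \<in> Arr (total G) \<and> Src (total G) h = y \<and> Tgt (total G) h = r x \<and>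
      e x \<cdot>\<^bsub>total F\<^esub> amap L h = g"
    if "x \<in> Obj (total F)" "y \<in> Obj (total G)" "g \<in> Arr (total F)"
    "Src (total F) g = omap L y" "Tgt (total F) g = x" for x y g
    using univ[OF that(1,2), of g] that by (auto simp: Hom_iff)
  have proj_h: "amap (proj F) (e x \<cdot>\<^bsub>total F\<^esub> amap L h) = amap (proj G) h"
    if "x \<in> Obj (total F)" "h \<in> Arr (total G)" "Tgt (total G) h = r x" for x h
    using that by simp
  have "\<forall>f \<in> Arr (total F). \<exists>h. h \<in> Arr (total G) \<and> Src (total G) h = r (Src (total F) f)
      \<and> Tgt (total G) h = r (Tgt (total F) f) \<and>
      e (Tgt (total F) f) \<cdot>\<^bsub>total F\<^esub> amap L h = f \<cdot>\<^bsub>total F\<^esub> e (Src (total F) f)"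
    by (intro ballI ex_h) auto
  then obtain a where a [simp]: "\<And>f. f \<in> Arr (total F) \<Longrightarrow> a f \<in> Arr (total G)"
      "\<And>f. f \<in> Arr (total F) \<Longrightarrow> Src (total G) (a f) = r (Src (total F) f)"
      "\<And>f. f \<in> Arr (total F) \<Longrightarrow> Tgt (total G) (a f) = r (Tgt (total F) f)"
      and ae: "\<And>f. f \<in> Arr (total F) \<Longrightarrow>
        e (Tgt (total F) f) \<cdot>\<^bsub>total F\<^esub> amap L (a f) = f \<cdot>\<^bsub>total F\<^esub> e (Src (total F) f)"
    unfolding bchoice_iff by blast
  have ae': "e z \<cdot>\<^bsub>total F\<^esub> (amap L (a f) \<cdot>\<^bsub>total F\<^esub> u) = f \<cdot>\<^bsub>total F\<^esub> (e (Src (total F) f) \<cdot>\<^bsub>total F\<^esub> u)"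
    if "f \<in> Arr (total F)" "u \<in> Arr (total F)" "Tgt (total F) u = omap L (r (Src (total F) f))"
      "z = Tgt (total F) f" for f u z
    using L.G.T.extend[OF ae[OF that(1)], of u] that by simp
  have pa [simp]: "amap (proj G) (a f) = amap (proj F) f" if "f \<in> Arr (total F)" for f
    using proj_h[of "Tgt (total F) f" "a f"] ae[OF that] that by simp
  define R :: "('o, 'm, 'p, 'n) fun_data" where "R = \<lparr>omap = r, amap = a\<rparr>"
  have R [simp]: "omap R = r" "amap R = a" by (simp_all add: R_def)
  have fR: "fibered_functor E F G R"
    unfolding fibered_functor_def is_functor_def
  proof (intro conjI ballI allI impI)
    fix x assume x: "x \<in> Obj (total F)"
    show "amap R (Ide (total F) x) = Ide (total G) (omap R x)"
      by (rule cancel[of x]) (use x ae[of "Ide (total F) x"] in \<open>simp_all\<close>)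
  next
    fix f g assume fg: "f \<in> Arr (total F)" "g \<in> Arr (total F)" "Src (total F) g = Tgt (total F) f"
    show "amap R (g \<cdot>\<^bsub>total F\<^esub> f) = amap R g \<cdot>\<^bsub>total G\<^esub> amap R f"
      by (rule cancel[of "Tgt (total F) g"])
        (use fg ae[of "g \<cdot>\<^bsub>total F\<^esub> f"] ae[of f] in \<open>simp_all add: ae'\<close>)
  next
    fix f assume c: "cartesian_arr E F f"
    then have f: "f \<in> Arr (total F)" by (simp add: cartesian_arr_def Let_def)
    show "cartesian_arr E G (amap R f)"
      unfolding cartesian_arr_def Let_def
    proof (intro conjI ballI impI)
      show "amap R f \<in> Arr (total G)" using f by simp
      fix g w assume g: "g \<in> Arr (total G)"
        and "w \<in> Hom E (omap (proj G) (Src (total G) g)) (omap (proj G) (Src (total G) (amap R f)))"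
        and "Tgt (total G) g = Tgt (total G) (amap R f) \<and> amap (proj G) (amap R f) \<cdot>\<^bsub>E\<^esub> w = amap (proj G) g"
      then have w: "w \<in> Arr E" "Src E w = omap (proj G) (Src (total G) g)"
          "Tgt E w = omap (proj F) (Src (total F) f)"
        and tg: "Tgt (total G) g = r (Tgt (total F) f)" and wg: "amap (proj F) f \<cdot>\<^bsub>E\<^esub> w = amap (proj G) g"
        using f by (auto simp: Hom_iff)
      let ?g = "e (Tgt (total F) f) \<cdot>\<^bsub>total F\<^esub> amap L g"
      have g': "?g \<in> Arr (total F)" "Src (total F) ?g = omap L (Src (total G) g)" "Tgt (total F) ?g = Tgt (total F) f"
        "amap (proj F) ?g = amap (proj G) g" using f g tg by simp_all
      have "\<exists>!h. h \<in> Hom (total F) (Src (total F) ?g) (Src (total F) f) \<and> f \<cdot>\<^bsub>total F\<^esub> h = ?g \<and> amap (proj F) h = w"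
        by (rule cartesian_arrD[OF c g'(1,3) w(1)]) (use g' w wg g in simp_all)
      then obtain k where k: "k \<in> Arr (total F)" "Src (total F) k = omap L (Src (total G) g)"
          "Tgt (total F) k = Src (total F) f" "f \<cdot>\<^bsub>total F\<^esub> k = ?g" "amap (proj F) k = w"
        and uk: "\<And>k'. \<lbrakk>k' \<in> Arr (total F); Src (total F) k' = omap L (Src (total G) g);
          Tgt (total F) k' = Src (total F) f; f \<cdot>\<^bsub>total F\<^esub> k' = ?g; amap (proj F) k' = w\<rbrakk> \<Longrightarrow> k' = k"
        unfolding Hom_iff g'(2) by (elim ex1E conjE) blast
      obtain h where h: "h \<in> Arr (total G)" "Src (total G) h = Src (total G) g"
         "Tgt (total G) h = r (Src (total F) f)" "e (Src (total F) f) \<cdot>\<^bsub>total F\<^esub> amap L h = k"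
        using ex_h[of "Src (total F) f" "Src (total G) g" k] f g k by auto
      show "\<exists>!h. h \<in> Hom (total G) (Src (total G) g) (Src (total G) (amap R f)) \<and>
          amap R f \<cdot>\<^bsub>total G\<^esub> h = g \<and> amap (proj G) h = w"
      proof (rule ex1I[of _ h], intro conjI)
        show "h \<in> Hom (total G) (Src (total G) g) (Src (total G) (amap R f))"
          using h f by (simp add: Hom_iff)
        show "amap R f \<cdot>\<^bsub>total G\<^esub> h = g"
          by (rule cancel[of "Tgt (total F) f"]) (use f h k g tg in \<open>simp_all add: ae'\<close>)
        show "amap (proj G) h = w" using proj_h[of "Src (total F) f" h] f h k by simp
      next
        fix h' assume A: "h' \<in> Hom (total G) (Src (total G) g) (Src (total G) (amap R f)) \<and>
          amap R f \<cdot>\<^bsub>total G\<^esub> h' = g \<and> amap (proj G) h' = w"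
        then have h': "h' \<in> Arr (total G)" "Src (total G) h' = Src (total G) g"
           "Tgt (total G) h' = r (Src (total F) f)" using f by (auto simp: Hom_iff)
        have "e (Src (total F) f) \<cdot>\<^bsub>total F\<^esub> amap L h' = k"
        proof (rule uk)
          have "f \<cdot>\<^bsub>total F\<^esub> (e (Src (total F) f) \<cdot>\<^bsub>total F\<^esub> amap L h') = e (Tgt (total F) f) \<cdot>\<^bsub>total F\<^esub> amap L (a f \<cdot>\<^bsub>total G\<^esub> h')"
            using f h' by (simp add: ae')
          then show "f \<cdot>\<^bsub>total F\<^esub> (e (Src (total F) f) \<cdot>\<^bsub>total F\<^esub> amap L h') = ?g" using A by simp
          show "amap (proj F) (e (Src (total F) f) \<cdot>\<^bsub>total F\<^esub> amap L h') = w"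
            using A proj_h[of "Src (total F) f" h'] f h' by simp
        qed (use f h' in simp_all)
        then show "h' = h" by (intro cancel[of "Src (total F) f"]) (use f h h' in simp_all)
      qed
    qed
  qed (simp_all add: L.F.fib L.G.fib Hom_iff)
  have "counit_adj E G F L R e"
    unfolding counit_adj_def fibered_nat_trans_def nat_trans_def
    by (intro conjI ballI L fR) (simp_all add: ae univ, simp_all add: Hom_iff)
  then show ?thesis by (intro exI)
qed

section \<open>Pullbacks, exponentials and dependent products\<close>

lemma slice_simps [simp]:
  "Obj (slice C x) = {f \<in> Arr C. Tgt C f = x}"
  "Src (slice C x) (f, g, u) = f" "Tgt (slice C x) (f, g, u) = g"
  "Ide (slice C x) f = (f, f, Ide C (Src C f))"
  "(g, h, v) \<cdot>\<^bsub>slice C x\<^esub> (f, g', u) = (f, h, v \<cdot>\<^bsub>C\<^esub> u)"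
  "(f, g, u) \<in> Arr (slice C x) \<longleftrightarrow> f \<in> Arr C \<and> Tgt C f = x \<and> g \<in> Arr C \<and> Tgt C g = x \<and>
     u \<in> Arr C \<and> Src C u = Src C f \<and> Tgt C u = Src C g \<and> g \<cdot>\<^bsub>C\<^esub> u = f"
  by (auto simp: slice_def Hom_iff)

lemma slice_Hom [simp]:
  "(f', g', u) \<in> Hom (slice C x) f g \<longleftrightarrow> f' = f \<and> g' = g \<and> (f, g, u) \<in> Arr (slice C x)"
  by (auto simp: Hom_iff)

lemma slice_HomE:
  assumes "t \<in> Hom (slice C x) f g"
  obtains u where "t = (f, g, u)" "f \<in> Arr C" "Tgt C f = x" "g \<in> Arr C" "Tgt C g = x"
    "u \<in> Arr C" "Src C u = Src C f" "Tgt C u = Src C g" "g \<cdot>\<^bsub>C\<^esub> u = f"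
  using assms by (cases t) auto

lemma is_pullbackD:
  assumes "is_pullback C f g a b"
  shows "f \<in> Arr C" "g \<in> Arr C" "a \<in> Arr C" "b \<in> Arr C" "Tgt C f = Tgt C g" "Src C a = Src C b"
    "Tgt C a = Src C f" "Tgt C b = Src C g" "f \<cdot>\<^bsub>C\<^esub> a = g \<cdot>\<^bsub>C\<^esub> b"
  using assms by (simp_all add: is_pullback_def)

lemma is_pullback_sym: "is_pullback C f g a b \<Longrightarrow> is_pullback C g f b a"
  unfolding is_pullback_def by (auto simp: eq_commute conj_commute) metis+

context category
begin

lemma pullback_univ:
  assumes "is_pullback C f g a b" "c \<in> Arr C" "d \<in> Arr C" "Src C c = Src C d"
    "Tgt C c = Src C f" "Tgt C d = Src C g" "f \<cdot> c = g \<cdot> d"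
  shows "\<exists>!u. u \<in> Hom C (Src C c) (Src C a) \<and> a \<cdot> u = c \<and> b \<cdot> u = d"
proof -
  have "Src C c \<in> Obj C" "c \<in> Hom C (Src C c) (Src C f)" "d \<in> Hom C (Src C c) (Src C g)"
    using assms by (simp_all add: Hom_iff)
  with assms(1,7) show ?thesis unfolding is_pullback_def by blast
qed

lemma pullback_lift:
  assumes "is_pullback C f g a b" "c \<in> Arr C" "d \<in> Arr C" "Src C c = Src C d"
    "Tgt C c = Src C f" "Tgt C d = Src C g" "f \<cdot> c = g \<cdot> d"
  obtains u where "u \<in> Arr C" "Src C u = Src C c" "Tgt C u = Src C a" "a \<cdot> u = c" "b \<cdot> u = d"
  using pullback_univ[OF assms] by (auto simp: Hom_iff)

lemma pullback_eqI:
  assumes "is_pullback C f g a b" "u \<in> Arr C" "v \<in> Arr C" "Src C u = Src C v"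
    "Tgt C u = Src C a" "Tgt C v = Src C a" "a \<cdot> u = a \<cdot> v" "b \<cdot> u = b \<cdot> v"
  shows "u = v"
proof -
  note [simp] = is_pullbackD[OF assms(1)]
  have "f \<cdot> (a \<cdot> v) = g \<cdot> (b \<cdot> v)"
    using extend[OF is_pullbackD(9)[OF assms(1)], of v] assms by simp
  then have "\<exists>!k. k \<in> Hom C (Src C (a \<cdot> v)) (Src C a) \<and> a \<cdot> k = a \<cdot> v \<and> b \<cdot> k = b \<cdot> v"
    using assms by (intro pullback_univ) simp_all
  then show ?thesis using assms by (auto simp: Hom_iff)
qed

lemma is_pullbackI:
  assumes "f \<in> Arr C" "g \<in> Arr C" "a \<in> Arr C" "b \<in> Arr C" "Tgt C f = Tgt C g" "Src C a = Src C b"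
    "Tgt C a = Src C f" "Tgt C b = Src C g" "f \<cdot> a = g \<cdot> b"
    and "\<And>c d. \<lbrakk>c \<in> Arr C; d \<in> Arr C; Src C c = Src C d; Tgt C c = Src C f; Tgt C d = Src C g;
      f \<cdot> c = g \<cdot> d\<rbrakk> \<Longrightarrow>
      \<exists>u. u \<in> Arr C \<and> Src C u = Src C c \<and> Tgt C u = Src C a \<and> a \<cdot> u = c \<and> b \<cdot> u = d"
    and uniq: "\<And>u v. \<lbrakk>u \<in> Arr C; v \<in> Arr C; Src C u = Src C v; Tgt C u = Src C a; Tgt C v = Src C a;
      a \<cdot> u = a \<cdot> v; b \<cdot> u = b \<cdot> v\<rbrakk> \<Longrightarrow> u = v"
  shows "is_pullback C f g a b"
  unfolding is_pullback_def
proof (intro conjI ballI impI assms(1-9))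
  fix z c d assume A: "c \<in> Hom C z (Src C f)" "d \<in> Hom C z (Src C g)" "f \<cdot> c = g \<cdot> d"
  then obtain u where u: "u \<in> Arr C" "Src C u = Src C c" "Tgt C u = Src C a" "a \<cdot> u = c" "b \<cdot> u = d"
    using assms(10)[of c d] by (auto simp: Hom_iff)
  show "\<exists>!u. u \<in> Hom C z (Src C a) \<and> a \<cdot> u = c \<and> b \<cdot> u = d"
    by (rule ex1I[of _ u]) (use u A in \<open>auto simp: Hom_iff intro!: uniq\<close>)
qed

text \<open>Binary products in a slice and pullbacks in the ambient category are the same data: the product
  object \<open>p\<close> is the common composite of the pullback square.\<close>

lemma product_pullback:
  assumes "is_product (slice C x) f g p a b"
  shows "\<exists>a' b'. a = (p, f, a') \<and> b = (p, g, b') \<and> is_pullback C f g a' b' \<and>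
    p \<in> Arr C \<and> Tgt C p = x \<and> Src C p = Src C a' \<and> p = f \<cdot> a'"
proof -
  have ah: "a \<in> Hom (slice C x) p f" and bh: "b \<in> Hom (slice C x) p g"
    using assms by (simp_all add: is_product_def)
  from ah obtain a' where a: "a = (p, f, a')" "p \<in> Arr C" "Tgt C p = x" "f \<in> Arr C" "Tgt C f = x"
      "a' \<in> Arr C" "Src C a' = Src C p" "Tgt C a' = Src C f" "f \<cdot> a' = p"
    by (rule slice_HomE)
  from bh obtain b' where b: "b = (p, g, b')" "p \<in> Arr C" "Tgt C p = x" "g \<in> Arr C" "Tgt C g = x"
      "b' \<in> Arr C" "Src C b' = Src C p" "Tgt C b' = Src C g" "g \<cdot> b' = p"
    by (rule slice_HomE)
  have univ: "\<exists>!u. u \<in> Hom (slice C x) z p \<and> a \<cdot>\<^bsub>slice C x\<^esub> u = c \<and> b \<cdot>\<^bsub>slice C x\<^esub> u = d"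
    if "z \<in> Arr C" "Tgt C z = x" "c \<in> Hom (slice C x) z f" "d \<in> Hom (slice C x) z g" for z c d
    using assms that by (simp add: is_product_def)
  have "is_pullback C f g a' b'"
  proof (rule is_pullbackI)
    fix c d assume cd: "c \<in> Arr C" "d \<in> Arr C" "Src C c = Src C d" "Tgt C c = Src C f" "Tgt C d = Src C g"
      "f \<cdot> c = g \<cdot> d"
    have "\<exists>u. u \<in> Hom (slice C x) (f \<cdot> c) p \<and> a \<cdot>\<^bsub>slice C x\<^esub> u = (f \<cdot> c, f, c) \<and> b \<cdot>\<^bsub>slice C x\<^esub> u = (f \<cdot> c, g, d)"
      by (rule ex1_implies_ex, rule univ) (use a b cd in simp_all)
    then obtain u where u: "u \<in> Hom (slice C x) (f \<cdot> c) p" "a \<cdot>\<^bsub>slice C x\<^esub> u = (f \<cdot> c, f, c) \<and> b \<cdot>\<^bsub>slice C x\<^esub> u = (f \<cdot> c, g, d)"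
      by blast
    from u(1) obtain u' where "u = (f \<cdot> c, p, u')" "f \<cdot> c \<in> Arr C" "Tgt C (f \<cdot> c) = x" "p \<in> Arr C" "Tgt C p = x"
      "u' \<in> Arr C" "Src C u' = Src C (f \<cdot> c)" "Tgt C u' = Src C p" "p \<cdot> u' = f \<cdot> c" by (rule slice_HomE)
    then show "\<exists>u. u \<in> Arr C \<and> Src C u = Src C c \<and> Tgt C u = Src C a' \<and> a' \<cdot> u = c \<and> b' \<cdot> u = d"
      using a b cd u(2) by (intro exI[of _ u']) simp
  next
    fix u v assume uv: "u \<in> Arr C" "v \<in> Arr C" "Src C u = Src C v" "Tgt C u = Src C a'" "Tgt C v = Src C a'"
      "a' \<cdot> u = a' \<cdot> v" "b' \<cdot> u = b' \<cdot> v"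
    have *: "f \<cdot> (a' \<cdot> v) = p \<cdot> v" "g \<cdot> (b' \<cdot> v) = p \<cdot> v" "p \<cdot> u = p \<cdot> v"
      using extend[OF a(9), of v] extend[OF a(9), of u] extend[OF b(9), of v] a b uv by simp_all
    have "\<exists>!k. k \<in> Hom (slice C x) (p \<cdot> v) p \<and> a \<cdot>\<^bsub>slice C x\<^esub> k = (p \<cdot> v, f, a' \<cdot> v) \<and> b \<cdot>\<^bsub>slice C x\<^esub> k = (p \<cdot> v, g, b' \<cdot> v)"
      by (rule univ) (use a b uv * in simp_all)
    moreover have "(p \<cdot> v, p, u) \<in> Hom (slice C x) (p \<cdot> v) p \<and> a \<cdot>\<^bsub>slice C x\<^esub> (p \<cdot> v, p, u) = (p \<cdot> v, f, a' \<cdot> v) \<and>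
        b \<cdot>\<^bsub>slice C x\<^esub> (p \<cdot> v, p, u) = (p \<cdot> v, g, b' \<cdot> v)"
      using a b uv * by simp
    moreover have "(p \<cdot> v, p, v) \<in> Hom (slice C x) (p \<cdot> v) p \<and> a \<cdot>\<^bsub>slice C x\<^esub> (p \<cdot> v, p, v) = (p \<cdot> v, f, a' \<cdot> v) \<and>
        b \<cdot>\<^bsub>slice C x\<^esub> (p \<cdot> v, p, v) = (p \<cdot> v, g, b' \<cdot> v)"
      using a b uv * by simp
    ultimately have "(p \<cdot> v, p, u) = (p \<cdot> v, p, v)" by blast
    then show "u = v" by simp
  qed (use a b in simp_all)
  then show ?thesis using a b by simp
qed

lemma pullback_product:
  assumes pb: "is_pullback C f g a b"
  shows "is_product (slice C (Tgt C f)) f g (f \<cdot> a) (f \<cdot> a, f, a) (f \<cdot> a, g, b)"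
proof -
  note [simp] = is_pullbackD(1-8)[OF pb]
  note eq = is_pullbackD(9)[OF pb]
  show ?thesis unfolding is_product_def
  proof (intro conjI ballI)
    fix z c d assume ch: "c \<in> Hom (slice C (Tgt C f)) z f" and dh: "d \<in> Hom (slice C (Tgt C f)) z g"
    from ch obtain c' where c: "c = (z, f, c')" "z \<in> Arr C" "Tgt C z = Tgt C f" "f \<in> Arr C" "Tgt C f = Tgt C f"
        "c' \<in> Arr C" "Src C c' = Src C z" "Tgt C c' = Src C f" "f \<cdot> c' = z"
      by (rule slice_HomE)
    from dh obtain d' where d: "d = (z, g, d')" "z \<in> Arr C" "Tgt C z = Tgt C f" "g \<in> Arr C" "Tgt C g = Tgt C f"
       "d' \<in> Arr C" "Src C d' = Src C z" "Tgt C d' = Src C g" "g \<cdot> d' = z"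
      by (rule slice_HomE)
    obtain u where u: "u \<in> Arr C" "Src C u = Src C c'" "Tgt C u = Src C a" "a \<cdot> u = c'" "b \<cdot> u = d'"
      by (rule pullback_lift[OF pb, of c' d']) (use c(1-3,6-9) d(1,6-9) in simp_all)
    show "\<exists>!u. u \<in> Hom (slice C (Tgt C f)) z (f \<cdot> a) \<and> (f \<cdot> a, f, a) \<cdot>\<^bsub>slice C (Tgt C f)\<^esub> u = c \<and>
       (f \<cdot> a, g, b) \<cdot>\<^bsub>slice C (Tgt C f)\<^esub> u = d"
    proof (rule ex1I[of _ "(z, f \<cdot> a, u)"])
      fix k assume A: "k \<in> Hom (slice C (Tgt C f)) z (f \<cdot> a) \<and> (f \<cdot> a, f, a) \<cdot>\<^bsub>slice C (Tgt C f)\<^esub> k = c \<and>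
       (f \<cdot> a, g, b) \<cdot>\<^bsub>slice C (Tgt C f)\<^esub> k = d"
      from conjunct1[OF A] obtain k' where k: "k = (z, f \<cdot> a, k')" "z \<in> Arr C" "Tgt C z = Tgt C f" "f \<cdot> a \<in> Arr C"
          "Tgt C (f \<cdot> a) = Tgt C f" "k' \<in> Arr C" "Src C k' = Src C z" "Tgt C k' = Src C (f \<cdot> a)" "(f \<cdot> a) \<cdot> k' = z"
        by (rule slice_HomE)
      have "k' = u" by (rule pullback_eqI[OF pb]) (use k(1,6-8) A u c(1-3,6-9) d(1,6-9) in simp_all)
      with k show "k = (z, f \<cdot> a, u)" by simp
    qed (use u c(1-3,6-9) d(1,6-9) in simp)
  qed (simp_all add: eq)
qed

end

text \<open>An exponential of \<open>m\<close> by \<open>f\<close> in the slice over their common target, in terms of the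
  ambient category: \<open>(a, b)\<close> is the pullback of \<open>(e, f)\<close>.\<close>

definition slice_exp :: "('o, 'm) cat \<Rightarrow> 'm \<Rightarrow> 'm \<Rightarrow> 'm \<Rightarrow> 'm \<Rightarrow> 'm \<Rightarrow> 'm \<Rightarrow> bool" where
  "slice_exp C f m e a b ev \<longleftrightarrow>
     is_pullback C e f a b \<and> ev \<in> Hom C (Src C a) (Src C m) \<and> m \<cdot>\<^bsub>C\<^esub> ev = f \<cdot>\<^bsub>C\<^esub> b \<and>
     (\<forall>z c d g. is_pullback C z f c d \<and> g \<in> Hom C (Src C c) (Src C m) \<and> m \<cdot>\<^bsub>C\<^esub> g = f \<cdot>\<^bsub>C\<^esub> d \<longrightarrow>
        (\<exists>!h. h \<in> Hom C (Src C z) (Src C e) \<and> e \<cdot>\<^bsub>C\<^esub> h = z \<and>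
          (\<exists>k \<in> Hom C (Src C c) (Src C a).
             a \<cdot>\<^bsub>C\<^esub> k = h \<cdot>\<^bsub>C\<^esub> c \<and> b \<cdot>\<^bsub>C\<^esub> k = d \<and> ev \<cdot>\<^bsub>C\<^esub> k = g)))"

locale lccc = category E for E :: "('o, 'm) cat" (structure) +
  fixes one
  assumes lcc: "locally_cartesian_closed E" and one: "terminal E one"
begin

lemma pullback_ex:
  assumes "f \<in> Arr E" "g \<in> Arr E" "Tgt E f = Tgt E g"
  shows "\<exists>a b. is_pullback E f g a b"
proof -
  have "\<exists>p a b. is_product (slice E (Tgt E f)) f g p a b"
    using lcc assms by (simp add: locally_cartesian_closed_def cartesian_closed_def)
  then show ?thesis using product_pullback by blast
qed

lemma pb:
  assumes "f \<in> Arr E" "g \<in> Arr E" "Tgt E f = Tgt E g"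
  shows "is_pullback E f g (fst (pb E f g)) (snd (pb E f g))"
proof -
  have "case pb E f g of (a, b) \<Rightarrow> is_pullback E f g a b"
    unfolding pb_def by (rule someI_ex) (use pullback_ex[OF assms] in auto)
  then show ?thesis by (simp add: case_prod_beta)
qed

lemma term_ex:
  assumes "x \<in> Obj E"
  shows "\<exists>f. f \<in> Arr E \<and> Src E f = x \<and> Tgt E f = one"
  using one assms unfolding terminal_def by (auto simp: Hom_iff)

lemma term_eq:
  assumes "f \<in> Arr E" "g \<in> Arr E" "Src E f = Src E g" "Tgt E f = one" "Tgt E g = one"
  shows "f = g"
  using one assms unfolding terminal_def by (metis Hom_iff Src_Tgt_Obj(1))

lemma product_ex:
  assumes x: "x \<in> Obj E" and y: "y \<in> Obj E"
  shows "\<exists>p a b. is_product E x y p a b"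
proof -
  obtain f where f: "f \<in> Arr E" "Src E f = x" "Tgt E f = one" using term_ex[OF x] by blast
  obtain g where g: "g \<in> Arr E" "Src E g = y" "Tgt E g = one" using term_ex[OF y] by blast
  obtain a b where pb: "is_pullback E f g a b" using pullback_ex[of f g] f g by auto
  have "is_product E x y (Src E a) a b"
    unfolding is_product_def
  proof (intro conjI ballI)
    fix z c d assume "c \<in> Hom E z x" "d \<in> Hom E z y"
    then have cd: "c \<in> Arr E" "d \<in> Arr E" "Src E c = z" "Src E d = z" "Tgt E c = x" "Tgt E d = y"
      by (simp_all add: Hom_iff)
    have "f \<cdot> c = g \<cdot> d" by (rule term_eq) (use cd f g in simp_all)
    then show "\<exists>!u. u \<in> Hom E z (Src E a) \<and> a \<cdot> u = c \<and> b \<cdot> u = d"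
      using pullback_univ[OF pb, of c d] cd f g by simp
  qed (use is_pullbackD[OF pb] f g in \<open>simp_all add: Hom_iff\<close>)
  then show ?thesis by blast
qed

lemma product_lift:
  assumes "is_product E x y p a b" "c \<in> Arr E" "d \<in> Arr E" "Src E c = Src E d" "Tgt E c = x" "Tgt E d = y"
  obtains u where "u \<in> Arr E" "Src E u = Src E c" "Tgt E u = p" "a \<cdot> u = c" "b \<cdot> u = d"
proof -
  have "Src E c \<in> Obj E" "c \<in> Hom E (Src E c) x" "d \<in> Hom E (Src E c) y" using assms by (simp_all add: Hom_iff)
  with assms(1) have "\<exists>!u. u \<in> Hom E (Src E c) p \<and> a \<cdot> u = c \<and> b \<cdot> u = d"
    unfolding is_product_def by blast
  then show ?thesis by (elim ex1E conjE) (rule that; simp add: Hom_iff)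
qed

lemma product_eqI:
  assumes p: "is_product E x y p a b" and uv: "u \<in> Arr E" "v \<in> Arr E" "Src E u = Src E v" "Tgt E u = p" "Tgt E v = p"
    "a \<cdot> u = a \<cdot> v" "b \<cdot> u = b \<cdot> v"
  shows "u = v"
proof -
  have ab: "a \<in> Arr E" "Src E a = p" "Tgt E a = x" "b \<in> Arr E" "Src E b = p" "Tgt E b = y"
    using p by (simp_all add: is_product_def Hom_iff)
  have "Src E v \<in> Obj E" "a \<cdot> v \<in> Hom E (Src E v) x" "b \<cdot> v \<in> Hom E (Src E v) y"
    using ab uv by (simp_all add: Hom_iff)
  with p have "\<exists>!k. k \<in> Hom E (Src E v) p \<and> a \<cdot> k = a \<cdot> v \<and> b \<cdot> k = b \<cdot> v"
    unfolding is_product_def by blast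
  moreover have "u \<in> Hom E (Src E v) p \<and> a \<cdot> u = a \<cdot> v \<and> b \<cdot> u = b \<cdot> v"
    "v \<in> Hom E (Src E v) p \<and> a \<cdot> v = a \<cdot> v \<and> b \<cdot> v = b \<cdot> v" using uv by (simp_all add: Hom_iff)
  ultimately show ?thesis by blast
qed

text \<open>All arrows of the slice that occur in the universal property of an exponential have prescribed
  endpoints, so only their underlying arrows matter.\<close>

lemma slice_exp_ex:
  assumes f: "f \<in> Arr E" and m: "m \<in> Arr E" and fm: "Tgt E f = Tgt E m"
  shows "\<exists>e a b ev. slice_exp E f m e a b ev"
proof -
  define S where "S = slice E (Tgt E f)"
  have "\<exists>e p a b ev. is_exponential S f m e p a b ev"
    using lcc assms by (simp add: locally_cartesian_closed_def cartesian_closed_def S_def)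
  then obtain e p a b ev where ex: "is_exponential S f m e p a b ev" by blast
  then have prd: "is_product S e f p a b" and "ev \<in> Hom S p m" and "e \<in> Obj S"
    by (simp_all add: is_exponential_def)
  obtain a' b' where ab: "a = (p, e, a')" "b = (p, f, b')" and pb: "is_pullback E e f a' b'"
    and p: "p \<in> Arr E" "Tgt E p = Tgt E f" "Src E p = Src E a'" "p = e \<cdot> a'"
    using product_pullback[OF prd[unfolded S_def]] by blast
  note [simp] = is_pullbackD(1-8)[OF pb]
  from \<open>ev \<in> Hom S p m\<close>[unfolded S_def] obtain ev' where ev: "ev = (p, m, ev')" "ev' \<in> Arr E"
      "Src E ev' = Src E a'" "Tgt E ev' = Src E m" "m \<cdot> ev' = p"
    unfolding p(3)[symmetric] by (rule slice_HomE)
  have e: "e \<in> Arr E" "Tgt E e = Tgt E f" using \<open>e \<in> Obj S\<close> by (simp_all add: S_def)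
  have "slice_exp E f m e a' b' ev'"
    unfolding slice_exp_def
  proof (intro conjI allI impI pb)
    show "ev' \<in> Hom E (Src E a') (Src E m)" "m \<cdot> ev' = f \<cdot> b'"
      using ev p is_pullbackD(9)[OF pb] by (simp_all add: Hom_iff)
    fix z c d g assume A: "is_pullback E z f c d \<and> g \<in> Hom E (Src E c) (Src E m) \<and> m \<cdot> g = f \<cdot> d"
    then have pz: "is_pullback E z f c d" and g: "g \<in> Arr E" "Src E g = Src E c" "Tgt E g = Src E m" "m \<cdot> g = f \<cdot> d"
      by (auto simp: Hom_iff)
    note z [simp] = is_pullbackD(1-8)[OF pz]
    note zc = is_pullbackD(9)[OF pz]
    have "is_product S z f (z \<cdot> c) (z \<cdot> c, z, c) (z \<cdot> c, f, d)"
      using pullback_product[OF pz] z by (simp add: S_def)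
    moreover have "(z \<cdot> c, m, g) \<in> Hom S (z \<cdot> c) m" using g m by (simp add: S_def zc fm)
    moreover have "z \<in> Obj S" by (simp add: S_def)
    ultimately have u: "\<exists>!h. h \<in> Hom S z e \<and>
           (\<exists>k \<in> Hom S (z \<cdot> c) p. a \<cdot>\<^bsub>S\<^esub> k = h \<cdot>\<^bsub>S\<^esub> (z \<cdot> c, z, c) \<and> b \<cdot>\<^bsub>S\<^esub> k = (z \<cdot> c, f, d) \<and> ev \<cdot>\<^bsub>S\<^esub> k = (z \<cdot> c, m, g))"
      using ex unfolding is_exponential_def by blast
    have iff: "(h \<in> Hom E (Src E z) (Src E e) \<and> e \<cdot> h = z \<and>
          (\<exists>k \<in> Hom E (Src E c) (Src E a'). a' \<cdot> k = h \<cdot> c \<and> b' \<cdot> k = d \<and> ev' \<cdot> k = g)) \<longleftrightarrow>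
       ((z, e, h) \<in> Hom S z e \<and>
           (\<exists>k \<in> Hom S (z \<cdot> c) p. a \<cdot>\<^bsub>S\<^esub> k = (z, e, h) \<cdot>\<^bsub>S\<^esub> (z \<cdot> c, z, c) \<and> b \<cdot>\<^bsub>S\<^esub> k = (z \<cdot> c, f, d) \<and> ev \<cdot>\<^bsub>S\<^esub> k = (z \<cdot> c, m, g)))"
      (is "?l h \<longleftrightarrow> ?r h") for h
    proof
      assume l: "?l h"
      then obtain k where k: "k \<in> Arr E" "Src E k = Src E c" "Tgt E k = Src E a'" "a' \<cdot> k = h \<cdot> c" "b' \<cdot> k = d" "ev' \<cdot> k = g"
        unfolding Hom_iff Bex_def by blast
      have h: "h \<in> Arr E" "Src E h = Src E z" "Tgt E h = Src E e" "e \<cdot> h = z"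
        using l unfolding Hom_iff by blast+
      have "p \<cdot> k = z \<cdot> c" using k h extend[OF h(4), of c] by (simp add: p(4))
      then show "?r h" using k h e ab ev p(1-3)
        by (intro conjI bexI[of _ "(z \<cdot> c, p, k)"]) (simp_all add: S_def)
    next
      assume r: "?r h"
      then obtain k where k: "k \<in> Hom S (z \<cdot> c) p" "a \<cdot>\<^bsub>S\<^esub> k = (z, e, h) \<cdot>\<^bsub>S\<^esub> (z \<cdot> c, z, c) \<and> b \<cdot>\<^bsub>S\<^esub> k = (z \<cdot> c, f, d) \<and> ev \<cdot>\<^bsub>S\<^esub> k = (z \<cdot> c, m, g)"
        by blast
      from k(1)[unfolded S_def] obtain k' where k': "k = (z \<cdot> c, p, k')" "k' \<in> Arr E" "Src E k' = Src E c" "Tgt E k' = Src E a'"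
        by (rule slice_HomE) (use p(3) in simp)
      then show "?l h" using k r p ab ev
        by (intro conjI bexI[of _ k']) (simp_all add: S_def Hom_iff)
    qed
    show "\<exists>!h. h \<in> Hom E (Src E z) (Src E e) \<and> e \<cdot> h = z \<and>
          (\<exists>k \<in> Hom E (Src E c) (Src E a'). a' \<cdot> k = h \<cdot> c \<and> b' \<cdot> k = d \<and> ev' \<cdot> k = g)"
    proof -
      from u obtain h0 where h0: "h0 \<in> Hom S z e"
        and "\<exists>k \<in> Hom S (z \<cdot> c) p. a \<cdot>\<^bsub>S\<^esub> k = h0 \<cdot>\<^bsub>S\<^esub> (z \<cdot> c, z, c) \<and> b \<cdot>\<^bsub>S\<^esub> k = (z \<cdot> c, f, d) \<and> ev \<cdot>\<^bsub>S\<^esub> k = (z \<cdot> c, m, g)"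
        by (elim ex1E conjE)
      moreover obtain h where "h0 = (z, e, h)" using h0 unfolding S_def by (elim slice_HomE)
      ultimately have r: "?r h" by blast
      show ?thesis unfolding iff
      proof (rule ex1I[of _ h], rule r)
        fix h' assume "?r h'"
        with r u have "(z, e, h') = (z, e, h)" by blast
        then show "h' = h" by simp
      qed
    qed
  qed
  then show ?thesis by blast
qed

lemma slice_exp_transpose:
  assumes "slice_exp E f m e a b ev" "is_pullback E z f c d"
    "g \<in> Arr E" "Src E g = Src E c" "Tgt E g = Src E m" "m \<cdot> g = f \<cdot> d"
  obtains h k where "h \<in> Arr E" "Src E h = Src E z" "Tgt E h = Src E e" "e \<cdot> h = z"
    "k \<in> Arr E" "Src E k = Src E c" "Tgt E k = Src E a" "a \<cdot> k = h \<cdot> c" "b \<cdot> k = d" "ev \<cdot> k = g"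
proof -
  have "\<exists>!h. h \<in> Hom E (Src E z) (Src E e) \<and> e \<cdot> h = z \<and>
          (\<exists>k \<in> Hom E (Src E c) (Src E a). a \<cdot> k = h \<cdot> c \<and> b \<cdot> k = d \<and> ev \<cdot> k = g)"
    using assms unfolding slice_exp_def by (simp add: Hom_iff)
  then show ?thesis by (elim ex1E conjE bexE) (rule that; simp add: Hom_iff)
qed

lemma slice_exp_eqI:
  assumes se: "slice_exp E f m e a b ev" and pz: "is_pullback E z f c d"
    and h: "h \<in> Arr E" "Src E h = Src E z" "Tgt E h = Src E e" "e \<cdot> h = z"
    and k: "k \<in> Arr E" "Src E k = Src E c" "Tgt E k = Src E a" "a \<cdot> k = h \<cdot> c" "b \<cdot> k = d"
    and h': "h' \<in> Arr E" "Src E h' = Src E z" "Tgt E h' = Src E e" "e \<cdot> h' = z"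
    and k': "k' \<in> Arr E" "Src E k' = Src E c" "Tgt E k' = Src E a" "a \<cdot> k' = h' \<cdot> c" "b \<cdot> k' = d"
    and eq: "ev \<cdot> k = ev \<cdot> k'"
    and m: "m \<in> Arr E"
  shows "h = h'"
proof -
  have "is_pullback E e f a b" and ev: "ev \<in> Arr E" "Src E ev = Src E a" "Tgt E ev = Src E m" "m \<cdot> ev = f \<cdot> b"
    using se by (simp_all add: slice_exp_def Hom_iff)
  note [simp] = is_pullbackD(1-8)[OF this(1)]
  have "m \<cdot> (ev \<cdot> k) = f \<cdot> d"
    using extend[OF ev(4), of k] k ev m by simp
  then have "\<exists>!h. h \<in> Hom E (Src E z) (Src E e) \<and> e \<cdot> h = z \<and>
          (\<exists>j \<in> Hom E (Src E c) (Src E a). a \<cdot> j = h \<cdot> c \<and> b \<cdot> j = d \<and> ev \<cdot> j = ev \<cdot> k)"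
    using se pz k ev unfolding slice_exp_def by (simp add: Hom_iff)
  moreover have "h \<in> Hom E (Src E z) (Src E e) \<and> e \<cdot> h = z \<and>
          (\<exists>j \<in> Hom E (Src E c) (Src E a). a \<cdot> j = h \<cdot> c \<and> b \<cdot> j = d \<and> ev \<cdot> j = ev \<cdot> k)"
    using h k by (auto simp: Hom_iff intro!: bexI[of _ k])
  moreover have "h' \<in> Hom E (Src E z) (Src E e) \<and> e \<cdot> h' = z \<and>
          (\<exists>j \<in> Hom E (Src E c) (Src E a). a \<cdot> j = h' \<cdot> c \<and> b \<cdot> j = d \<and> ev \<cdot> j = ev \<cdot> k)"
    using h' k' eq by (auto simp: Hom_iff intro!: bexI[of _ k'])
  ultimately show ?thesis by (elim ex1E) metis
qed

text \<open>The span \<open>(n, k)\<close> is the value at the span \<open>(x, q)\<close> of the right adjoint to the base change \<open>f\<^sup>*\<close>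
  of spans, and \<open>\<epsilon>\<close> is the counit \<open>f\<^sup>*(n, k) \<rightarrow> (x, q)\<close>. For a span with left leg \<open>y\<close>, an arrow \<open>h\<close> into
  \<open>(n, k)\<close> is paired with its pullback \<open>l = f\<^sup>*h\<close>; the two quantified clauses are existence and uniqueness of
  the transpose of \<open>v\<close>. In classical terms \<open>\<langle>n, k\<rangle>\<close> is the dependent product of \<open>\<langle>x, q\<rangle>\<close> along \<open>f \<times> K\<close>.\<close>

definition dependent_product :: "'m \<Rightarrow> 'm \<Rightarrow> 'm \<Rightarrow> 'm \<Rightarrow> 'm \<Rightarrow> 'm \<Rightarrow> bool" where
  "dependent_product f x q n k \<epsilon> \<longleftrightarrow>
     n \<in> Arr E \<and> k \<in> Arr E \<and> Src E n = Src E k \<and> Tgt E n = Tgt E f \<and> Tgt E k = Tgt E q \<and>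
     \<epsilon> \<in> Arr E \<and> Src E \<epsilon> = Src E (fst (pb E f n)) \<and> Tgt E \<epsilon> = Src E x \<and>
     x \<cdot> \<epsilon> = fst (pb E f n) \<and> q \<cdot> \<epsilon> = k \<cdot> snd (pb E f n) \<and>
     (\<forall>y r \<gamma> \<delta> v. is_pullback E f y \<gamma> \<delta> \<and> r \<in> Arr E \<and> Src E y = Src E r \<and> Tgt E r = Tgt E q \<and>
        v \<in> Arr E \<and> Src E v = Src E \<gamma> \<and> Tgt E v = Src E x \<and> x \<cdot> v = \<gamma> \<and> q \<cdot> v = r \<cdot> \<delta> \<longrightarrow>
        (\<exists>h l. h \<in> Arr E \<and> Src E h = Src E y \<and> Tgt E h = Src E n \<and> n \<cdot> h = y \<and> k \<cdot> h = r \<and>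
           l \<in> Arr E \<and> Src E l = Src E \<gamma> \<and> Tgt E l = Src E (fst (pb E f n)) \<and>
           fst (pb E f n) \<cdot> l = \<gamma> \<and> snd (pb E f n) \<cdot> l = h \<cdot> \<delta> \<and> \<epsilon> \<cdot> l = v)) \<and>
     (\<forall>y \<gamma> \<delta> h h' l l'. is_pullback E f y \<gamma> \<delta> \<and>
        h \<in> Arr E \<and> Src E h = Src E y \<and> Tgt E h = Src E n \<and> n \<cdot> h = y \<and>
        h' \<in> Arr E \<and> Src E h' = Src E y \<and> Tgt E h' = Src E n \<and> n \<cdot> h' = y \<and> k \<cdot> h = k \<cdot> h' \<and>
        l \<in> Arr E \<and> Src E l = Src E \<gamma> \<and> Tgt E l = Src E (fst (pb E f n)) \<and>
        fst (pb E f n) \<cdot> l = \<gamma> \<and> snd (pb E f n) \<cdot> l = h \<cdot> \<delta> \<and>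
        l' \<in> Arr E \<and> Src E l' = Src E \<gamma> \<and> Tgt E l' = Src E (fst (pb E f n)) \<and>
        fst (pb E f n) \<cdot> l' = \<gamma> \<and> snd (pb E f n) \<cdot> l' = h' \<cdot> \<delta> \<and>
        \<epsilon> \<cdot> l = \<epsilon> \<cdot> l' \<longrightarrow> h = h')"

text \<open>Let \<open>f : J \<rightarrow> I\<close> and \<open>K\<close> be the target of \<open>q\<close>. In the slice over \<open>I\<close> form the exponentials
  \<open>X = M\<^sup>J\<close> and \<open>Y = (J \<times> K)\<^sup>J\<close>. A map \<open>Z \<rightarrow> X\<close> over \<open>I\<close> is a map \<open>v : J \<times>\<^sub>I Z \<rightarrow> M\<close> over \<open>I\<close>. It
  underlies an arrow of spans precisely when \<open>x \<cdot> v\<close> is the projection to \<open>J\<close> and \<open>q \<cdot> v\<close> factors through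
  the projection to \<open>Z\<close>, that is, when the composite of \<open>Z \<rightarrow> X\<close> with
  \<open>e1 = \<langle>x, q\<rangle>\<^sup>J : X \<rightarrow> Y\<close> factors through \<open>i : I \<times> K \<rightarrow> Y\<close>, the transpose of the projections from
  \<open>J \<times>\<^sub>I (I \<times> K)\<close> to \<open>J\<close> and \<open>K\<close>. So the span sought is carved out of \<open>X\<close> by pulling back \<open>e1\<close> along \<open>i\<close>.\<close>

lemma dependent_product_ex:
  assumes f: "f \<in> Arr E" and x: "x \<in> Arr E" and q: "q \<in> Arr E" and xq: "Src E x = Src E q" and fx: "Tgt E x = Src E f"
  shows "\<exists>n k \<epsilon>. dependent_product f x q n k \<epsilon>"
proof -
  define K where "K = Tgt E q"
  have K: "K \<in> Obj E" "Tgt E q = K" using q by (simp_all add: K_def)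
  note [simp] = f x q xq fx K
  obtain JK a1 a2 where pJK: "is_product E (Src E f) K JK a1 a2" using product_ex[of "Src E f" K] by auto
  then have JK [simp]: "a1 \<in> Arr E" "a2 \<in> Arr E" "Src E a2 = JK" "Src E a1 = JK" "Tgt E a1 = Src E f" "Tgt E a2 = K"
    by (simp_all add: is_product_def Hom_iff)
  obtain IK b1 b2 where pIK: "is_product E (Tgt E f) K IK b1 b2" using product_ex[of "Tgt E f" K] by auto
  then have IK [simp]: "b1 \<in> Arr E" "b2 \<in> Arr E" "Src E b2 = IK" "Src E b1 = IK" "Tgt E b1 = Tgt E f" "Tgt E b2 = K"
    by (simp_all add: is_product_def Hom_iff)
  obtain xq where xq [simp]: "xq \<in> Arr E" "Src E xq = Src E q" "Tgt E xq = JK" "a1 \<cdot> xq = x" "a2 \<cdot> xq = q"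
    by (rule product_lift[OF pJK, of x q]) simp_all
  have xq' [simp]: "a1 \<cdot> (xq \<cdot> u) = x \<cdot> u" "a2 \<cdot> (xq \<cdot> u) = q \<cdot> u" if "u \<in> Arr E" "Tgt E u = Src E q" for u
    using extend[OF xq(4), of u] extend[OF xq(5), of u] that by simp_all

  obtain X a b ev where seX: "slice_exp E f (f \<cdot> x) X a b ev" using slice_exp_ex[of f "f \<cdot> x"] by auto
  then have pX: "is_pullback E X f a b" and ev [simp]: "ev \<in> Arr E" "Src E ev = Src E a" "Tgt E ev = Src E q"
    and ev_eq: "(f \<cdot> x) \<cdot> ev = f \<cdot> b"
    unfolding slice_exp_def Hom_iff by simp_all
  note pXs [simp] = is_pullbackD(1,3,4,5,7,8)[OF pX] is_pullbackD(6)[OF pX, symmetric]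
  obtain Y a' b' ev' where seY: "slice_exp E f (f \<cdot> a1) Y a' b' ev'" using slice_exp_ex[of f "f \<cdot> a1"] by auto
  then have pY: "is_pullback E Y f a' b'" and ev' [simp]: "ev' \<in> Arr E" "Src E ev' = Src E a'" "Tgt E ev' = Src E a1"
    unfolding slice_exp_def Hom_iff by simp_all
  note pYs [simp] = is_pullbackD(1,3,4,5,7,8)[OF pY] is_pullbackD(6)[OF pY, symmetric]

  have "(f \<cdot> a1) \<cdot> (xq \<cdot> ev) = f \<cdot> b" using ev_eq by simp
  then obtain e1 k1 where e1 [simp]: "e1 \<in> Arr E" "Src E e1 = Src E X" "Tgt E e1 = Src E Y" and e1_eq: "Y \<cdot> e1 = X"
    and k1 [simp]: "k1 \<in> Arr E" "Src E k1 = Src E a" "Tgt E k1 = Src E a'"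
    and k1_eq: "a' \<cdot> k1 = e1 \<cdot> a" "b' \<cdot> k1 = b" "ev' \<cdot> k1 = xq \<cdot> ev"
    by (rule slice_exp_transpose[OF seY pX, of "xq \<cdot> ev", rotated 3]) simp_all
  obtain c d where pD: "is_pullback E b1 f c d" using pullback_ex[of b1 f] by auto
  note pDs [simp] = is_pullbackD(3,4,7,8)[OF pD] is_pullbackD(6)[OF pD, symmetric]
  obtain dk where dk [simp]: "dk \<in> Arr E" "Src E dk = Src E c" "Tgt E dk = Src E a1" "a1 \<cdot> dk = d" "a2 \<cdot> dk = b2 \<cdot> c"
    by (rule product_lift[OF pJK, of d "b2 \<cdot> c"]) simp_all
  have "(f \<cdot> a1) \<cdot> dk = f \<cdot> d" by simp
  then obtain i k2 where i [simp]: "i \<in> Arr E" "Src E i = Src E b1" "Tgt E i = Src E Y" and i_eq: "Y \<cdot> i = b1"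
    and k2 [simp]: "k2 \<in> Arr E" "Src E k2 = Src E c" "Tgt E k2 = Src E a'"
    and k2_eq: "a' \<cdot> k2 = i \<cdot> c" "b' \<cdot> k2 = d" "ev' \<cdot> k2 = dk"
    by (rule slice_exp_transpose[OF seY pD, of dk, rotated 3]) simp_all

  obtain n1 n2 where pN: "is_pullback E e1 i n1 n2" using pullback_ex[of e1 i] by auto
  note pNs [simp] = is_pullbackD(3,4,7,8)[OF pN] is_pullbackD(6)[OF pN, symmetric]
  note pN_eq = is_pullbackD(9)[OF pN]
  define n where "n = X \<cdot> n1"
  define k where "k = b2 \<cdot> n2"
  have n_eq: "n = b1 \<cdot> n2"
    using extend[OF e1_eq, of n1] extend[OF i_eq, of n2] by (simp add: n_def pN_eq)
  have nk [simp]: "n \<in> Arr E" "k \<in> Arr E" "Src E n = Src E n1" "Src E k = Src E n1" "Tgt E n = Tgt E f" "Tgt E k = K"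
    by (simp_all add: n_def k_def)
  define \<alpha> where "\<alpha> = fst (pb E f n)"
  define \<beta> where "\<beta> = snd (pb E f n)"
  have p\<alpha>: "is_pullback E f n \<alpha> \<beta>" unfolding \<alpha>_def \<beta>_def by (rule pb) simp_all
  note p\<alpha>s [simp] = is_pullbackD(3,4,7,8)[OF p\<alpha>] is_pullbackD(6)[OF p\<alpha>, symmetric]
  note p\<alpha>_eq = is_pullbackD(9)[OF p\<alpha>]
  have "X \<cdot> (n1 \<cdot> \<beta>) = f \<cdot> \<alpha>" using p\<alpha>_eq by (simp add: n_def)
  then obtain j where j [simp]: "j \<in> Arr E" "Src E j = Src E \<alpha>" "Tgt E j = Src E a" "a \<cdot> j = n1 \<cdot> \<beta>" "b \<cdot> j = \<alpha>"
    by (rule pullback_lift[OF pX, of "n1 \<cdot> \<beta>" \<alpha>, rotated 5]) simp_all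
  have "b1 \<cdot> (n2 \<cdot> \<beta>) = f \<cdot> \<alpha>" using p\<alpha>_eq by (simp add: n_eq)
  then obtain j' where j' [simp]: "j' \<in> Arr E" "Src E j' = Src E \<alpha>" "Tgt E j' = Src E c" "c \<cdot> j' = n2 \<cdot> \<beta>" "d \<cdot> j' = \<alpha>"
    by (rule pullback_lift[OF pD, of "n2 \<cdot> \<beta>" \<alpha>, rotated 5]) simp_all
  have kj: "k1 \<cdot> j = k2 \<cdot> j'"
  proof (rule pullback_eqI[OF pY])
    show "a' \<cdot> (k1 \<cdot> j) = a' \<cdot> (k2 \<cdot> j')"
      using extend[OF k1_eq(1), of j] extend[OF k2_eq(1), of j'] extend[OF pN_eq, of \<beta>] by simp
    show "b' \<cdot> (k1 \<cdot> j) = b' \<cdot> (k2 \<cdot> j')"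
      using extend[OF k1_eq(2), of j] extend[OF k2_eq(2), of j'] by simp
  qed simp_all
  define \<epsilon> where "\<epsilon> = ev \<cdot> j"
  have \<epsilon> [simp]: "\<epsilon> \<in> Arr E" "Src E \<epsilon> = Src E \<alpha>" "Tgt E \<epsilon> = Src E q" by (simp_all add: \<epsilon>_def)
  have xq\<epsilon>: "xq \<cdot> \<epsilon> = dk \<cdot> j'"
    using extend[OF k1_eq(3), of j] extend[OF k2_eq(3), of j'] kj by (simp add: \<epsilon>_def)
  have x\<epsilon>: "x \<cdot> \<epsilon> = \<alpha>"
    using arg_cong[OF xq\<epsilon>, of "\<lambda>t. a1 \<cdot> t"] extend[OF dk(4), of j'] by simp
  have q\<epsilon>: "q \<cdot> \<epsilon> = k \<cdot> \<beta>"
    using arg_cong[OF xq\<epsilon>, of "\<lambda>t. a2 \<cdot> t"] extend[OF dk(5), of j'] by (simp add: k_def)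

  have "dependent_product f x q n k \<epsilon>"
    unfolding dependent_product_def \<alpha>_def[symmetric] \<beta>_def[symmetric]
  proof (intro conjI allI impI)
    fix y r \<gamma> \<delta> v
    assume A: "is_pullback E f y \<gamma> \<delta> \<and> r \<in> Arr E \<and> Src E y = Src E r \<and> Tgt E r = Tgt E q \<and>
        v \<in> Arr E \<and> Src E v = Src E \<gamma> \<and> Tgt E v = Src E x \<and> x \<cdot> v = \<gamma> \<and> q \<cdot> v = r \<cdot> \<delta>"
    then have py: "is_pullback E y f \<delta> \<gamma>" and py': "is_pullback E f y \<gamma> \<delta>"
      and r [simp]: "r \<in> Arr E" "Src E y = Src E r" "Tgt E r = K"
      and v [simp]: "v \<in> Arr E" "Src E v = Src E \<gamma>" "Tgt E v = Src E q"
      and xv: "x \<cdot> v = \<gamma>" and qv: "q \<cdot> v = r \<cdot> \<delta>" by (simp_all add: is_pullback_sym)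
    note pys [simp] = is_pullbackD(1,3,4,5,7,8)[OF py] is_pullbackD(6)[OF py]
    note py_eq = is_pullbackD(9)[OF py]
    obtain h0 k0 where h0 [simp]: "h0 \<in> Arr E" "Src E h0 = Src E y" "Tgt E h0 = Src E X" and h0_eq: "X \<cdot> h0 = y"
      and k0 [simp]: "k0 \<in> Arr E" "Src E k0 = Src E \<delta>" "Tgt E k0 = Src E a"
      and k0_eq: "a \<cdot> k0 = h0 \<cdot> \<delta>" "b \<cdot> k0 = \<gamma>" "ev \<cdot> k0 = v"
      by (rule slice_exp_transpose[OF seX py, of v]) (simp_all add: xv)
    obtain h1 where h1 [simp]: "h1 \<in> Arr E" "Src E h1 = Src E y" "Tgt E h1 = Src E b1" and h1_eq: "b1 \<cdot> h1 = y" "b2 \<cdot> h1 = r"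
      by (rule product_lift[OF pIK, of y r]) simp_all
    have "b1 \<cdot> (h1 \<cdot> \<delta>) = f \<cdot> \<gamma>" using extend[OF h1_eq(1), of \<delta>] py_eq by simp
    then obtain l' where l' [simp]: "l' \<in> Arr E" "Src E l' = Src E \<delta>" "Tgt E l' = Src E c" and l'_eq: "c \<cdot> l' = h1 \<cdot> \<delta>" "d \<cdot> l' = \<gamma>"
      by (rule pullback_lift[OF pD, of "h1 \<cdot> \<delta>" \<gamma>, rotated 5]) simp_all
    have eqN: "e1 \<cdot> h0 = i \<cdot> h1"
    proof (rule slice_exp_eqI[OF seY py, where k = "k1 \<cdot> k0" and k' = "k2 \<cdot> l'"])
      show "Y \<cdot> (e1 \<cdot> h0) = y" using extend[OF e1_eq, of h0] h0_eq by simp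
      show "Y \<cdot> (i \<cdot> h1) = y" using extend[OF i_eq, of h1] h1_eq by simp
      show "a' \<cdot> (k1 \<cdot> k0) = (e1 \<cdot> h0) \<cdot> \<delta>" using extend[OF k1_eq(1), of k0] by (simp add: k0_eq)
      show "b' \<cdot> (k1 \<cdot> k0) = \<gamma>" using extend[OF k1_eq(2), of k0] by (simp add: k0_eq)
      show "a' \<cdot> (k2 \<cdot> l') = (i \<cdot> h1) \<cdot> \<delta>" using extend[OF k2_eq(1), of l'] by (simp add: l'_eq)
      show "b' \<cdot> (k2 \<cdot> l') = \<gamma>" using extend[OF k2_eq(2), of l'] by (simp add: l'_eq)
      have "xq \<cdot> v = dk \<cdot> l'"
      proof (rule product_eqI[OF pJK])
        show "a1 \<cdot> (xq \<cdot> v) = a1 \<cdot> (dk \<cdot> l')" using extend[OF dk(4), of l'] by (simp add: l'_eq xv)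
        show "a2 \<cdot> (xq \<cdot> v) = a2 \<cdot> (dk \<cdot> l')" using extend[OF dk(5), of l'] extend[OF h1_eq(2), of \<delta>] by (simp add: l'_eq qv)
      qed simp_all
      then show "ev' \<cdot> (k1 \<cdot> k0) = ev' \<cdot> (k2 \<cdot> l')"
        using extend[OF k1_eq(3), of k0] extend[OF k2_eq(3), of l'] by (simp add: k0_eq)
    qed simp_all
    then obtain h where h [simp]: "h \<in> Arr E" "Src E h = Src E h0" "Tgt E h = Src E n1" and h_eq: "n1 \<cdot> h = h0" "n2 \<cdot> h = h1"
      by (rule pullback_lift[OF pN, of h0 h1, rotated 5]) simp_all
    have nh: "n \<cdot> h = y" using h_eq h0_eq by (simp add: n_def)
    have kh: "k \<cdot> h = r" using h_eq h1_eq by (simp add: k_def)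
    have "f \<cdot> \<gamma> = n \<cdot> (h \<cdot> \<delta>)" using extend[OF nh, of \<delta>] py_eq by simp
    then obtain l where l [simp]: "l \<in> Arr E" "Src E l = Src E \<gamma>" "Tgt E l = Src E \<alpha>" and l_eq: "\<alpha> \<cdot> l = \<gamma>" "\<beta> \<cdot> l = h \<cdot> \<delta>"
      by (rule pullback_lift[OF p\<alpha>, of \<gamma> "h \<cdot> \<delta>", rotated 5]) simp_all
    have "j \<cdot> l = k0"
    proof (rule pullback_eqI[OF pX])
      show "a \<cdot> (j \<cdot> l) = a \<cdot> k0" using extend[OF j(4), of l] extend[OF h_eq(1), of \<delta>] by (simp add: l_eq k0_eq)
      show "b \<cdot> (j \<cdot> l) = b \<cdot> k0" using extend[OF j(5), of l] by (simp add: l_eq k0_eq)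
    qed simp_all
    then have "\<epsilon> \<cdot> l = v" by (simp add: \<epsilon>_def k0_eq)
    then show "\<exists>h l. h \<in> Arr E \<and> Src E h = Src E y \<and> Tgt E h = Src E n \<and> n \<cdot> h = y \<and> k \<cdot> h = r \<and>
           l \<in> Arr E \<and> Src E l = Src E \<gamma> \<and> Tgt E l = Src E \<alpha> \<and> \<alpha> \<cdot> l = \<gamma> \<and> \<beta> \<cdot> l = h \<cdot> \<delta> \<and> \<epsilon> \<cdot> l = v"
      by (intro exI[of _ h] exI[of _ l]) (simp add: nh kh l_eq)
  next
    fix y \<gamma> \<delta> h h' l l'
    assume A: "is_pullback E f y \<gamma> \<delta> \<and>
        h \<in> Arr E \<and> Src E h = Src E y \<and> Tgt E h = Src E n \<and> n \<cdot> h = y \<and>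
        h' \<in> Arr E \<and> Src E h' = Src E y \<and> Tgt E h' = Src E n \<and> n \<cdot> h' = y \<and> k \<cdot> h = k \<cdot> h' \<and>
        l \<in> Arr E \<and> Src E l = Src E \<gamma> \<and> Tgt E l = Src E \<alpha> \<and>
        \<alpha> \<cdot> l = \<gamma> \<and> \<beta> \<cdot> l = h \<cdot> \<delta> \<and>
        l' \<in> Arr E \<and> Src E l' = Src E \<gamma> \<and> Tgt E l' = Src E \<alpha> \<and>
        \<alpha> \<cdot> l' = \<gamma> \<and> \<beta> \<cdot> l' = h' \<cdot> \<delta> \<and> \<epsilon> \<cdot> l = \<epsilon> \<cdot> l'"
    then have py: "is_pullback E y f \<delta> \<gamma>"
      and h [simp]: "h \<in> Arr E" "Src E h = Src E y" "Tgt E h = Src E n1"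
      and h' [simp]: "h' \<in> Arr E" "Src E h' = Src E y" "Tgt E h' = Src E n1"
      and l [simp]: "l \<in> Arr E" "Src E l = Src E \<gamma>" "Tgt E l = Src E \<alpha>"
      and l' [simp]: "l' \<in> Arr E" "Src E l' = Src E \<gamma>" "Tgt E l' = Src E \<alpha>"
      and nh: "n \<cdot> h = y" "n \<cdot> h' = y"
      and l_eq: "\<alpha> \<cdot> l = \<gamma>" "\<beta> \<cdot> l = h \<cdot> \<delta>" "\<alpha> \<cdot> l' = \<gamma>" "\<beta> \<cdot> l' = h' \<cdot> \<delta>"
      and kk: "k \<cdot> h = k \<cdot> h'" and \<epsilon>\<epsilon>: "\<epsilon> \<cdot> l = \<epsilon> \<cdot> l'"
      by (simp_all add: is_pullback_sym)
    have Xnh: "X \<cdot> (n1 \<cdot> h) = y" "X \<cdot> (n1 \<cdot> h') = y" using nh by (simp_all add: n_def)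
    note pys [simp] = is_pullbackD(1,3,4,5,7,8)[OF py] is_pullbackD(6)[OF py]
    have "n1 \<cdot> h = n1 \<cdot> h'"
    proof (rule slice_exp_eqI[OF seX py, where k = "j \<cdot> l" and k' = "j \<cdot> l'"])
      show "a \<cdot> (j \<cdot> l) = (n1 \<cdot> h) \<cdot> \<delta>" using extend[OF j(4), of l] by (simp add: l_eq)
      show "a \<cdot> (j \<cdot> l') = (n1 \<cdot> h') \<cdot> \<delta>" using extend[OF j(4), of l'] by (simp add: l_eq)
      show "b \<cdot> (j \<cdot> l) = \<gamma>" using extend[OF j(5), of l] by (simp add: l_eq)
      show "b \<cdot> (j \<cdot> l') = \<gamma>" using extend[OF j(5), of l'] by (simp add: l_eq)
      show "ev \<cdot> (j \<cdot> l) = ev \<cdot> (j \<cdot> l')" using \<epsilon>\<epsilon> by (simp add: \<epsilon>_def)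
    qed (simp_all add: Xnh)
    moreover have "n2 \<cdot> h = n2 \<cdot> h'"
      by (rule product_eqI[OF pIK]) (use nh kk in \<open>simp_all add: n_eq k_def\<close>)
    ultimately show "h = h'" by (rule pullback_eqI[OF pN, rotated 5]) simp_all
  qed (simp_all add: x\<epsilon> q\<epsilon>)
  then show ?thesis by blast
qed

end

section \<open>Fibered slices and base change\<close>

lemma fslice_simps [simp]:
  "(p, q) \<in> Obj (total (fslice C I)) \<longleftrightarrow> p \<in> Arr C \<and> q \<in> Arr C \<and> Src C p = Src C q \<and> Tgt C p = I"
  "((p', q'), (p, q), (v, w)) \<in> Arr (total (fslice C I)) \<longleftrightarrow>
     (p', q') \<in> Obj (total (fslice C I)) \<and> (p, q) \<in> Obj (total (fslice C I)) \<and>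
     v \<in> Arr C \<and> Src C v = Src C q' \<and> Tgt C v = Src C q \<and>
     w \<in> Arr C \<and> Src C w = Tgt C q' \<and> Tgt C w = Tgt C q \<and>
     p \<cdot>\<^bsub>C\<^esub> v = p' \<and> q \<cdot>\<^bsub>C\<^esub> v = w \<cdot>\<^bsub>C\<^esub> q'"
  "Src (total (fslice C I)) (X, Y, f) = X" "Tgt (total (fslice C I)) (X, Y, f) = Y"
  "Ide (total (fslice C I)) (p, q) = ((p, q), (p, q), (Ide C (Src C p), Ide C (Tgt C q)))"
  "(Y, Z, (v', w')) \<cdot>\<^bsub>total (fslice C I)\<^esub> (X, Y', (v, w)) = (X, Z, (v' \<cdot>\<^bsub>C\<^esub> v, w' \<cdot>\<^bsub>C\<^esub> w))"
  "omap (proj (fslice C I)) (p, q) = Tgt C q"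
  "amap (proj (fslice C I)) (X, Y, (v, w)) = w"
  by (auto simp: fslice_def fslice_cat_def spans_def Hom_iff)

lemma fslice_objE:
  assumes "X \<in> Obj (total (fslice C I))"
  obtains p q where "X = (p, q)" "p \<in> Arr C" "q \<in> Arr C" "Src C p = Src C q" "Tgt C p = I"
  using assms by (cases X) simp

lemma fslice_arrE:
  assumes "t \<in> Arr (total (fslice C I))"
  obtains p' q' p q v w where "t = ((p', q'), (p, q), (v, w))"
    "p' \<in> Arr C" "q' \<in> Arr C" "Src C p' = Src C q'" "Tgt C p' = I"
    "p \<in> Arr C" "q \<in> Arr C" "Src C p = Src C q" "Tgt C p = I"
    "v \<in> Arr C" "Src C v = Src C q'" "Tgt C v = Src C q"
    "w \<in> Arr C" "Src C w = Tgt C q'" "Tgt C w = Tgt C q"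
    "p \<cdot>\<^bsub>C\<^esub> v = p'" "q \<cdot>\<^bsub>C\<^esub> v = w \<cdot>\<^bsub>C\<^esub> q'"
proof -
  obtain p' q' p q v w where t: "t = ((p', q'), (p, q), (v, w))" by (metis surj_pair)
  show ?thesis by (rule that[OF t]) (use assms in \<open>simp_all add: t\<close>)
qed

context category
begin

lemma category_fslice: "category (total (fslice C I))"
proof
  fix f x y z g assume "f \<in> Hom (total (fslice C I)) x y" "g \<in> Hom (total (fslice C I)) y z"
  then have f: "f \<in> Arr (total (fslice C I))" "Src (total (fslice C I)) f = x" "Tgt (total (fslice C I)) f = y"
    and g: "g \<in> Arr (total (fslice C I))" "Src (total (fslice C I)) g = y" "Tgt (total (fslice C I)) g = z"
    by (simp_all add: Hom_iff)
  show "g \<cdot>\<^bsub>total (fslice C I)\<^esub> f \<in> Hom (total (fslice C I)) x z"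
    unfolding Hom_iff
  proof (rule fslice_arrE[OF f(1)], rule fslice_arrE[OF g(1)])
    fix p' q' p q v w a' b' a b v' w'
    assume *: "f = ((p', q'), (p, q), (v, w))"
    "p' \<in> Arr C" "q' \<in> Arr C" "Src C p' = Src C q'" "Tgt C p' = I"
    "p \<in> Arr C" "q \<in> Arr C" "Src C p = Src C q" "Tgt C p = I"
    "v \<in> Arr C" "Src C v = Src C q'" "Tgt C v = Src C q"
    "w \<in> Arr C" "Src C w = Tgt C q'" "Tgt C w = Tgt C q"
    "p \<cdot>\<^bsub>C\<^esub> v = p'" "q \<cdot>\<^bsub>C\<^esub> v = w \<cdot>\<^bsub>C\<^esub> q'"
    "g = ((a', b'), (a, b), (v', w'))"
    "a' \<in> Arr C" "b' \<in> Arr C" "Src C a' = Src C b'" "Tgt C a' = I"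
    "a \<in> Arr C" "b \<in> Arr C" "Src C a = Src C b" "Tgt C a = I"
    "v' \<in> Arr C" "Src C v' = Src C b'" "Tgt C v' = Src C b"
    "w' \<in> Arr C" "Src C w' = Tgt C b'" "Tgt C w' = Tgt C b"
    "a \<cdot>\<^bsub>C\<^esub> v' = a'" "b \<cdot>\<^bsub>C\<^esub> v' = w' \<cdot>\<^bsub>C\<^esub> b'"
    have xz: "x = (p', q')" "z = (a, b)" using f(2) g(3) by (simp_all add: *(1,18))
    have "(p, q) = y" "(a', b') = y" using f(3) g(2) by (simp_all add: *(1,18))
    then have "(a', b') = (p, q)" by (rule trans[OF _ sym, rotated])
    then have e: "a' = p" "b' = q" by simp_all
    have "a \<cdot> (v' \<cdot> v) = p'" using extend[OF *(33), of v] * e by simp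
    moreover have "b \<cdot> (v' \<cdot> v) = w' \<cdot> (w \<cdot> q')" using extend[OF *(34), of v] * e by simp
    ultimately show "g \<cdot>\<^bsub>total (fslice C I)\<^esub> f \<in> Arr (total (fslice C I)) \<and>
      Src (total (fslice C I)) (g \<cdot>\<^bsub>total (fslice C I)\<^esub> f) = x \<and>
      Tgt (total (fslice C I)) (g \<cdot>\<^bsub>total (fslice C I)\<^esub> f) = z"
      using xz * e by simp
  qed
next
  fix f x y z w g h assume A: "f \<in> Hom (total (fslice C I)) w x" "g \<in> Hom (total (fslice C I)) x y" "h \<in> Hom (total (fslice C I)) y z"
  then have "f \<in> Arr (total (fslice C I))" "g \<in> Arr (total (fslice C I))" "h \<in> Arr (total (fslice C I))"
    "Src (total (fslice C I)) g = Tgt (total (fslice C I)) f" "Src (total (fslice C I)) h = Tgt (total (fslice C I)) g"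
    by (simp_all add: Hom_iff)
  then show "(h \<cdot>\<^bsub>total (fslice C I)\<^esub> g) \<cdot>\<^bsub>total (fslice C I)\<^esub> f = h \<cdot>\<^bsub>total (fslice C I)\<^esub> (g \<cdot>\<^bsub>total (fslice C I)\<^esub> f)"
    by (elim fslice_arrE) simp
qed (auto simp: Hom_iff elim!: fslice_arrE fslice_objE)

end

context lccc
begin

abbreviation Sp :: "'o \<Rightarrow> ('m span, 'm span_arr) cat" where "Sp I \<equiv> total (fslice E I)"

lemma is_functor_fslice_proj: "is_functor (Sp I) E (proj (fslice E I))"
  unfolding is_functor_def
proof (intro conjI ballI impI)
  fix x assume "x \<in> Obj (Sp I)"
  then show "omap (proj (fslice E I)) x \<in> Obj E"
    "amap (proj (fslice E I)) (Ide (Sp I) x) = Ide E (omap (proj (fslice E I)) x)"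
    by (elim fslice_objE; simp)+
next
  fix f assume f: "f \<in> Arr (Sp I)"
  then show "amap (proj (fslice E I)) f \<in> Hom E (omap (proj (fslice E I)) (Src (Sp I) f)) (omap (proj (fslice E I)) (Tgt (Sp I) f))"
    by (elim fslice_arrE) (simp add: Hom_iff)
  fix g assume g: "g \<in> Arr (Sp I)" 
  from f g show "amap (proj (fslice E I)) (g \<cdot>\<^bsub>Sp I\<^esub> f) = amap (proj (fslice E I)) g \<cdot> amap (proj (fslice E I)) f"
    by (elim fslice_arrE) simp
qed

text \<open>A map into the source of \<open>v\<close> is compatible with the left legs as soon as its composite with \<open>v\<close> is,
  because \<open>p' = p \<cdot> v\<close>. So being cartesian only concerns the square formed by the right legs.\<close>

lemma cartesian_if_pullback:
  assumes arr: "((p', q'), (p, q), (v, w)) \<in> Arr (Sp I)" and pb: "is_pullback E q w v q'"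
  shows "cartesian_arr E (fslice E I) ((p', q'), (p, q), (v, w))"
  unfolding cartesian_arr_def Let_def
proof (intro conjI ballI impI arr)
  fix t u assume t: "t \<in> Arr (Sp I)"
    and u0: "u \<in> Hom E (omap (proj (fslice E I)) (Src (Sp I) t)) (omap (proj (fslice E I)) (Src (Sp I) ((p', q'), (p, q), v, w)))"
    and A: "Tgt (Sp I) t = Tgt (Sp I) ((p', q'), (p, q), v, w) \<and>
       amap (proj (fslice E I)) ((p', q'), (p, q), v, w) \<cdot> u = amap (proj (fslice E I)) t"
  from t A obtain a b v2 w2 where t': "t = ((a, b), (p, q), (v2, w2))" by (elim fslice_arrE) simp
  have u: "u \<in> Arr E" "Src E u = Tgt E b" "Tgt E u = Tgt E q'" "w \<cdot> u = w2"
    using u0 A arr by (simp_all add: t' Hom_iff)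
  have wub: "w \<cdot> (u \<cdot> b) = w2 \<cdot> b" by (rule extend) (use u arr t t' in simp_all)
  have "q \<cdot> v2 = w \<cdot> (u \<cdot> b)" using wub t t' by simp
  then obtain h where h: "h \<in> Arr E" "Src E h = Src E v2" "Tgt E h = Src E v" "v \<cdot> h = v2" "q' \<cdot> h = u \<cdot> b"
    by (rule pullback_lift[OF pb, of v2 "u \<cdot> b", rotated 5]) (use t u t' arr in simp_all)
  have pvh: "p \<cdot> (v \<cdot> h) = p' \<cdot> h" by (rule extend) (use h arr in simp_all)
  show "\<exists>!h. h \<in> Hom (Sp I) (Src (Sp I) t) (Src (Sp I) ((p', q'), (p, q), v, w)) \<and>
       ((p', q'), (p, q), v, w) \<cdot>\<^bsub>Sp I\<^esub> h = t \<and> amap (proj (fslice E I)) h = u"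
  proof (rule ex1I[of _ "((a, b), (p', q'), (h, u))"])
    show "((a, b), (p', q'), h, u) \<in> Hom (Sp I) (Src (Sp I) t) (Src (Sp I) ((p', q'), (p, q), v, w)) \<and>
       ((p', q'), (p, q), v, w) \<cdot>\<^bsub>Sp I\<^esub> ((a, b), (p', q'), h, u) = t \<and> amap (proj (fslice E I)) ((a, b), (p', q'), h, u) = u"
      using h u t arr pvh by (simp add: t' Hom_iff)
    fix k assume k: "k \<in> Hom (Sp I) (Src (Sp I) t) (Src (Sp I) ((p', q'), (p, q), v, w)) \<and>
       ((p', q'), (p, q), v, w) \<cdot>\<^bsub>Sp I\<^esub> k = t \<and> amap (proj (fslice E I)) k = u"
    then have "k \<in> Arr (Sp I)" "Src (Sp I) k = (a, b)" "Tgt (Sp I) k = (p', q')"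
      by (simp_all add: Hom_iff t')
    then obtain k' where k': "k = ((a, b), (p', q'), (k', u))" "k' \<in> Arr E" "Src E k' = Src E b" "Tgt E k' = Src E q'" "q' \<cdot> k' = u \<cdot> b"
      using k by (elim fslice_arrE) simp
    have "k' = h" by (rule pullback_eqI[OF pb]) (use k k' h t t' arr in simp_all)
    with k' show "k = ((a, b), (p', q'), (h, u))" by simp
  qed
qed

lemma pullback_if_cartesian:
  assumes "cartesian_arr E (fslice E I) ((p', q'), (p, q), (v, w))"
  shows "is_pullback E q w v q'"
proof -
  note c = assms
  have arr: "((p', q'), (p, q), (v, w)) \<in> Arr (Sp I)"
    using c by (simp add: cartesian_arr_def Let_def)
  have univ: "\<exists>!h. h \<in> Hom (Sp I) (p \<cdot> c, d) (p', q') \<and>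
     ((p', q'), (p, q), (v, w)) \<cdot>\<^bsub>Sp I\<^esub> h = ((p \<cdot> c, d), (p, q), (c, w)) \<and>
     amap (proj (fslice E I)) h = Ide E (Tgt E q')"
    if "c \<in> Arr E" "d \<in> Arr E" "Src E c = Src E d" "Tgt E c = Src E q" "Tgt E d = Src E w" "q \<cdot> c = w \<cdot> d" for c d
    using cartesian_arrD[OF assms, of "((p \<cdot> c, d), (p, q), (c, w))" "Ide E (Tgt E q')"] that arr by simp
  show ?thesis
  proof (rule is_pullbackI)
    fix c d assume cd: "c \<in> Arr E" "d \<in> Arr E" "Src E c = Src E d" "Tgt E c = Src E q" "Tgt E d = Src E w" "q \<cdot> c = w \<cdot> d"
    obtain h where "h \<in> Arr (Sp I)" "Src (Sp I) h = (p \<cdot> c, d)" "Tgt (Sp I) h = (p', q')"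
     and h: "((p', q'), (p, q), (v, w)) \<cdot>\<^bsub>Sp I\<^esub> h = ((p \<cdot> c, d), (p, q), (c, w))"
     "amap (proj (fslice E I)) h = Ide E (Tgt E q')"
      using univ[OF cd] unfolding Hom_iff by blast
    then obtain h' where "h = ((p \<cdot> c, d), (p', q'), (h', Ide E (Tgt E q')))" "h' \<in> Arr E" "Src E h' = Src E d" "Tgt E h' = Src E q'"
        "q' \<cdot> h' = Ide E (Tgt E q') \<cdot> d"
      by (elim fslice_arrE) simp
    then show "\<exists>u. u \<in> Arr E \<and> Src E u = Src E c \<and> Tgt E u = Src E v \<and> v \<cdot> u = c \<and> q' \<cdot> u = d"
      using cd arr h(1) by (intro exI[of _ h']) simp
  next
    fix u u' assume uu: "u \<in> Arr E" "u' \<in> Arr E" "Src E u = Src E u'" "Tgt E u = Src E v" "Tgt E u' = Src E v"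
      "v \<cdot> u = v \<cdot> u'" "q' \<cdot> u = q' \<cdot> u'"
    have *: "q \<cdot> (v \<cdot> u') = w \<cdot> (q' \<cdot> u')" "p \<cdot> (v \<cdot> u') = p' \<cdot> u'" "p \<cdot> (v \<cdot> u') = p' \<cdot> u"
      using extend[of q v "w \<cdot> q'" u'] extend[of p v p' u'] extend[of p v p' u] uu arr by simp_all
    have "((p \<cdot> (v \<cdot> u'), q' \<cdot> u'), (p', q'), (u, Ide E (Tgt E q'))) = ((p \<cdot> (v \<cdot> u'), q' \<cdot> u'), (p', q'), (u', Ide E (Tgt E q')))"
    proof (rule ex1E[OF univ[of "v \<cdot> u'" "q' \<cdot> u'"]])
      fix k assume "\<forall>y. y \<in> Hom (Sp I) (p \<cdot> (v \<cdot> u'), q' \<cdot> u') (p', q') \<and>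
           ((p', q'), (p, q), (v, w)) \<cdot>\<^bsub>Sp I\<^esub> y = ((p \<cdot> (v \<cdot> u'), q' \<cdot> u'), (p, q), (v \<cdot> u', w)) \<and>
           amap (proj (fslice E I)) y = Ide E (Tgt E q') \<longrightarrow> y = k"
      then have k: "y = k" if "y \<in> Hom (Sp I) (p \<cdot> (v \<cdot> u'), q' \<cdot> u') (p', q')"
           "((p', q'), (p, q), (v, w)) \<cdot>\<^bsub>Sp I\<^esub> y = ((p \<cdot> (v \<cdot> u'), q' \<cdot> u'), (p, q), (v \<cdot> u', w))"
           "amap (proj (fslice E I)) y = Ide E (Tgt E q')" for y using that by blast
      have "((p \<cdot> (v \<cdot> u'), q' \<cdot> u'), (p', q'), (u, Ide E (Tgt E q'))) = k"
        by (rule k) (use uu arr *(3) in \<open>simp_all add: Hom_iff *(1)\<close>)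
      moreover have "((p \<cdot> (v \<cdot> u'), q' \<cdot> u'), (p', q'), (u', Ide E (Tgt E q'))) = k"
        by (rule k) (use uu arr *(2) in \<open>simp_all add: Hom_iff *(1)\<close>)
      ultimately show ?thesis by simp
    qed (use uu arr * in simp_all)
    then show "u = u'" by simp
  qed (use arr in simp_all)
qed

lemma fibered_fslice: "fibered_category E (fslice E I)"
  unfolding fibered_category_def
proof (intro conjI ballI impI category_fslice is_functor_fslice_proj)
  show "category E" by unfold_locales
  fix x u assume x: "x \<in> Obj (Sp I)" and u: "u \<in> Arr E" and ux: "Tgt E u = omap (proj (fslice E I)) x"
  from x obtain p q where pq: "x = (p, q)" "p \<in> Arr E" "q \<in> Arr E" "Src E p = Src E q" "Tgt E p = I" by (rule fslice_objE)
  obtain a b where pb: "is_pullback E q u a b" using pullback_ex[of q u] pq u ux by auto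
  note pbs = is_pullbackD[OF pb]
  have "cartesian_arr E (fslice E I) ((p \<cdot> a, b), (p, q), (a, u))"
    by (rule cartesian_if_pullback[OF _ pb]) (use pbs(1-4,6-) ux pq in simp_all)
  then show "\<exists>f. cartesian_arr E (fslice E I) f \<and> Tgt (Sp I) f = x \<and> amap (proj (fslice E I)) f = u"
    by (rule exI[of _ "((p \<cdot> a, b), (p, q), (a, u))", OF conjI]) (simp add: pq)
qed

lemma fibered_lower_shriek:
  assumes f: "f \<in> Arr E"
  shows "fibered_functor E (fslice E (Src E f)) (fslice E (Tgt E f)) (lower_shriek E f)"
proof -
  have s: "omap (lower_shriek E f) (p, q) = (f \<cdot> p, q)"
    "amap (lower_shriek E f) ((p', q'), (p, q), vw) = ((f \<cdot> p', q'), (f \<cdot> p, q), vw)" for p q p' q' vw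
    by (simp_all add: lower_shriek_def Let_def)
  show ?thesis unfolding fibered_functor_def is_functor_def
  proof (intro conjI ballI allI impI fibered_fslice)
    fix x assume "x \<in> Obj (Sp (Src E f))"
    then obtain p q where x: "x = (p, q)" "p \<in> Arr E" "q \<in> Arr E" "Src E p = Src E q" "Tgt E p = Src E f" by (rule fslice_objE)
    show "omap (lower_shriek E f) x \<in> Obj (Sp (Tgt E f))"
      "omap (proj (fslice E (Tgt E f))) (omap (lower_shriek E f) x) = omap (proj (fslice E (Src E f))) x"
      "amap (lower_shriek E f) (Ide (Sp (Src E f)) x) = Ide (Sp (Tgt E f)) (omap (lower_shriek E f) x)"
      using x f by (simp_all add: s)
  next
    fix t assume t: "t \<in> Arr (Sp (Src E f))"
    then obtain p' q' p q v w where t': "t = ((p', q'), (p, q), (v, w))" by (rule fslice_arrE)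
    then have pv: "f \<cdot> (p \<cdot> v) = f \<cdot> p'" using t by simp
    show "amap (lower_shriek E f) t \<in> Hom (Sp (Tgt E f)) (omap (lower_shriek E f) (Src (Sp (Src E f)) t))
        (omap (lower_shriek E f) (Tgt (Sp (Src E f)) t))"
      using t pv f by (simp add: t' s Hom_iff)
    show "amap (proj (fslice E (Tgt E f))) (amap (lower_shriek E f) t) = amap (proj (fslice E (Src E f))) t"
      by (simp add: t' s)
    fix u assume u: "u \<in> Arr (Sp (Src E f))" "Src (Sp (Src E f)) u = Tgt (Sp (Src E f)) t"
    then show "amap (lower_shriek E f) (u \<cdot>\<^bsub>Sp (Src E f)\<^esub> t) =
      amap (lower_shriek E f) u \<cdot>\<^bsub>Sp (Tgt E f)\<^esub> amap (lower_shriek E f) t"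
      by (elim fslice_arrE) (simp add: t' s)
  next
    fix t assume c: "cartesian_arr E (fslice E (Src E f)) t"
    then have t: "t \<in> Arr (Sp (Src E f))" by (simp add: cartesian_arr_def Let_def)
    then obtain p' q' p q v w where t': "t = ((p', q'), (p, q), (v, w))" by (rule fslice_arrE)
    then have pv: "f \<cdot> (p \<cdot> v) = f \<cdot> p'" using t by simp
    have "is_pullback E q w v q'" using c unfolding t' by (rule pullback_if_cartesian)
    then show "cartesian_arr E (fslice E (Tgt E f)) (amap (lower_shriek E f) t)"
      unfolding t' s by (intro cartesian_if_pullback) (use t pv f in \<open>simp_all add: t'\<close>)
  qed
qed

abbreviation pl :: "'m \<Rightarrow> 'm \<Rightarrow> 'm" where "pl f p \<equiv> fst (pb E f p)"
abbreviation pr :: "'m \<Rightarrow> 'm \<Rightarrow> 'm" where "pr f p \<equiv> snd (pb E f p)"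

lemma pb_simps [simp]:
  assumes "f \<in> Arr E" "p \<in> Arr E" "Tgt E f = Tgt E p"
  shows "pl f p \<in> Arr E" "pr f p \<in> Arr E" "Src E (pl f p) = Src E (pr f p)"
    "Tgt E (pl f p) = Src E f" "Tgt E (pr f p) = Src E p"
  using is_pullbackD[OF pb[OF assms]] by simp_all

lemma pb_eq:
  assumes "f \<in> Arr E" "p \<in> Arr E" "Tgt E f = Tgt E p"
  shows "f \<cdot> pl f p = p \<cdot> pr f p"
  using is_pullbackD[OF pb[OF assms]] by simp

text \<open>The first component of the action of \<open>upper_star\<close> on an arrow of spans.\<close>

definition pb_map :: "'m \<Rightarrow> 'm \<Rightarrow> 'm \<Rightarrow> 'm \<Rightarrow> 'm" where
  "pb_map f p' p v = (THE u. u \<in> Hom E (Src E (pl f p')) (Src E (pl f p)) \<and>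
     pl f p \<cdot> u = pl f p' \<and> pr f p \<cdot> u = v \<cdot> pr f p')"

lemma pb_map:
  assumes [simp]: "f \<in> Arr E" "p \<in> Arr E" "p' \<in> Arr E" "Tgt E p = Tgt E f" "Tgt E p' = Tgt E f"
    "v \<in> Arr E" "Src E v = Src E p'" "Tgt E v = Src E p" and pv: "p \<cdot> v = p'"
  shows "pb_map f p' p v \<in> Arr E" "Src E (pb_map f p' p v) = Src E (pr f p')"
    "Tgt E (pb_map f p' p v) = Src E (pr f p)" "pl f p \<cdot> pb_map f p' p v = pl f p'"
    "pr f p \<cdot> pb_map f p' p v = v \<cdot> pr f p'"
proof -
  have "\<exists>!u. u \<in> Hom E (Src E (pl f p')) (Src E (pl f p)) \<and>
     pl f p \<cdot> u = pl f p' \<and> pr f p \<cdot> u = v \<cdot> pr f p'"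
    by (rule pullback_univ[OF pb]) (use pb_eq[of f p'] extend[OF pv, of "pr f p'"] in simp_all)
  from theI'[OF this] show "pb_map f p' p v \<in> Arr E" "Src E (pb_map f p' p v) = Src E (pr f p')"
    "Tgt E (pb_map f p' p v) = Src E (pr f p)" "pl f p \<cdot> pb_map f p' p v = pl f p'"
    "pr f p \<cdot> pb_map f p' p v = v \<cdot> pr f p'"
    unfolding pb_map_def by (simp_all add: Hom_iff)
qed

lemma pb_map_eqI:
  assumes [simp]: "f \<in> Arr E" "p \<in> Arr E" "p' \<in> Arr E" "Tgt E p = Tgt E f" "Tgt E p' = Tgt E f"
    "v \<in> Arr E" "Src E v = Src E p'" "Tgt E v = Src E p" and pv: "p \<cdot> v = p'"
    and u: "u \<in> Arr E" "Src E u = Src E (pr f p')" "Tgt E u = Src E (pr f p)"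
      "pl f p \<cdot> u = pl f p'" "pr f p \<cdot> u = v \<cdot> pr f p'"
  shows "pb_map f p' p v = u"
  by (rule pullback_eqI[OF pb[of f p]]) (use u pb_map[of f p p' v] pv in simp_all)

lemma upper_star_simps [simp]:
  "omap (upper_star E f) (p, q) = (pl f p, q \<cdot> pr f p)"
  "amap (upper_star E f) ((p', q'), (p, q), (v, w)) =
     ((pl f p', q' \<cdot> pr f p'), (pl f p, q \<cdot> pr f p), (pb_map f p' p v, w))"
  by (simp_all add: upper_star_def Let_def pb_map_def)

text \<open>Cartesian arrows are preserved by pasting: the square formed by \<open>pb_map\<close> and the projections is a
  pullback because it is a base change over \<open>I\<close>.\<close>

lemma fibered_upper_star:
  assumes f [simp]: "f \<in> Arr E"
  shows "fibered_functor E (fslice E (Tgt E f)) (fslice E (Src E f)) (upper_star E f)"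
  unfolding fibered_functor_def is_functor_def
proof (intro conjI ballI allI impI fibered_fslice)
  fix x assume "x \<in> Obj (Sp (Tgt E f))"
  then obtain p q where x: "x = (p, q)" "p \<in> Arr E" "q \<in> Arr E" "Src E p = Src E q" "Tgt E p = Tgt E f" by (rule fslice_objE)
  show "omap (upper_star E f) x \<in> Obj (Sp (Src E f))"
    "omap (proj (fslice E (Src E f))) (omap (upper_star E f) x) = omap (proj (fslice E (Tgt E f))) x"
    using x by simp_all
  have "pb_map f p p (Ide E (Src E p)) = Ide E (Src E (pr f p))"
    by (rule pb_map_eqI) (use x in simp_all)
  then show "amap (upper_star E f) (Ide (Sp (Tgt E f)) x) = Ide (Sp (Src E f)) (omap (upper_star E f) x)"
    using x by simp
next
  fix t assume t0: "t \<in> Arr (Sp (Tgt E f))"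
  from t0 obtain p' q' p q v w where t': "t = ((p', q'), (p, q), (v, w))" and t:
    "p' \<in> Arr E" "q' \<in> Arr E" "Src E p' = Src E q'" "Tgt E p' = Tgt E f"
    "p \<in> Arr E" "q \<in> Arr E" "Src E p = Src E q" "Tgt E p = Tgt E f"
    "v \<in> Arr E" "Src E v = Src E q'" "Tgt E v = Src E q"
    "w \<in> Arr E" "Src E w = Tgt E q'" "Tgt E w = Tgt E q"
    "p \<cdot> v = p'" "q \<cdot> v = w \<cdot> q'" by (rule fslice_arrE)
  have m: "pb_map f p' p v \<in> Arr E" "Src E (pb_map f p' p v) = Src E (pr f p')"
    "Tgt E (pb_map f p' p v) = Src E (pr f p)" "pl f p \<cdot> pb_map f p' p v = pl f p'"
    "pr f p \<cdot> pb_map f p' p v = v \<cdot> pr f p'"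
    by (rule pb_map; use t in simp)+
  have "q \<cdot> (pr f p \<cdot> pb_map f p' p v) = w \<cdot> (q' \<cdot> pr f p')"
    using extend[OF t(16), of "pr f p'"] t m by simp
  then show "amap (upper_star E f) t \<in> Hom (Sp (Src E f)) (omap (upper_star E f) (Src (Sp (Tgt E f)) t))
      (omap (upper_star E f) (Tgt (Sp (Tgt E f)) t))"
    using t m by (simp add: t' Hom_iff)
  show "amap (proj (fslice E (Src E f))) (amap (upper_star E f) t) = amap (proj (fslice E (Tgt E f))) t"
    by (simp add: t')
  fix u assume u0: "u \<in> Arr (Sp (Tgt E f))" "Src (Sp (Tgt E f)) u = Tgt (Sp (Tgt E f)) t"
  from u0(1) obtain a' b' a b v2 w2 where u': "u = ((a', b'), (a, b), (v2, w2))" by (rule fslice_arrE)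
  with u0(2) t' have e: "a' = p" "b' = q" by simp_all
  have u: "a \<in> Arr E" "b \<in> Arr E" "Src E a = Src E b" "Tgt E a = Tgt E f"
    "v2 \<in> Arr E" "Src E v2 = Src E q" "Tgt E v2 = Src E b"
    "w2 \<in> Arr E" "Src E w2 = Tgt E q" "Tgt E w2 = Tgt E b" "a \<cdot> v2 = p"
    using u0(1) by (simp_all add: u' e)
  have m2: "pb_map f p a v2 \<in> Arr E" "Src E (pb_map f p a v2) = Src E (pr f p)"
    "Tgt E (pb_map f p a v2) = Src E (pr f a)" "pl f a \<cdot> pb_map f p a v2 = pl f p"
    "pr f a \<cdot> pb_map f p a v2 = v2 \<cdot> pr f p"
    by (rule pb_map; use t u in simp)+
  have "pb_map f p' a (v2 \<cdot> v) = pb_map f p a v2 \<cdot> pb_map f p' p v"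
  proof (rule pb_map_eqI)
    show "a \<cdot> (v2 \<cdot> v) = p'" using extend[OF u(11), of v] t u by simp
    show "pl f a \<cdot> (pb_map f p a v2 \<cdot> pb_map f p' p v) = pl f p'"
      using extend[OF m2(4), of "pb_map f p' p v"] m m2 t u by simp
    show "pr f a \<cdot> (pb_map f p a v2 \<cdot> pb_map f p' p v) = (v2 \<cdot> v) \<cdot> pr f p'"
      using extend[OF m2(5), of "pb_map f p' p v"] m m2 t u by simp
  qed (use t u m m2 in simp_all)
  then show "amap (upper_star E f) (u \<cdot>\<^bsub>Sp (Tgt E f)\<^esub> t) =
      amap (upper_star E f) u \<cdot>\<^bsub>Sp (Src E f)\<^esub> amap (upper_star E f) t"
    by (simp add: t' u' e)
next
  fix t assume c: "cartesian_arr E (fslice E (Tgt E f)) t"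
  then have t0: "t \<in> Arr (Sp (Tgt E f))" by (simp add: cartesian_arr_def Let_def)
  then obtain p' q' p q v w where t': "t = ((p', q'), (p, q), (v, w))" and t:
    "p' \<in> Arr E" "q' \<in> Arr E" "Src E p' = Src E q'" "Tgt E p' = Tgt E f"
    "p \<in> Arr E" "q \<in> Arr E" "Src E p = Src E q" "Tgt E p = Tgt E f"
    "v \<in> Arr E" "Src E v = Src E q'" "Tgt E v = Src E q"
    "w \<in> Arr E" "Src E w = Tgt E q'" "Tgt E w = Tgt E q"
    "p \<cdot> v = p'" "q \<cdot> v = w \<cdot> q'" by (rule fslice_arrE)
  have m: "pb_map f p' p v \<in> Arr E" "Src E (pb_map f p' p v) = Src E (pr f p')"
    "Tgt E (pb_map f p' p v) = Src E (pr f p)" "pl f p \<cdot> pb_map f p' p v = pl f p'"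
    "pr f p \<cdot> pb_map f p' p v = v \<cdot> pr f p'"
    by (rule pb_map; use t in simp)+
  have sq: "q \<cdot> (pr f p \<cdot> pb_map f p' p v) = w \<cdot> (q' \<cdot> pr f p')"
    using extend[OF t(16), of "pr f p'"] t m by simp
  have pbq: "is_pullback E q w v q'" using c unfolding t' by (rule pullback_if_cartesian)
  have "is_pullback E (q \<cdot> pr f p) w (pb_map f p' p v) (q' \<cdot> pr f p')"
  proof (rule is_pullbackI)
    fix c d assume cd: "c \<in> Arr E" "d \<in> Arr E" "Src E c = Src E d" "Tgt E c = Src E (q \<cdot> pr f p)" "Tgt E d = Src E w"
      "(q \<cdot> pr f p) \<cdot> c = w \<cdot> d"
    have cT: "Tgt E c = Src E (pr f p)" using cd t by simp
    have "q \<cdot> (pr f p \<cdot> c) = w \<cdot> d" using cd cT t by simp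
    then obtain h where h: "h \<in> Arr E" "Src E h = Src E (pr f p \<cdot> c)" "Tgt E h = Src E v" "v \<cdot> h = pr f p \<cdot> c" "q' \<cdot> h = d"
      by (rule pullback_lift[OF pbq, of "pr f p \<cdot> c" d, rotated 5]) (use cd(1-3,5) cT t in simp_all)
    have "f \<cdot> (pl f p \<cdot> c) = p' \<cdot> h"
      using extend[OF pb_eq[of f p], of c] extend[OF t(15), of h] h cd(1-3,5) cT t by simp
    then obtain l where l: "l \<in> Arr E" "Src E l = Src E (pl f p \<cdot> c)" "Tgt E l = Src E (pl f p')" "pl f p' \<cdot> l = pl f p \<cdot> c" "pr f p' \<cdot> l = h"
      by (rule pullback_lift[OF pb, of f p' "pl f p \<cdot> c" h, rotated 8]) (use cd(1-3,5) cT t h in simp_all)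
    have "pb_map f p' p v \<cdot> l = c"
    proof (rule pullback_eqI[OF pb[of f p]])
      show "pl f p \<cdot> (pb_map f p' p v \<cdot> l) = pl f p \<cdot> c"
        using extend[OF m(4), of l] m l cd(1-3,5) cT t by simp
      show "pr f p \<cdot> (pb_map f p' p v \<cdot> l) = pr f p \<cdot> c"
        using extend[OF m(5), of l] m l h cd(1-3,5) cT t by simp
    qed (use m l cd(1-3,5) cT t in simp_all)
    then show "\<exists>u. u \<in> Arr E \<and> Src E u = Src E c \<and> Tgt E u = Src E (pb_map f p' p v) \<and>
        pb_map f p' p v \<cdot> u = c \<and> (q' \<cdot> pr f p') \<cdot> u = d"
      using m l h cd(1-3,5) cT t by (intro exI[of _ l]) simp
  next
    fix c d assume cd: "c \<in> Arr E" "d \<in> Arr E" "Src E c = Src E d" "Tgt E c = Src E (pb_map f p' p v)"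
      "Tgt E d = Src E (pb_map f p' p v)" "pb_map f p' p v \<cdot> c = pb_map f p' p v \<cdot> d" "(q' \<cdot> pr f p') \<cdot> c = (q' \<cdot> pr f p') \<cdot> d"
    have cT: "Tgt E c = Src E (pr f p')" "Tgt E d = Src E (pr f p')" using cd m by simp_all
    show "c = d"
    proof (rule pullback_eqI[OF pb[of f p']])
      show "pl f p' \<cdot> c = pl f p' \<cdot> d"
        using extend[OF m(4), of c] extend[OF m(4), of d] m cd(1-3,6) cT t by simp
      show "pr f p' \<cdot> c = pr f p' \<cdot> d"
      proof (rule pullback_eqI[OF pbq])
        show "v \<cdot> (pr f p' \<cdot> c) = v \<cdot> (pr f p' \<cdot> d)"
          using extend[OF m(5), of c] extend[OF m(5), of d] m cd(1-3,6) cT t by simp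
        show "q' \<cdot> (pr f p' \<cdot> c) = q' \<cdot> (pr f p' \<cdot> d)" using cd(1-3,7) cT t by simp
      qed (use cd(1-3) cT t in simp_all)
    qed (use cd(1-3) cT t in simp_all)
  qed (use t m sq in simp_all)
  then show "cartesian_arr E (fslice E (Src E f)) (amap (upper_star E f) t)"
    unfolding t' upper_star_simps by (intro cartesian_if_pullback) (use t m sq in simp_all)
qed

lemma lower_shriek_simps [simp]:
  "omap (lower_shriek E f) (p, q) = (f \<cdot> p, q)"
  "amap (lower_shriek E f) ((p', q'), (p, q), vw) = ((f \<cdot> p', q'), (f \<cdot> p, q), vw)"
  by (simp_all add: lower_shriek_def Let_def)

lemma shriek_star_adj:
  assumes f [simp]: "f \<in> Arr E"
  shows "counit_adj E (fslice E (Src E f)) (fslice E (Tgt E f)) (lower_shriek E f) (upper_star E f)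
    (\<lambda>(p, q). ((f \<cdot> pl f p, q \<cdot> pr f p), (p, q), (pr f p, Ide E (Tgt E q))))"
  (is "counit_adj _ ?G ?F _ _ ?\<epsilon>")
  unfolding counit_adj_def fibered_nat_trans_def nat_trans_def
proof (intro conjI ballI fibered_lower_shriek fibered_upper_star f)
  fix x assume "x \<in> Obj (total ?F)"
  then obtain p q where x: "x = (p, q)" "p \<in> Arr E" "q \<in> Arr E" "Src E p = Src E q" "Tgt E p = Tgt E f" by (rule fslice_objE)
  have e: "f \<cdot> pl f p = p \<cdot> pr f p" using x by (intro pb_eq) simp_all
  show "?\<epsilon> x \<in> Hom (total ?F) (omap (lower_shriek E f \<odot> upper_star E f) x) (omap idF x)"
    "amap (proj ?F) (?\<epsilon> x) = Ide E (omap (proj ?F) x)"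
    using x e by (simp_all add: Hom_iff)
  fix y g assume y0: "y \<in> Obj (total ?G)" and g0: "g \<in> Hom (total ?F) (omap (lower_shriek E f) y) x"
  from y0 obtain a b where y: "y = (a, b)" "a \<in> Arr E" "b \<in> Arr E" "Src E a = Src E b" "Tgt E a = Src E f" by (rule fslice_objE)
  obtain v w where g: "g = ((f \<cdot> a, b), (p, q), (v, w))" "v \<in> Arr E" "Src E v = Src E b" "Tgt E v = Src E q"
    "w \<in> Arr E" "Src E w = Tgt E b" "Tgt E w = Tgt E q" "p \<cdot> v = f \<cdot> a" "q \<cdot> v = w \<cdot> b"
    using g0 x(1) y(1) by (auto simp: Hom_iff elim!: fslice_arrE)
  from g(8) have "f \<cdot> a = p \<cdot> v" by simp
  then obtain u where u: "u \<in> Arr E" "Src E u = Src E a" "Tgt E u = Src E (pl f p)" "pl f p \<cdot> u = a" "pr f p \<cdot> u = v"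
    by (rule pullback_lift[OF pb, of f p a v, rotated 8]) (use x y g(2-7) in simp_all)
  show "\<exists>!h. h \<in> Hom (total ?G) y (omap (upper_star E f) x) \<and> ?\<epsilon> x \<cdot>\<^bsub>total ?F\<^esub> amap (lower_shriek E f) h = g"
  proof (rule ex1I[of _ "((a, b), (pl f p, q \<cdot> pr f p), (u, w))"])
    show "((a, b), (pl f p, q \<cdot> pr f p), (u, w)) \<in> Hom (total ?G) y (omap (upper_star E f) x) \<and>
      ?\<epsilon> x \<cdot>\<^bsub>total ?F\<^esub> amap (lower_shriek E f) ((a, b), (pl f p, q \<cdot> pr f p), (u, w)) = g"
      using x y g u by (simp add: Hom_iff)
    fix h assume h0: "h \<in> Hom (total ?G) y (omap (upper_star E f) x) \<and> ?\<epsilon> x \<cdot>\<^bsub>total ?F\<^esub> amap (lower_shriek E f) h = g"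
    then have "h \<in> Arr (total ?G)" "Src (total ?G) h = (a, b)" "Tgt (total ?G) h = (pl f p, q \<cdot> pr f p)"
      using x y by (simp_all add: Hom_iff)
    then obtain u' w' where h: "h = ((a, b), (pl f p, q \<cdot> pr f p), (u', w'))" "u' \<in> Arr E" "Src E u' = Src E b"
        "Tgt E u' = Src E (q \<cdot> pr f p)" "w' \<in> Arr E" "Src E w' = Tgt E b" "Tgt E w' = Tgt E (q \<cdot> pr f p)" "pl f p \<cdot> u' = a"
      by (elim fslice_arrE) simp
    have "pr f p \<cdot> u' = v" "w' = w" using h0 h x g by simp_all
    moreover from this have "u' = u"
      by (intro pullback_eqI[OF pb[of f p], of u' u]) (use h x u y in simp_all)
    ultimately show "h = ((a, b), (pl f p, q \<cdot> pr f p), (u, w))" using h by simp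
  qed
next
  fix t assume "t \<in> Arr (total ?F)"
  then obtain p' q' p q v w where t': "t = ((p', q'), (p, q), (v, w))" and t:
    "p' \<in> Arr E" "q' \<in> Arr E" "Src E p' = Src E q'" "Tgt E p' = Tgt E f"
    "p \<in> Arr E" "q \<in> Arr E" "Src E p = Src E q" "Tgt E p = Tgt E f"
    "v \<in> Arr E" "Src E v = Src E q'" "Tgt E v = Src E q"
    "w \<in> Arr E" "Src E w = Tgt E q'" "Tgt E w = Tgt E q"
    "p \<cdot> v = p'" "q \<cdot> v = w \<cdot> q'" by (rule fslice_arrE)
  have "pr f p \<cdot> pb_map f p' p v = v \<cdot> pr f p'" by (rule pb_map) (use t in simp_all)
  then show "amap idF t \<cdot>\<^bsub>total ?F\<^esub> ?\<epsilon> (Src (total ?F) t) =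
      ?\<epsilon> (Tgt (total ?F) t) \<cdot>\<^bsub>total ?F\<^esub> amap (lower_shriek E f \<odot> upper_star E f) t"
    using t by (simp add: t')
qed

lemma star_couniversal:
  assumes f [simp]: "f \<in> Arr E" and xq: "(x, q) \<in> Obj (Sp (Src E f))"
    and dp: "dependent_product f x q n k \<epsilon>"
  shows "couniversal E (fslice E (Tgt E f)) (fslice E (Src E f)) (upper_star E f) (x, q) (n, k)
    ((pl f n, k \<cdot> pr f n), (x, q), (\<epsilon>, Ide E (Tgt E q)))"
proof -
  have nk: "n \<in> Arr E" "k \<in> Arr E" "Src E n = Src E k" "Tgt E n = Tgt E f" "Tgt E k = Tgt E q"
    and \<epsilon>: "\<epsilon> \<in> Arr E" "Src E \<epsilon> = Src E (pl f n)" "Tgt E \<epsilon> = Src E x" "x \<cdot> \<epsilon> = pl f n" "q \<cdot> \<epsilon> = k \<cdot> pr f n"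
    using dp unfolding dependent_product_def by blast+
  have xs: "x \<in> Arr E" "q \<in> Arr E" "Src E x = Src E q" "Tgt E x = Src E f" using xq by simp_all
  show ?thesis unfolding couniversal_def
  proof (intro conjI ballI)
    show "((pl f n, k \<cdot> pr f n), (x, q), (\<epsilon>, Ide E (Tgt E q))) \<in> Hom (Sp (Src E f)) (omap (upper_star E f) (n, k)) (x, q)"
      using nk \<epsilon> xs by (simp add: Hom_iff)
    fix Y g assume Y0: "Y \<in> Obj (Sp (Tgt E f))"
      and g0: "g \<in> Hom (Sp (Src E f)) (omap (upper_star E f) Y) (x, q)"
    from Y0 obtain y r where Y: "Y = (y, r)" "y \<in> Arr E" "r \<in> Arr E" "Src E y = Src E r" "Tgt E y = Tgt E f" by (rule fslice_objE)
    have "g \<in> Arr (Sp (Src E f))" "Src (Sp (Src E f)) g = (pl f y, r \<cdot> pr f y)"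
      "Tgt (Sp (Src E f)) g = (x, q)" using g0 Y by (simp_all add: Hom_iff)
    then obtain v w where g: "g = ((pl f y, r \<cdot> pr f y), (x, q), (v, w))" "v \<in> Arr E" "Src E v = Src E (r \<cdot> pr f y)" "Tgt E v = Src E q"
      "w \<in> Arr E" "Src E w = Tgt E (r \<cdot> pr f y)" "Tgt E w = Tgt E q" "x \<cdot> v = pl f y" "q \<cdot> v = w \<cdot> (r \<cdot> pr f y)"
      by (elim fslice_arrE) simp
    have py: "is_pullback E f y (pl f y) (pr f y)" by (rule pb) (use Y in simp_all)
    have wr: "w \<cdot> r \<in> Arr E" "Src E y = Src E (w \<cdot> r)" "Tgt E (w \<cdot> r) = Tgt E q" "Src E v = Src E (pl f y)" "Tgt E v = Src E x"
      "q \<cdot> v = (w \<cdot> r) \<cdot> pr f y"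
      using Y g xs by simp_all
    obtain h l where h: "h \<in> Arr E" "Src E h = Src E y" "Tgt E h = Src E n" "n \<cdot> h = y" "k \<cdot> h = w \<cdot> r"
      and l: "l \<in> Arr E" "Src E l = Src E (pl f y)" "Tgt E l = Src E (pl f n)" "pl f n \<cdot> l = pl f y" "pr f n \<cdot> l = h \<cdot> pr f y" "\<epsilon> \<cdot> l = v"
      using dp py wr g(2,8) unfolding dependent_product_def by blast
    have ml: "pb_map f y n h = l" by (rule pb_map_eqI) (use h l nk Y in simp_all)
    show "\<exists>!j. j \<in> Hom (Sp (Tgt E f)) Y (n, k) \<and>
        ((pl f n, k \<cdot> pr f n), (x, q), (\<epsilon>, Ide E (Tgt E q))) \<cdot>\<^bsub>Sp (Src E f)\<^esub> amap (upper_star E f) j = g"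
    proof (rule ex1I[of _ "((y, r), (n, k), (h, w))"])
      show "((y, r), (n, k), (h, w)) \<in> Hom (Sp (Tgt E f)) Y (n, k) \<and>
        ((pl f n, k \<cdot> pr f n), (x, q), (\<epsilon>, Ide E (Tgt E q))) \<cdot>\<^bsub>Sp (Src E f)\<^esub> amap (upper_star E f) ((y, r), (n, k), (h, w)) = g"
        using Y h l nk g by (simp add: Hom_iff ml)
      fix j assume j0: "j \<in> Hom (Sp (Tgt E f)) Y (n, k) \<and>
        ((pl f n, k \<cdot> pr f n), (x, q), (\<epsilon>, Ide E (Tgt E q))) \<cdot>\<^bsub>Sp (Src E f)\<^esub> amap (upper_star E f) j = g"
      then have "j \<in> Arr (Sp (Tgt E f))" "Src (Sp (Tgt E f)) j = (y, r)"
        "Tgt (Sp (Tgt E f)) j = (n, k)" using Y by (simp_all add: Hom_iff)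
      then obtain h' w' where j: "j = ((y, r), (n, k), (h', w'))" "h' \<in> Arr E" "Src E h' = Src E r" "Tgt E h' = Src E k"
        "w' \<in> Arr E" "Src E w' = Tgt E r" "Tgt E w' = Tgt E k" "n \<cdot> h' = y" "k \<cdot> h' = w' \<cdot> r"
        by (elim fslice_arrE) simp
      have w': "w' = w" and \<epsilon>l: "\<epsilon> \<cdot> pb_map f y n h' = v" using j0 j g nk by simp_all
      have m: "pb_map f y n h' \<in> Arr E" "Src E (pb_map f y n h') = Src E (pr f y)" "Tgt E (pb_map f y n h') = Src E (pr f n)"
        "pl f n \<cdot> pb_map f y n h' = pl f y" "pr f n \<cdot> pb_map f y n h' = h' \<cdot> pr f y"
        by (rule pb_map; use j nk Y in simp)+
      have pre: "is_pullback E f y (pl f y) (pr f y) \<and>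
        h' \<in> Arr E \<and> Src E h' = Src E y \<and> Tgt E h' = Src E n \<and> n \<cdot> h' = y \<and>
        h \<in> Arr E \<and> Src E h = Src E y \<and> Tgt E h = Src E n \<and> n \<cdot> h = y \<and> k \<cdot> h' = k \<cdot> h \<and>
        pb_map f y n h' \<in> Arr E \<and> Src E (pb_map f y n h') = Src E (pl f y) \<and> Tgt E (pb_map f y n h') = Src E (pl f n) \<and>
        pl f n \<cdot> pb_map f y n h' = pl f y \<and> pr f n \<cdot> pb_map f y n h' = h' \<cdot> pr f y \<and>
        l \<in> Arr E \<and> Src E l = Src E (pl f y) \<and> Tgt E l = Src E (pl f n) \<and>
        pl f n \<cdot> l = pl f y \<and> pr f n \<cdot> l = h \<cdot> pr f y \<and> \<epsilon> \<cdot> pb_map f y n h' = \<epsilon> \<cdot> l"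
        using py h l m j(2-) nk Y w' \<epsilon>l by simp
      have "h' = h" using dp pre unfolding dependent_product_def by blast
      then show "j = ((y, r), (n, k), (h, w))" using j w' by simp
    qed
  qed (use nk in simp_all)
qed

text \<open>The choice in the definition of \<open>lower_star\<close> is made among fibered right adjoints, and the dependent
  products provide one.\<close>

lemma lower_star_adj:
  assumes f: "f \<in> Arr E"
  shows "\<exists>\<epsilon>. counit_adj E (fslice E (Tgt E f)) (fslice E (Src E f)) (upper_star E f) (lower_star E f) \<epsilon>"
proof -
  have "\<exists>R \<epsilon>. counit_adj E (fslice E (Tgt E f)) (fslice E (Src E f)) (upper_star E f) R \<epsilon>"
  proof (rule pointwise_right_adjoint[OF fibered_upper_star[OF f]])
    fix X assume X: "X \<in> Obj (Sp (Src E f))"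
    then obtain x q where x: "X = (x, q)" "x \<in> Arr E" "q \<in> Arr E" "Src E x = Src E q" "Tgt E x = Src E f" by (rule fslice_objE)
    obtain n k \<epsilon> where dp: "dependent_product f x q n k \<epsilon>" using dependent_product_ex[OF f x(2-5)] by blast
    show "\<exists>r e. couniversal E (fslice E (Tgt E f)) (fslice E (Src E f)) (upper_star E f) X r e"
      using star_couniversal[OF f _ dp] X unfolding x(1) by blast
  qed
  then obtain R \<epsilon> where "counit_adj E (fslice E (Tgt E f)) (fslice E (Src E f)) (upper_star E f) R \<epsilon>" by (elim exE)
  from adj.fibered_adjunction[OF adjI[OF this]]
  have ex: "\<exists>R \<eta> \<epsilon>. fibered_adjunction E (fslice E (Tgt E f)) (fslice E (Src E f)) (upper_star E f) R \<eta> \<epsilon>"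
    by (intro exI[of _ R]) (elim exE, intro exI)
  have "\<exists>\<eta> \<epsilon>. fibered_adjunction E (fslice E (Tgt E f)) (fslice E (Src E f)) (upper_star E f) (lower_star E f) \<eta> \<epsilon>"
    unfolding lower_star_def by (rule someI_ex[OF ex])
  then obtain \<eta> \<epsilon> where "fibered_adjunction E (fslice E (Tgt E f)) (fslice E (Src E f)) (upper_star E f) (lower_star E f) \<eta> \<epsilon>"
    by (elim exE)
  then show ?thesis by (intro exI) (rule fibered_adjunction_counit)
qed

lemma polynomial_adj:
  assumes "s \<in> Hom E M I" "p \<in> Hom E M B"
  shows "\<exists>\<epsilon>. counit_adj E (fslice E B) (fslice E I) (lower_shriek E s \<odot> upper_star E p) (lower_star E p \<odot> upper_star E s) \<epsilon>"
proof -
  have s: "s \<in> Arr E" "Src E s = M" "Tgt E s = I" and p: "p \<in> Arr E" "Src E p = M" "Tgt E p = B"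
    using assms by (simp_all add: Hom_iff)
  obtain \<epsilon> where "counit_adj E (fslice E B) (fslice E M) (upper_star E p) (lower_star E p) \<epsilon>"
    using lower_star_adj[OF p(1)] p by auto
  then show ?thesis
    using counit_adj_comp[OF shriek_star_adj[OF s(1)]] s by blast
qed

lemma iso_arr_fslice:
  assumes "((a, b), (c, d), (v, w)) \<in> Arr (Sp I)" "w = Ide E (Tgt E b)" "Tgt E d = Tgt E b"
    "j \<in> Arr E" "Src E j = Tgt E v" "Tgt E j = Src E v"
    "j \<cdot> v = Ide E (Src E v)" "v \<cdot> j = Ide E (Tgt E v)"
  shows "iso_arr (Sp I) ((a, b), (c, d), (v, w))"
proof -
  have "a \<cdot> j = c" "b \<cdot> j = d"
    using extend[of c v a j] extend[of d v b j] assms by simp_all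
  then show ?thesis unfolding iso_arr_def
    by (intro conjI bexI[of _ "((c, d), (a, b), (j, w))"]) (use assms in \<open>simp_all add: Hom_iff\<close>)
qed

lemma pullback_compare:
  assumes p1: "is_pullback E f g a b" and p2: "is_pullback E f g a' b'"
  shows "\<exists>u j. u \<in> Arr E \<and> Src E u = Src E a' \<and> Tgt E u = Src E a \<and> a \<cdot> u = a' \<and> b \<cdot> u = b' \<and>
    j \<in> Arr E \<and> Src E j = Src E a \<and> Tgt E j = Src E a' \<and> j \<cdot> u = Ide E (Src E a') \<and> u \<cdot> j = Ide E (Src E a)"
proof -
  note 1 = is_pullbackD[OF p1] and 2 = is_pullbackD[OF p2]
  obtain u where u: "u \<in> Arr E" "Src E u = Src E a'" "Tgt E u = Src E a" "a \<cdot> u = a'" "b \<cdot> u = b'"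
    by (rule pullback_lift[OF p1 2(3,4,6,7,8,9)])
  obtain j where j: "j \<in> Arr E" "Src E j = Src E a" "Tgt E j = Src E a'" "a' \<cdot> j = a" "b' \<cdot> j = b"
    by (rule pullback_lift[OF p2 1(3,4,6,7,8,9)])
  have "j \<cdot> u = Ide E (Src E a')"
    by (rule pullback_eqI[OF p2]) (use 1(3,4) 2(3,4) u j 2(6)[symmetric] extend[OF j(4), of u] extend[OF j(5), of u] in simp_all)
  moreover have "u \<cdot> j = Ide E (Src E a)"
    by (rule pullback_eqI[OF p1]) (use 1(3,4) 2(3,4) u j 1(6)[symmetric] extend[OF u(4), of j] extend[OF u(5), of j] in simp_all)
  ultimately show ?thesis using u j by blast
qed

text \<open>A fibered left adjoint on \<open>E|B\<close> is determined by its value \<open>I \<leftarrow> M \<rightarrow> B\<close>, with legs \<open>s\<close> and \<open>p\<close>, at the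
  diagonal span \<open>(id, id)\<close>. Any span \<open>(x, y)\<close> is linked to the diagonal by
  \<open>(id, id) \<leftarrow> (x, id) \<rightarrow> (x, y)\<close>, a cartesian arrow over \<open>x\<close> and an opcartesian arrow over \<open>y\<close>. The functor \<open>L\<close> preserves the first by
  assumption and the second because it is a left adjoint over the base. Hence \<open>L (x, id)\<close> is the pullback of
  \<open>(s, p)\<close> along \<open>x\<close>, and \<open>L (x, y)\<close> is obtained from it by composing the right leg with \<open>y\<close>; this is
  \<open>s\<^sub>! p\<^sup>* (x, y)\<close>.\<close>

lemma left_adjoint_polynomial:
  assumes adj: "counit_adj E (fslice E B) (fslice E I) L R \<epsilon>" and B [simp]: "B \<in> Obj E"
  shows "\<exists>M s p \<theta>. s \<in> Hom E M I \<and> p \<in> Hom E M B \<and>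
    vertical_iso E (fslice E B) (fslice E I) (lower_shriek E s \<odot> upper_star E p) L \<theta>"
proof -
  interpret a: adj E "fslice E B" "fslice E I" L R \<epsilon> using adj by (rule adjI)
  let ?G = "Sp B" and ?F = "Sp I"
  let ?D = "(Ide E B, Ide E B)"
  obtain s p where sp: "omap L ?D = (s, p)" by (cases "omap L ?D")
  have "omap L ?D \<in> Obj ?F" "omap (proj (fslice E I)) (omap L ?D) = B" by simp_all
  then have s [simp]: "s \<in> Arr E" "Src E s = Src E p" "Tgt E s = I" and p [simp]: "p \<in> Arr E" "Tgt E p = B"
    unfolding sp by simp_all
  \<comment> \<open>The functor is over the base, so only the first component of its value on an arrow is unknown.\<close>
  define lv where "lv t = fst (snd (snd (amap L t)))" for t
  have L: "amap L (X, Y, (v, w)) = (omap L X, omap L Y, (lv (X, Y, (v, w)), w))"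
    and L_arr: "(omap L X, omap L Y, (lv (X, Y, (v, w)), w)) \<in> Arr ?F"
    if t: "(X, Y, (v, w)) \<in> Arr ?G" for X Y v w
  proof -
    have "amap L (X, Y, (v, w)) \<in> Arr ?F" "Src ?F (amap L (X, Y, (v, w))) = omap L X" "Tgt ?F (amap L (X, Y, (v, w))) = omap L Y"
       "amap (proj (fslice E I)) (amap L (X, Y, (v, w))) = w"
      using t by (simp_all del: fslice_simps(1,2))
    then show "amap L (X, Y, (v, w)) = (omap L X, omap L Y, (lv (X, Y, (v, w)), w))"
      by (elim fslice_arrE) (simp add: lv_def)
    then show "(omap L X, omap L Y, (lv (X, Y, (v, w)), w)) \<in> Arr ?F" 
      using \<open>amap L (X, Y, (v, w)) \<in> Arr ?F\<close> by simp
  qed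
  \<comment> \<open>\<open>(s1 x, p1 x)\<close> is \<open>L (x, id)\<close> and \<open>(s2 x y, p2 x y)\<close> is \<open>L (x, y)\<close>.\<close>
  define s1 where "s1 x = fst (omap L (x, Ide E (Src E x)))" for x
  define p1 where "p1 x = snd (omap L (x, Ide E (Src E x)))" for x
  define s2 where "s2 x y = fst (omap L (x, y))" for x y
  define p2 where "p2 x y = snd (omap L (x, y))" for x y
  have Lx: "omap L (x, Ide E (Src E x)) = (s1 x, p1 x)" and Lxy: "omap L (x, y) = (s2 x y, p2 x y)" for x y
    by (simp_all add: s1_def p1_def s2_def p2_def)
  have sp2: "s2 x y \<in> Arr E" "p2 x y \<in> Arr E" "Src E (s2 x y) = Src E (p2 x y)" "Tgt E (s2 x y) = I" "Tgt E (p2 x y) = Tgt E y"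
    if "x \<in> Arr E" "y \<in> Arr E" "Src E x = Src E y" "Tgt E x = B" for x y
  proof -
    have "omap L (x, y) \<in> Obj ?F" "omap (proj (fslice E I)) (omap L (x, y)) = Tgt E y"
      using that by simp_all
    then show "s2 x y \<in> Arr E" "p2 x y \<in> Arr E" "Src E (s2 x y) = Src E (p2 x y)" "Tgt E (s2 x y) = I" "Tgt E (p2 x y) = Tgt E y"
      by (simp_all add: Lxy)
  qed
  have sp1: "s1 x \<in> Arr E" "p1 x \<in> Arr E" "Src E (s1 x) = Src E (p1 x)" "Tgt E (s1 x) = I" "Tgt E (p1 x) = Src E x"
    if "x \<in> Arr E" "Tgt E x = B" for x
    using sp2[of x "Ide E (Src E x)"] that by (simp_all add: s1_def p1_def s2_def p2_def)

  \<comment> \<open>The image of the cartesian arrow \<open>(x, id) \<rightarrow> (id, id)\<close>.\<close>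
  define kv where "kv x = lv ((x, Ide E (Src E x)), ?D, (x, x))" for x
  have k_arr: "((x, Ide E (Src E x)), ?D, (x, x)) \<in> Arr ?G" if "x \<in> Arr E" "Tgt E x = B" for x
    using that by simp
  have kL: "amap L ((x, Ide E (Src E x)), ?D, (x, x)) = ((s1 x, p1 x), (s, p), (kv x, x))"
    if "x \<in> Arr E" "Tgt E x = B" for x
    using L[OF k_arr[OF that]] by (simp add: Lx sp kv_def)
  have kv: "kv x \<in> Arr E" "Src E (kv x) = Src E (p1 x)" "Tgt E (kv x) = Src E p" "s \<cdot> kv x = s1 x" "p \<cdot> kv x = x \<cdot> p1 x"
    if "x \<in> Arr E" "Tgt E x = B" for x
    using L_arr[OF k_arr[OF that]] unfolding Lx sp kv_def[symmetric] by simp_all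
  have kpb: "is_pullback E p x (kv x) (p1 x)" if x: "x \<in> Arr E" "Tgt E x = B" for x
  proof -
    have "is_pullback E (Ide E B) x x (Ide E (Src E x))"
      by (rule is_pullbackI) (use x in \<open>auto\<close>)
    then have "cartesian_arr E (fslice E B) ((x, Ide E (Src E x)), ?D, (x, x))"
      by (rule cartesian_if_pullback[OF k_arr[OF x]])
    from a.L.cartesian[OF this] show ?thesis
      unfolding kL[OF x] by (rule pullback_if_cartesian)
  qed
  \<comment> \<open>Both \<open>L (x, id)\<close> and the chosen pullback are pullbacks of \<open>p\<close> along \<open>x\<close>; \<open>u x\<close> compares them.\<close>
  have "\<exists>u. \<forall>x. x \<in> Arr E \<and> Tgt E x = B \<longrightarrow>
    (\<exists>j. u x \<in> Arr E \<and> Src E (u x) = Src E (pl p x) \<and> Tgt E (u x) = Src E (kv x) \<and> kv x \<cdot> u x = pl p x \<and> p1 x \<cdot> u x = pr p x \<and>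
     j \<in> Arr E \<and> Src E j = Src E (kv x) \<and> Tgt E j = Src E (pl p x) \<and> j \<cdot> u x = Ide E (Src E (pl p x)) \<and> u x \<cdot> j = Ide E (Src E (kv x)))"
    by (rule choice) (use pullback_compare[OF kpb pb[of p]] in simp)
  then obtain u where u': "\<And>x. x \<in> Arr E \<and> Tgt E x = B \<longrightarrow>
    (\<exists>j. u x \<in> Arr E \<and> Src E (u x) = Src E (pl p x) \<and> Tgt E (u x) = Src E (kv x) \<and> kv x \<cdot> u x = pl p x \<and> p1 x \<cdot> u x = pr p x \<and>
     j \<in> Arr E \<and> Src E j = Src E (kv x) \<and> Tgt E j = Src E (pl p x) \<and> j \<cdot> u x = Ide E (Src E (pl p x)) \<and> u x \<cdot> j = Ide E (Src E (kv x)))"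
    by blast
  have u: "u x \<in> Arr E" "Src E (u x) = Src E (pr p x)" "Tgt E (u x) = Src E (p1 x)" "kv x \<cdot> u x = pl p x" "p1 x \<cdot> u x = pr p x"
    and u_inv: "\<exists>j. j \<in> Arr E \<and> Src E j = Src E (p1 x) \<and> Tgt E j = Src E (pr p x) \<and> j \<cdot> u x = Ide E (Src E (pr p x)) \<and> u x \<cdot> j = Ide E (Src E (p1 x))"
    if "x \<in> Arr E" "Tgt E x = B" for x
    using u'[of x] that kv[OF that] by auto

  \<comment> \<open>The opcartesian arrow \<open>(x, id) \<rightarrow> (x, y)\<close>.\<close>
  let ?w = "\<lambda>x y. ((x, Ide E (Src E x)), (x, y), (Ide E (Src E x), y))"
  define ov where "ov x y = lv (?w x y)" for x y
  have w_arr: "?w x y \<in> Arr ?G" if "x \<in> Arr E" "y \<in> Arr E" "Src E x = Src E y" "Tgt E x = B" for x y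
    using that by simp
  have wL: "amap L (?w x y) = ((s1 x, p1 x), (s2 x y, p2 x y), (ov x y, y))"
    if "x \<in> Arr E" "y \<in> Arr E" "Src E x = Src E y" "Tgt E x = B" for x y
    using L[OF w_arr[OF that]] unfolding Lx unfolding Lxy ov_def by (simp del: fslice_simps(2))
  have ov: "ov x y \<in> Arr E" "Src E (ov x y) = Src E (p1 x)" "Tgt E (ov x y) = Src E (p2 x y)"
      "s2 x y \<cdot> ov x y = s1 x" "p2 x y \<cdot> ov x y = y \<cdot> p1 x"
    if "x \<in> Arr E" "y \<in> Arr E" "Src E x = Src E y" "Tgt E x = B" for x y
    using L_arr[OF w_arr[OF that]] unfolding Lx unfolding Lxy ov_def[symmetric] by simp_all
  have ov_inv: "\<exists>j. j \<in> Arr E \<and> Src E j = Src E (p2 x y) \<and> Tgt E j = Src E (p1 x) \<and>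
      j \<cdot> ov x y = Ide E (Src E (p1 x)) \<and> ov x y \<cdot> j = Ide E (Src E (p2 x y))"
    if xy: "x \<in> Arr E" "y \<in> Arr E" "Src E x = Src E y" "Tgt E x = B" for x y
  proof -
    note [simp] = xy sp1[OF xy(1,4)] sp2[OF xy] ov[OF xy]
    have xyO: "(x, y) \<in> Obj ?G" "(x, Ide E (Src E x)) \<in> Obj ?G" by simp_all
    \<comment> \<open>The inverse \<open>j\<close>: composing the right leg of \<open>L (x, id)\<close> with \<open>y\<close> gives a span \<open>?Z\<close> and an arrow
      \<open>?g : L (x, id) \<rightarrow> ?Z\<close> over \<open>y\<close>, whose transpose factors through \<open>?w\<close>.\<close>
    let ?Z = "(s1 x, y \<cdot> p1 x)"
    let ?g = "((s1 x, p1 x), ?Z, (Ide E (Src E (p1 x)), y))"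
    have ZO: "?Z \<in> Obj ?F" and gA: "?g \<in> Arr ?F" by simp_all
    obtain h where h0: "h \<in> Arr ?G" "Src ?G h = (x, Ide E (Src E x))" "Tgt ?G h = omap R ?Z"
        and \<epsilon>h: "\<epsilon> ?Z \<cdot>\<^bsub>?F\<^esub> amap L h = ?g"
      by (rule a.transposeE[OF ZO xyO(2) gA]) (simp_all only: Lx fslice_simps(3,4))
    obtain m n where RZ: "omap R ?Z = (m, n)" by (cases "omap R ?Z")
    have RZO: "(m, n) \<in> Obj ?G" "Tgt E n = Tgt E y"
      using a.R.f.omap_Obj[OF ZO] a.R.proj_omap[OF ZO] unfolding RZ by simp_all
    have ph: "amap (proj (fslice E B)) h = y"
      using a.proj_transpose[OF ZO h0(1,3)] by (simp add: \<epsilon>h)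
    obtain hv where h: "h = ((x, Ide E (Src E x)), (m, n), (hv, y))" "hv \<in> Arr E" "Src E hv = Src E x" "Tgt E hv = Src E n"
        "m \<cdot> hv = x" "n \<cdot> hv = y \<cdot> Ide E (Src E x)"
      using h0 ph unfolding RZ by (elim fslice_arrE) simp
    let ?h = "((x, y), (m, n), (hv, Ide E (Tgt E y)))"
    have hA: "?h \<in> Arr ?G" using h RZO by simp
    have hw: "?h \<cdot>\<^bsub>?G\<^esub> ?w x y = h" using h by simp
    have eL: "\<epsilon> ?Z \<cdot>\<^bsub>?F\<^esub> amap L ?h \<in> Arr ?F" "Src ?F (\<epsilon> ?Z \<cdot>\<^bsub>?F\<^esub> amap L ?h) = (s2 x y, p2 x y)"
        "Tgt ?F (\<epsilon> ?Z \<cdot>\<^bsub>?F\<^esub> amap L ?h) = ?Z"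
      using ZO hA RZ by (simp_all add: Lxy del: fslice_simps(1,2))
    have pe: "amap (proj (fslice E I)) (\<epsilon> ?Z \<cdot>\<^bsub>?F\<^esub> amap L ?h) = Ide E (Tgt E y)"
      using a.proj_transpose[OF ZO hA] RZ by simp
    obtain j where j: "\<epsilon> ?Z \<cdot>\<^bsub>?F\<^esub> amap L ?h = ((s2 x y, p2 x y), ?Z, (j, Ide E (Tgt E y)))"
        "j \<in> Arr E" "Src E j = Src E (p2 x y)" "Tgt E j = Src E (y \<cdot> p1 x)" "s1 x \<cdot> j = s2 x y" "(y \<cdot> p1 x) \<cdot> j = Ide E (Tgt E y) \<cdot> p2 x y"
      using eL pe by (elim fslice_arrE) simp
    have "(\<epsilon> ?Z \<cdot>\<^bsub>?F\<^esub> amap L ?h) \<cdot>\<^bsub>?F\<^esub> amap L (?w x y) = \<epsilon> ?Z \<cdot>\<^bsub>?F\<^esub> amap L (?h \<cdot>\<^bsub>?G\<^esub> ?w x y)"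
      using ZO hA RZ w_arr[OF xy] by (simp add: a.L.f.amap_Cmp del: fslice_simps(1,2,6))
    then have jo: "j \<cdot> ov x y = Ide E (Src E (p1 x))"
      unfolding j(1) hw \<epsilon>h wL[OF xy] by simp

    \<comment> \<open>The other composite agrees with the identity after precomposition with \<open>L ?w\<close>; transposing,
      two vertical arrows out of \<open>(x, y)\<close> agree after precomposition with \<open>?w\<close>, whose first component is
      an identity.\<close>
    let ?k = "((s2 x y, p2 x y), (s2 x y, p2 x y), (ov x y \<cdot> j, Ide E (Tgt E y)))"
    let ?W = "(s2 x y, p2 x y)"
    have WO: "?W \<in> Obj ?F" by simp
    have jT: "Tgt E j = Src E (p1 x)" using j by simp
    have "s2 x y \<cdot> (ov x y \<cdot> j) = s2 x y" "p2 x y \<cdot> (ov x y \<cdot> j) = p2 x y"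
      using extend[OF ov(4)[OF xy], of j] extend[OF ov(5)[OF xy], of j] j jT by simp_all
    then have kA: "?k \<in> Arr ?F" using j jT by simp
    obtain t1 where t10: "t1 \<in> Arr ?G" "Src ?G t1 = (x, y)" "Tgt ?G t1 = omap R ?W" "\<epsilon> ?W \<cdot>\<^bsub>?F\<^esub> amap L t1 = ?k"
      by (rule a.transposeE[OF WO xyO(1) kA]) (simp_all only: Lxy fslice_simps(3,4))
    obtain t2 where t20: "t2 \<in> Arr ?G" "Src ?G t2 = (x, y)" "Tgt ?G t2 = omap R ?W" "\<epsilon> ?W \<cdot>\<^bsub>?F\<^esub> amap L t2 = Ide ?F ?W"
      by (rule a.transposeE[OF WO xyO(1), of "Ide ?F ?W"])
        (use WO in \<open>simp_all only: Lxy a.L.G.T.Ide_arr\<close>)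
    have pt: "amap (proj (fslice E B)) t1 = Ide E (Tgt E y)" "amap (proj (fslice E B)) t2 = Ide E (Tgt E y)"
      using a.proj_transpose[OF WO t10(1,3)] a.proj_transpose[OF WO t20(1,3)] by (simp_all add: t10 t20)
    have "t1 \<cdot>\<^bsub>?G\<^esub> ?w x y = t2 \<cdot>\<^bsub>?G\<^esub> ?w x y"
    proof (rule a.transpose_eqI[OF _ WO])
      have 1: "\<epsilon> ?W \<cdot>\<^bsub>?F\<^esub> amap L (t \<cdot>\<^bsub>?G\<^esub> ?w x y) = (\<epsilon> ?W \<cdot>\<^bsub>?F\<^esub> amap L t) \<cdot>\<^bsub>?F\<^esub> amap L (?w x y)"
        if "t \<in> Arr ?G" "Src ?G t = (x, y)" "Tgt ?G t = omap R ?W" for t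
        using WO that w_arr[OF xy] by (simp add: a.L.f.amap_Cmp del: fslice_simps(1,2,6))
      have "?k \<cdot>\<^bsub>?F\<^esub> amap L (?w x y) = Ide ?F ?W \<cdot>\<^bsub>?F\<^esub> amap L (?w x y)"
        unfolding wL[OF xy] using j jT jo by simp
      then show "\<epsilon> ?W \<cdot>\<^bsub>?F\<^esub> amap L (t1 \<cdot>\<^bsub>?G\<^esub> ?w x y) = \<epsilon> ?W \<cdot>\<^bsub>?F\<^esub> amap L (t2 \<cdot>\<^bsub>?G\<^esub> ?w x y)"
        unfolding 1[OF t10(1-3)] 1[OF t20(1-3)] t10(4) t20(4) .
    qed (use t10(1-3) t20(1-3) w_arr[OF xy] in \<open>simp_all del: fslice_simps(1,2)\<close>)
    then have "t1 = t2"
      using t10(1-3) t20(1-3) pt by (elim fslice_arrE) simp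
    then have "?k = Ide ?F ?W" using t10(4) t20(4) by simp
    then have "ov x y \<cdot> j = Ide E (Src E (p2 x y))" by simp
    then show ?thesis using j jT jo by blast
  qed

  define \<theta> where "\<theta> = (\<lambda>(x, y). ((s \<cdot> pl p x, y \<cdot> pr p x), (s2 x y, p2 x y), (ov x y \<cdot> u x, Ide E (Tgt E y))))"
  have \<theta>_arr: "((s \<cdot> pl p x, y \<cdot> pr p x), (s2 x y, p2 x y), (ov x y \<cdot> u x, Ide E (Tgt E y))) \<in> Arr ?F"
    if xy: "x \<in> Arr E" "y \<in> Arr E" "Src E x = Src E y" "Tgt E x = B" for x y
  proof -
    note [simp] = xy sp1[OF xy(1,4)] sp2[OF xy] ov[OF xy] kv[OF xy(1,4)] u[OF xy(1,4)]
    have "s2 x y \<cdot> (ov x y \<cdot> u x) = s \<cdot> pl p x"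
      using extend[OF ov(4)[OF xy], of "u x"] extend[OF kv(4)[OF xy(1,4)], of "u x"] by simp
    moreover have "p2 x y \<cdot> (ov x y \<cdot> u x) = y \<cdot> pr p x"
      using extend[OF ov(5)[OF xy], of "u x"] by simp
    ultimately show ?thesis by simp
  qed
  have "vertical_iso E (fslice E B) (fslice E I) (lower_shriek E s \<odot> upper_star E p) L \<theta>"
    unfolding vertical_iso_def fibered_nat_trans_def nat_trans_def
  proof (intro conjI ballI)
    fix X assume X: "X \<in> Obj ?G"
    then obtain x y where x: "X = (x, y)" and xy: "x \<in> Arr E" "y \<in> Arr E" "Src E x = Src E y" "Tgt E x = B" by (rule fslice_objE)
    show "\<theta> X \<in> Hom ?F (omap (lower_shriek E s \<odot> upper_star E p) X) (omap L X)"
      using \<theta>_arr[OF xy] by (simp add: Hom_iff x \<theta>_def Lxy del: fslice_simps(2))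
    show "amap (proj (fslice E I)) (\<theta> X) = Ide E (omap (proj (fslice E B)) X)" by (simp add: x \<theta>_def)
    note [simp] = xy sp1[OF xy(1,4)] sp2[OF xy] ov[OF xy] u[OF xy(1,4)]
    obtain j where j: "j \<in> Arr E" "Src E j = Src E (p2 x y)" "Tgt E j = Src E (p1 x)" "j \<cdot> ov x y = Ide E (Src E (p1 x))" "ov x y \<cdot> j = Ide E (Src E (p2 x y))"
      using ov_inv[OF xy] by blast
    obtain i where i: "i \<in> Arr E" "Src E i = Src E (p1 x)" "Tgt E i = Src E (pr p x)" "i \<cdot> u x = Ide E (Src E (pr p x))" "u x \<cdot> i = Ide E (Src E (p1 x))"
      using u_inv[OF xy(1,4)] by blast
    show "iso_arr ?F (\<theta> X)" unfolding x \<theta>_def prod.case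
      by (rule iso_arr_fslice[OF \<theta>_arr[OF xy], of "i \<cdot> j"])
        (use i j extend[OF j(4), of "u x"] extend[OF i(5), of j] in simp_all)
  next
    fix t assume "t \<in> Arr ?G"
    then obtain x' y' x y v w where t': "t = ((x', y'), (x, y), (v, w))" and tA: "((x', y'), (x, y), (v, w)) \<in> Arr ?G" and
      xy': "x' \<in> Arr E" "y' \<in> Arr E" "Src E x' = Src E y'" "Tgt E x' = B" and
      xy: "x \<in> Arr E" "y \<in> Arr E" "Src E x = Src E y" "Tgt E x = B" and
      t: "v \<in> Arr E" "Src E v = Src E y'" "Tgt E v = Src E y"
      "w \<in> Arr E" "Src E w = Tgt E y'" "Tgt E w = Tgt E y"
      "x \<cdot> v = x'" "y \<cdot> v = w \<cdot> y'" by (elim fslice_arrE) simp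
    note [simp] = xy(1,2,4) xy'(1,2,4) xy(3) xy'(3) t(1-6) sp1[OF xy(1,4)] sp2[OF xy] ov[OF xy] kv(1-3)[OF xy(1,4)] u[OF xy(1,4)]
      sp1[OF xy'(1,4)] sp2[OF xy'] ov[OF xy'] kv(1-3)[OF xy'(1,4)] u[OF xy'(1,4)]
    let ?t0 = "((x', Ide E (Src E x')), (x, Ide E (Src E x)), (v, v))"
    have t0A: "?t0 \<in> Arr ?G" using t by simp
    define l0 where "l0 = lv ?t0"
    define l where "l = lv ((x', y'), (x, y), (v, w))"
    have t0L: "amap L ?t0 = ((s1 x', p1 x'), (s1 x, p1 x), (l0, v))"
      using L[OF t0A] unfolding Lx l0_def .
    have l0 [simp]: "l0 \<in> Arr E" "Src E l0 = Src E (p1 x')" "Tgt E l0 = Src E (p1 x)" and pl0: "p1 x \<cdot> l0 = v \<cdot> p1 x'"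
      using L_arr[OF t0A] unfolding Lx l0_def[symmetric] by simp_all
    have tL: "amap L ((x', y'), (x, y), (v, w)) = ((s2 x' y', p2 x' y'), (s2 x y, p2 x y), (l, w))"
      using L[OF tA] unfolding Lxy l_def .
    have l [simp]: "l \<in> Arr E" "Src E l = Src E (p2 x' y')" "Tgt E l = Src E (p2 x y)"
      using L_arr[OF tA] unfolding Lxy l_def[symmetric] by simp_all
    have "?w x y \<cdot>\<^bsub>?G\<^esub> ?t0 = t \<cdot>\<^bsub>?G\<^esub> ?w x' y'" using t by (simp add: t')
    from arg_cong[OF this, of "amap L"]
    have "amap L (?w x y) \<cdot>\<^bsub>?F\<^esub> amap L ?t0 = amap L t \<cdot>\<^bsub>?F\<^esub> amap L (?w x' y')"
      using w_arr[OF xy] w_arr[OF xy'] t0A tA unfolding t' by (simp add: a.L.f.amap_Cmp del: fslice_simps(1,2,6))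
    then have ovl: "ov x y \<cdot> l0 = l \<cdot> ov x' y'"
      unfolding wL[OF xy] wL[OF xy'] t0L t' tL by simp
    have "((x, Ide E (Src E x)), ?D, (x, x)) \<cdot>\<^bsub>?G\<^esub> ?t0 = ((x', Ide E (Src E x')), ?D, (x', x'))" using t by simp
    from arg_cong[OF this, of "amap L"]
    have "amap L ((x, Ide E (Src E x)), ?D, (x, x)) \<cdot>\<^bsub>?F\<^esub> amap L ?t0 = amap L ((x', Ide E (Src E x')), ?D, (x', x'))"
      using k_arr[OF xy(1,4)] k_arr[OF xy'(1,4)] t0A by (simp add: a.L.f.amap_Cmp del: fslice_simps(1,2,6))
    then have kvl: "kv x \<cdot> l0 = kv x'"
      unfolding kL[OF xy(1,4)] kL[OF xy'(1,4)] t0L by simp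
    have m [simp]: "pb_map p x' x v \<in> Arr E" "Src E (pb_map p x' x v) = Src E (pr p x')" "Tgt E (pb_map p x' x v) = Src E (pr p x)"
      "pl p x \<cdot> pb_map p x' x v = pl p x'" "pr p x \<cdot> pb_map p x' x v = v \<cdot> pr p x'"
      by (rule pb_map; use t in simp)+
    have ul: "u x \<cdot> pb_map p x' x v = l0 \<cdot> u x'"
    proof (rule pullback_eqI[OF kpb[OF xy(1,4)]])
      show "kv x \<cdot> (u x \<cdot> pb_map p x' x v) = kv x \<cdot> (l0 \<cdot> u x')"
        using extend[OF u(4)[OF xy(1,4)], of "pb_map p x' x v"] extend[OF kvl, of "u x'"] by simp
      show "p1 x \<cdot> (u x \<cdot> pb_map p x' x v) = p1 x \<cdot> (l0 \<cdot> u x')"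
        using extend[OF u(5)[OF xy(1,4)], of "pb_map p x' x v"] extend[OF pl0, of "u x'"] by simp
    qed simp_all
    have "l \<cdot> (ov x' y' \<cdot> u x') = ov x y \<cdot> (u x \<cdot> pb_map p x' x v)"
      using extend[OF ovl, of "u x'"] by (simp add: ul)
    then show "amap L t \<cdot>\<^bsub>?F\<^esub> \<theta> (Src ?G t) = \<theta> (Tgt ?G t) \<cdot>\<^bsub>?F\<^esub> amap (lower_shriek E s \<odot> upper_star E p) t"
      by (simp add: t' tL \<theta>_def)
  qed
  then show ?thesis
    by (intro exI[of _ "Src E p"] exI[of _ s] exI[of _ p] exI[of _ \<theta>]) (simp add: Hom_iff)
qed

end

section \<open>Slices of fibered categories\<close>

lemma (in category) category_slice: "category (slice C x)"
proof
  fix f a b c g assume fh: "f \<in> Hom (slice C x) a b" and gh: "g \<in> Hom (slice C x) b c"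
  from fh obtain u where f: "f = (a, b, u)" "a \<in> Arr C" "Tgt C a = x" "b \<in> Arr C" "Tgt C b = x"
    "u \<in> Arr C" "Src C u = Src C a" "Tgt C u = Src C b" "b \<cdot> u = a" by (rule slice_HomE)
  from gh obtain v where g: "g = (b, c, v)" "b \<in> Arr C" "Tgt C b = x" "c \<in> Arr C" "Tgt C c = x"
    "v \<in> Arr C" "Src C v = Src C b" "Tgt C v = Src C c" "c \<cdot> v = b" by (rule slice_HomE)
  have "c \<cdot> (v \<cdot> u) = a" using extend[OF g(9), of u] f g by simp
  then show "g \<cdot>\<^bsub>slice C x\<^esub> f \<in> Hom (slice C x) a c" using f g by simp
next
  fix f a b c d g h assume fh: "f \<in> Hom (slice C x) a b" and gh: "g \<in> Hom (slice C x) b c" and hh: "h \<in> Hom (slice C x) c d"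
  from fh obtain u where f: "f = (a, b, u)" "a \<in> Arr C" "Tgt C a = x" "b \<in> Arr C" "Tgt C b = x"
    "u \<in> Arr C" "Src C u = Src C a" "Tgt C u = Src C b" "b \<cdot> u = a" by (rule slice_HomE)
  from gh obtain v where g: "g = (b, c, v)" "b \<in> Arr C" "Tgt C b = x" "c \<in> Arr C" "Tgt C c = x"
    "v \<in> Arr C" "Src C v = Src C b" "Tgt C v = Src C c" "c \<cdot> v = b" by (rule slice_HomE)
  from hh obtain w where h: "h = (c, d, w)" "c \<in> Arr C" "Tgt C c = x" "d \<in> Arr C" "Tgt C d = x"
    "w \<in> Arr C" "Src C w = Src C c" "Tgt C w = Src C d" "d \<cdot> w = c" by (rule slice_HomE)
  show "(h \<cdot>\<^bsub>slice C x\<^esub> g) \<cdot>\<^bsub>slice C x\<^esub> f = h \<cdot>\<^bsub>slice C x\<^esub> (g \<cdot>\<^bsub>slice C x\<^esub> f)"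
    using f g h by simp
next
  fix f a b assume fh: "f \<in> Hom (slice C x) a b"
  then obtain u where f: "f = (a, b, u)" "a \<in> Arr C" "Tgt C a = x" "b \<in> Arr C" "Tgt C b = x"
    "u \<in> Arr C" "Src C u = Src C a" "Tgt C u = Src C b" "b \<cdot> u = a" by (rule slice_HomE)
  show "f \<cdot>\<^bsub>slice C x\<^esub> Ide (slice C x) a = f" "Ide (slice C x) b \<cdot>\<^bsub>slice C x\<^esub> f = f" using f by simp_all
next
  fix f assume f0: "f \<in> Arr (slice C x)"
  obtain a b u where f: "f = (a, b, u)" by (cases f)
  show "Src (slice C x) f \<in> Obj (slice C x)" "Tgt (slice C x) f \<in> Obj (slice C x)" using f0 by (simp_all add: f)
qed simp

lemma slice_fib_simps [simp]:
  "total (slice_fib G x) = slice (total G) x"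
  "omap (proj (slice_fib G x)) f = omap (proj G) (Src (total G) f)"
  "amap (proj (slice_fib G x)) (f, g, u) = amap (proj G) u"
  by (simp_all add: slice_fib_def)

context fib_cat
begin

lemma slice_cartesian_if:
  assumes arr: "(f, g, u) \<in> Arr (slice (total F) x)" and c: "cartesian_arr E F u"
  shows "cartesian_arr E (slice_fib F x) (f, g, u)"
  unfolding cartesian_arr_def Let_def slice_fib_simps(1)
proof (intro conjI ballI impI arr)
  fix t w assume t0: "t \<in> Arr (slice (total F) x)"
    and w0: "w \<in> Hom E (omap (proj (slice_fib F x)) (Src (slice (total F) x) t)) (omap (proj (slice_fib F x)) (Src (slice (total F) x) (f, g, u)))"
    and A: "Tgt (slice (total F) x) t = Tgt (slice (total F) x) (f, g, u) \<and>
      amap (proj (slice_fib F x)) (f, g, u) \<cdot>\<^bsub>E\<^esub> w = amap (proj (slice_fib F x)) t"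
  obtain k v where t: "t = (k, g, v)" using A by (cases t) simp
  have k: "k \<in> Arr (total F)" "Tgt (total F) k = x" "v \<in> Arr (total F)" "Src (total F) v = Src (total F) k" "Tgt (total F) v = Src (total F) g" "g \<cdot>\<^bsub>total F\<^esub> v = k"
    using t0 by (simp_all add: t)
  have w: "w \<in> Arr E" "Src E w = omap (proj F) (Src (total F) k)" "Tgt E w = omap (proj F) (Src (total F) f)" "amap (proj F) u \<cdot>\<^bsub>E\<^esub> w = amap (proj F) v"
    using w0 A by (simp_all add: t Hom_iff)
  have f: "f \<in> Arr (total F)" "Tgt (total F) f = x" "g \<in> Arr (total F)" "Tgt (total F) g = x"
      "u \<in> Arr (total F)" "Src (total F) u = Src (total F) f" "Tgt (total F) u = Src (total F) g" "g \<cdot>\<^bsub>total F\<^esub> u = f"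
    using arr by simp_all
  have ex: "\<exists>!h. h \<in> Hom (total F) (Src (total F) v) (Src (total F) u) \<and> u \<cdot>\<^bsub>total F\<^esub> h = v \<and> amap (proj F) h = w"
    by (rule cartesian_arrD[OF c]) (use w k f in simp_all)
  then obtain h where h: "h \<in> Arr (total F)" "Src (total F) h = Src (total F) k" "Tgt (total F) h = Src (total F) f" "u \<cdot>\<^bsub>total F\<^esub> h = v" "amap (proj F) h = w"
    unfolding Hom_iff k(4) f(6) by blast
  have "f \<cdot>\<^bsub>total F\<^esub> h = k" using T.extend[OF f(8), of h] h f k by simp
  show "\<exists>!h. h \<in> Hom (slice (total F) x) (Src (slice (total F) x) t) (Src (slice (total F) x) (f, g, u)) \<and>
      (f, g, u) \<cdot>\<^bsub>slice (total F) x\<^esub> h = t \<and> amap (proj (slice_fib F x)) h = w"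
  proof (rule ex1I[of _ "(k, f, h)"])
    show "(k, f, h) \<in> Hom (slice (total F) x) (Src (slice (total F) x) t) (Src (slice (total F) x) (f, g, u)) \<and>
      (f, g, u) \<cdot>\<^bsub>slice (total F) x\<^esub> (k, f, h) = t \<and> amap (proj (slice_fib F x)) (k, f, h) = w"
      using h k f \<open>f \<cdot>\<^bsub>total F\<^esub> h = k\<close> by (simp add: t)
    fix j assume j0: "j \<in> Hom (slice (total F) x) (Src (slice (total F) x) t) (Src (slice (total F) x) (f, g, u)) \<and>
      (f, g, u) \<cdot>\<^bsub>slice (total F) x\<^esub> j = t \<and> amap (proj (slice_fib F x)) j = w"
    then have "j \<in> Hom (slice (total F) x) k f" by (simp add: t)
    then obtain j' where j: "j = (k, f, j')" "k \<in> Arr (total F)" "Tgt (total F) k = x" "f \<in> Arr (total F)" "Tgt (total F) f = x"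
      "j' \<in> Arr (total F)" "Src (total F) j' = Src (total F) k" "Tgt (total F) j' = Src (total F) f" "f \<cdot>\<^bsub>total F\<^esub> j' = k" by (rule slice_HomE)
    have "j' \<in> Hom (total F) (Src (total F) v) (Src (total F) u) \<and> u \<cdot>\<^bsub>total F\<^esub> j' = v \<and> amap (proj F) j' = w"
      using j0 j f k by (simp add: t Hom_iff)
    moreover have "h \<in> Hom (total F) (Src (total F) v) (Src (total F) u) \<and> u \<cdot>\<^bsub>total F\<^esub> h = v \<and> amap (proj F) h = w"
      using h f k by (simp add: Hom_iff)
    ultimately have "j' = h" using ex by blast
    then show "j = (k, f, h)" using j by simp
  qed
qed

lemma cartesian_if_slice:
  assumes c: "cartesian_arr E (slice_fib F x) (f, g, u)"
  shows "cartesian_arr E F u"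
proof -
  have arr: "(f, g, u) \<in> Arr (slice (total F) x)" using c by (simp add: cartesian_arr_def Let_def)
  then have f: "f \<in> Arr (total F)" "Tgt (total F) f = x" "g \<in> Arr (total F)" "Tgt (total F) g = x"
      "u \<in> Arr (total F)" "Src (total F) u = Src (total F) f" "Tgt (total F) u = Src (total F) g" "g \<cdot>\<^bsub>total F\<^esub> u = f"
    by simp_all
  show ?thesis unfolding cartesian_arr_def Let_def
  proof (intro conjI ballI impI f(5))
    fix k w assume k: "k \<in> Arr (total F)" and w0: "w \<in> Hom E (omap (proj F) (Src (total F) k)) (omap (proj F) (Src (total F) u))"
      and A: "Tgt (total F) k = Tgt (total F) u \<and> amap (proj F) u \<cdot>\<^bsub>E\<^esub> w = amap (proj F) k"
    let ?k = "(g \<cdot>\<^bsub>total F\<^esub> k, g, k)"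
    have ex: "\<exists>!h. h \<in> Hom (slice (total F) x) (g \<cdot>\<^bsub>total F\<^esub> k) f \<and> (f, g, u) \<cdot>\<^bsub>slice (total F) x\<^esub> h = ?k \<and> amap (proj (slice_fib F x)) h = w"
      using cartesian_arrD[OF c, of ?k w] k w0 A f by (simp add: Hom_iff del: slice_Hom)
    then obtain h0 where h0: "h0 \<in> Hom (slice (total F) x) (g \<cdot>\<^bsub>total F\<^esub> k) f" "(f, g, u) \<cdot>\<^bsub>slice (total F) x\<^esub> h0 = ?k \<and> amap (proj (slice_fib F x)) h0 = w"
      by blast
    from h0(1) obtain h where h: "h0 = (g \<cdot>\<^bsub>total F\<^esub> k, f, h)" "g \<cdot>\<^bsub>total F\<^esub> k \<in> Arr (total F)" "Tgt (total F) (g \<cdot>\<^bsub>total F\<^esub> k) = x"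
      "f \<in> Arr (total F)" "Tgt (total F) f = x" "h \<in> Arr (total F)" "Src (total F) h = Src (total F) (g \<cdot>\<^bsub>total F\<^esub> k)" "Tgt (total F) h = Src (total F) f" "f \<cdot>\<^bsub>total F\<^esub> h = g \<cdot>\<^bsub>total F\<^esub> k"
      by (rule slice_HomE)
    show "\<exists>!h. h \<in> Hom (total F) (Src (total F) k) (Src (total F) u) \<and> u \<cdot>\<^bsub>total F\<^esub> h = k \<and> amap (proj F) h = w"
    proof (rule ex1I[of _ h])
      show "h \<in> Hom (total F) (Src (total F) k) (Src (total F) u) \<and> u \<cdot>\<^bsub>total F\<^esub> h = k \<and> amap (proj F) h = w"
        using h h0(2) k f A by (simp add: Hom_iff)
      fix j assume j: "j \<in> Hom (total F) (Src (total F) k) (Src (total F) u) \<and> u \<cdot>\<^bsub>total F\<^esub> j = k \<and> amap (proj F) j = w"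
      have "f \<cdot>\<^bsub>total F\<^esub> j = g \<cdot>\<^bsub>total F\<^esub> k" using T.extend[OF f(8), of j] j f by (simp add: Hom_iff)
      then have "(g \<cdot>\<^bsub>total F\<^esub> k, f, j) \<in> Hom (slice (total F) x) (g \<cdot>\<^bsub>total F\<^esub> k) f \<and>
          (f, g, u) \<cdot>\<^bsub>slice (total F) x\<^esub> (g \<cdot>\<^bsub>total F\<^esub> k, f, j) = ?k \<and> amap (proj (slice_fib F x)) (g \<cdot>\<^bsub>total F\<^esub> k, f, j) = w"
        using j f k A by (simp add: Hom_iff)
      with ex h0 h(1) have "(g \<cdot>\<^bsub>total F\<^esub> k, f, j) = (g \<cdot>\<^bsub>total F\<^esub> k, f, h)" by blast
      then show "j = h" by simp
    qed
  qed
qed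

lemma fibered_slice_fib: "fibered_category E (slice_fib F x)"
  unfolding fibered_category_def slice_fib_simps(1)
proof (intro conjI ballI impI T.category_slice)
  show "category E" by unfold_locales
  show "is_functor (slice (total F) x) E (proj (slice_fib F x))"
    unfolding is_functor_def
  proof (intro conjI ballI impI)
    fix f g assume "f \<in> Arr (slice (total F) x)" "g \<in> Arr (slice (total F) x)" "Src (slice (total F) x) g = Tgt (slice (total F) x) f"
    then show "amap (proj (slice_fib F x)) (g \<cdot>\<^bsub>slice (total F) x\<^esub> f) = amap (proj (slice_fib F x)) g \<cdot>\<^bsub>E\<^esub> amap (proj (slice_fib F x)) f"
      by (cases f; cases g) simp
  next
    fix f assume "f \<in> Arr (slice (total F) x)"
    then show "amap (proj (slice_fib F x)) f \<in> Hom E (omap (proj (slice_fib F x)) (Src (slice (total F) x) f)) (omap (proj (slice_fib F x)) (Tgt (slice (total F) x) f))"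
      by (cases f) (simp add: Hom_iff)
  qed simp_all
  fix f u assume f: "f \<in> Obj (slice (total F) x)" and u: "u \<in> Arr E" "Tgt E u = omap (proj (slice_fib F x)) f"
  have "Src (total F) f \<in> Obj (total F)" "Tgt E u = omap (proj F) (Src (total F) f)" using f u by simp_all
  then obtain c where c: "cartesian_arr E F c" "Tgt (total F) c = Src (total F) f" "amap (proj F) c = u"
    using fib u(1) unfolding fibered_category_def by blast
  have "c \<in> Arr (total F)" using c by (simp add: cartesian_arr_def Let_def)
  then have "cartesian_arr E (slice_fib F x) (f \<cdot>\<^bsub>total F\<^esub> c, f, c)"
    by (intro slice_cartesian_if c) (use f c in simp)
  then show "\<exists>d. cartesian_arr E (slice_fib F x) d \<and> Tgt (slice (total F) x) d = f \<and> amap (proj (slice_fib F x)) d = u"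
    by (rule exI[of _ "(f \<cdot>\<^bsub>total F\<^esub> c, f, c)", OF conjI]) (simp add: c)
qed

end

lemma term_arr:
  assumes "terminal C t" "x \<in> Obj C"
  shows "term_arr C t x \<in> Hom C x t"
  unfolding term_arr_def by (rule theI') (use assms in \<open>simp add: terminal_def\<close>)

lemma terminal_eq:
  assumes "terminal C t" "f \<in> Hom C x t" "g \<in> Hom C x t" "x \<in> Obj C"
  shows "f = g"
proof -
  have "\<exists>!f. f \<in> Hom C x t" using assms(1,4) by (simp add: terminal_def)
  with assms(2,3) show ?thesis by (elim ex1E) blast
qed

lemma fibered_slice_lift:
  assumes R: "fibered_functor E F G R" and t: "terminal (total F) t"
  shows "fibered_functor E F (slice_fib G (omap R t)) (slice_lift F t R)"
proof -
  interpret R: fib_functor E F G R using R by (rule fib_functorI)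
  have a [simp]: "term_arr (total F) t x \<in> Arr (total F)" "Src (total F) (term_arr (total F) t x) = x" "Tgt (total F) (term_arr (total F) t x) = t"
    if "x \<in> Obj (total F)" for x using term_arr[OF t that] by (simp_all add: Hom_iff)
  have o: "omap (slice_lift F t R) x = amap R (term_arr (total F) t x)"
    "amap (slice_lift F t R) f = (amap R (term_arr (total F) t (Src (total F) f)), amap R (term_arr (total F) t (Tgt (total F) f)), amap R f)" for x f
    by (simp_all add: slice_lift_def Let_def)
  have c: "amap R (term_arr (total F) t (Tgt (total F) f)) \<cdot>\<^bsub>total G\<^esub> amap R f = amap R (term_arr (total F) t (Src (total F) f))"
    if f: "f \<in> Arr (total F)" for f
  proof -
    have "term_arr (total F) t (Tgt (total F) f) \<cdot>\<^bsub>total F\<^esub> f = term_arr (total F) t (Src (total F) f)"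
      by (rule terminal_eq[OF t, where x = "Src (total F) f"]) (use f in \<open>simp_all add: Hom_iff\<close>)
    then show ?thesis using f by (simp flip: R.f.amap_Cmp)
  qed
  have arr: "amap (slice_lift F t R) f \<in> Arr (slice (total G) (omap R t))" if "f \<in> Arr (total F)" for f
    using that c[OF that] by (simp add: o)
  show ?thesis unfolding fibered_functor_def is_functor_def slice_fib_simps(1)
  proof (intro conjI ballI allI impI R.F.fib R.G.fibered_slice_fib)
    fix f assume f: "f \<in> Arr (total F)"
    show "amap (slice_lift F t R) f \<in> Hom (slice (total G) (omap R t)) (omap (slice_lift F t R) (Src (total F) f)) (omap (slice_lift F t R) (Tgt (total F) f))"
      using arr[OF f] by (simp add: Hom_iff o)
  next
    fix f assume cf: "cartesian_arr E F f"
    then have "f \<in> Arr (total F)" by (simp add: cartesian_arr_def Let_def)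
    then show "cartesian_arr E (slice_fib G (omap R t)) (amap (slice_lift F t R) f)"
      using arr unfolding o by (intro R.G.slice_cartesian_if R.cartesian cf) simp_all
  qed (simp_all add: o)
qed

text \<open>Stated as an adjunction so that a strict isomorphism over the base can be composed with other
  adjunctions.\<close>

lemma strict_inverse_adj:
  assumes L: "fibered_functor E G F L" and R: "fibered_functor E F G R"
    and LRo: "\<And>x. x \<in> Obj (total F) \<Longrightarrow> omap L (omap R x) = x"
    and LRa: "\<And>f. f \<in> Arr (total F) \<Longrightarrow> amap L (amap R f) = f"
    and RLo: "\<And>y. y \<in> Obj (total G) \<Longrightarrow> omap R (omap L y) = y"
    and RLa: "\<And>g. g \<in> Arr (total G) \<Longrightarrow> amap R (amap L g) = g"
  shows "counit_adj E G F L R (Ide (total F))"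
proof -
  interpret L: fib_functor E G F L using L by (rule fib_functorI)
  interpret R: fib_functor E F G R using R by (rule fib_functorI)
  show ?thesis unfolding counit_adj_def fibered_nat_trans_def nat_trans_def
  proof (intro conjI ballI L R)
    fix x y g assume x: "x \<in> Obj (total F)" and y: "y \<in> Obj (total G)" and g0: "g \<in> Hom (total F) (omap L y) x"
    then have g: "g \<in> Arr (total F)" "Src (total F) g = omap L y" "Tgt (total F) g = x" by (simp_all add: Hom_iff)
    show "\<exists>!h. h \<in> Hom (total G) y (omap R x) \<and> Ide (total F) x \<cdot>\<^bsub>total F\<^esub> amap L h = g"
    proof (rule ex1I[of _ "amap R g"])
      show "amap R g \<in> Hom (total G) y (omap R x) \<and> Ide (total F) x \<cdot>\<^bsub>total F\<^esub> amap L (amap R g) = g"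
        using x y g by (simp add: Hom_iff LRa RLo)
      fix h assume h: "h \<in> Hom (total G) y (omap R x) \<and> Ide (total F) x \<cdot>\<^bsub>total F\<^esub> amap L h = g"
      then have h': "h \<in> Arr (total G)" "Src (total G) h = y" "Tgt (total G) h = omap R x" by (simp_all add: Hom_iff)
      have "Ide (total F) x \<cdot>\<^bsub>total F\<^esub> amap L h = amap L h" using x h' by (simp add: LRo)
      then have "amap L h = g" using h by simp
      then show "h = amap R g" using RLa[OF h'(1)] by simp
    qed
  qed (simp_all add: Hom_iff LRo LRa)
qed

lemma (in cat_functor) iso_arr_amap: "iso_arr A f \<Longrightarrow> iso_arr B (amap F f)"
  unfolding iso_arr_def
proof (elim conjE bexE, intro conjI)
  fix g assume f: "f \<in> Arr A" and "g \<in> Hom A (Tgt A f) (Src A f)" and gf: "g \<cdot>\<^bsub>A\<^esub> f = Ide A (Src A f)" "f \<cdot>\<^bsub>A\<^esub> g = Ide A (Tgt A f)"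
  then have g: "g \<in> Arr A" "Src A g = Tgt A f" "Tgt A g = Src A f" by (simp_all add: Hom_iff)
  show "amap F f \<in> Arr B" using f by simp
  show "\<exists>g\<in>Hom B (Tgt B (amap F f)) (Src B (amap F f)). g \<cdot>\<^bsub>B\<^esub> amap F f = Ide B (Src B (amap F f)) \<and> amap F f \<cdot>\<^bsub>B\<^esub> g = Ide B (Tgt B (amap F f))"
    by (rule bexI[of _ "amap F g"]) (use f g gf in \<open>simp_all add: Hom_iff flip: amap_Cmp\<close>)
qed

lemma (in category) iso_arr_slice:
  assumes "(f, g, u) \<in> Arr (slice C x)" "iso_arr C u"
  shows "iso_arr (slice C x) (f, g, u)"
proof -
  obtain j where j: "j \<in> Arr C" "Src C j = Tgt C u" "Tgt C j = Src C u" "j \<cdot> u = Ide C (Src C u)" "u \<cdot> j = Ide C (Tgt C u)"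
    using assms(2) unfolding iso_arr_def Bex_def Hom_iff by blast
  have "f \<cdot> j = g" using extend[of g u f j] assms j by simp
  then show ?thesis unfolding iso_arr_def
    by (intro conjI bexI[of _ "(g, f, j)"]) (use assms j in \<open>simp_all\<close>)
qed

section \<open>A slice of a fibered slice is a fibered slice\<close>

text \<open>An arrow from a span \<open>(a, q)\<close> to the span \<open>J \<leftarrow> B' \<rightarrow> 1\<close> with legs \<open>t'\<close> and \<open>k'\<close> amounts to a map \<open>v\<close> with
  \<open>t' \<cdot> v = a\<close>, since its component into the terminal object is forced. Hence
  the slice of \<open>E|J\<close> over this span is isomorphic to \<open>E|B'\<close> by sending the arrow to \<open>(v, q)\<close>, and the domain projection
  becomes \<open>t'\<^sub>!\<close>. The isomorphism \<open>e : B' \<cong> B\<close> replaces \<open>t'\<close> by an arrow \<open>t : B \<rightarrow> J\<close>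
  that is isomorphic to it over \<open>J\<close>: the value of a polynomial functor at the terminal object is the
  span with legs \<open>t\<close> and \<open>B \<rightarrow> 1\<close> only up to isomorphism.\<close>

locale span_slice = lccc E one for E :: "('o, 'm) cat" (structure) and one +
  fixes J B t' k' t e e'
  assumes t' [simp]: "t' \<in> Arr E" "Src E t' = Src E k'" "Tgt E t' = J"
    and k' [simp]: "k' \<in> Arr E" "Tgt E k' = one"
    and t [simp]: "t \<in> Arr E" "Src E t = B" "Tgt E t = J"
    and e [simp]: "e \<in> Arr E" "Src E e = Src E k'" "Tgt E e = B" "t \<cdot> e = t'"
    and e' [simp]: "e' \<in> Arr E" "Src E e' = B" "Tgt E e' = Src E k'"
    and ee' [simp]: "e \<cdot> e' = Ide E B" "e' \<cdot> e = Ide E (Src E k')"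
begin

abbreviation "S \<equiv> slice_fib (fslice E J) (t', k')"

definition \<Phi> :: "('m span_arr, 'm span_arr \<times> 'm span_arr \<times> 'm span_arr, 'm span, 'm span_arr) fun_data" where
  "\<Phi> = (let r = (\<lambda>(X, Y, (v, w)). (e \<cdot> v, snd X)) in
     \<lparr>omap = r, amap = (\<lambda>(f, g, (X, Y, vw)). (r f, r g, vw))\<rparr>)"

definition \<Psi> :: "('m span, 'm span_arr, 'm span_arr, 'm span_arr \<times> 'm span_arr \<times> 'm span_arr) fun_data" where
  "\<Psi> = (let r = (\<lambda>(v, q). (omap (lower_shriek E t) (v, q), (t', k'), (e' \<cdot> v, term_arr E one (Tgt E q)))) in
     \<lparr>omap = r, amap = (\<lambda>(X, Y, vw). (r X, r Y, amap (lower_shriek E t) (X, Y, vw)))\<rparr>)"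

lemma \<Phi>_simps [simp]:
  "omap \<Phi> ((a, q), Y, (v, w)) = (e \<cdot> v, q)"
  "amap \<Phi> (f, g, (X, Y, vw)) = (omap \<Phi> f, omap \<Phi> g, vw)"
  by (simp_all add: \<Phi>_def Let_def)

lemma \<Psi>_simps [simp]:
  "omap \<Psi> (v, q) = ((t \<cdot> v, q), (t', k'), (e' \<cdot> v, term_arr E one (Tgt E q)))"
  "amap \<Psi> (X, Y, vw) = (omap \<Psi> X, omap \<Psi> Y, amap (lower_shriek E t) (X, Y, vw))"
  by (simp_all add: \<Psi>_def Let_def)

lemma one_arr [simp]:
  assumes "x \<in> Obj E"
  shows "term_arr E one x \<in> Arr E" "Src E (term_arr E one x) = x" "Tgt E (term_arr E one x) = one"
  using term_arr[OF one assms] by (simp_all add: Hom_iff)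

lemma S_objE:
  assumes "f \<in> Obj (total S)"
  obtains a q v w where "f = ((a, q), (t', k'), (v, w))" "a \<in> Arr E" "q \<in> Arr E" "Src E a = Src E q" "Tgt E a = J"
    "v \<in> Arr E" "Src E v = Src E q" "Tgt E v = Src E k'" "w = term_arr E one (Tgt E q)" "t' \<cdot> v = a" "t \<cdot> (e \<cdot> v) = a"
proof -
  have f: "f \<in> Arr (Sp J)" "Tgt (Sp J) f = (t', k')" using assms by simp_all
  from f(1) obtain a q p q' v w where *: "f = ((a, q), (p, q'), (v, w))"
    "a \<in> Arr E" "q \<in> Arr E" "Src E a = Src E q" "Tgt E a = J"
    "p \<in> Arr E" "q' \<in> Arr E" "Src E p = Src E q'" "Tgt E p = J"
    "v \<in> Arr E" "Src E v = Src E q" "Tgt E v = Src E q'"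
    "w \<in> Arr E" "Src E w = Tgt E q" "Tgt E w = Tgt E q'"
    "p \<cdot> v = a" "q' \<cdot> v = w \<cdot> q" by (rule fslice_arrE)
  from f(2) have pq: "p = t'" "q' = k'" by (simp_all add: *(1))
  have "w = term_arr E one (Tgt E q)" by (rule term_eq) (use * pq in simp_all)
  moreover have "t \<cdot> (e \<cdot> v) = a" using extend[OF e(4), of v] * pq by simp
  ultimately show ?thesis using * pq by (intro that[of a q v w]) simp_all
qed

lemma S_arrE:
  assumes "u \<in> Arr (total S)"
  obtains f g X Y vw where "u = (f, g, (X, Y, vw))" "f \<in> Obj (total S)" "g \<in> Obj (total S)"
    "(X, Y, vw) \<in> Arr (Sp J)" "Src (Sp J) f = X" "Src (Sp J) g = Y"
    "g \<cdot>\<^bsub>Sp J\<^esub> (X, Y, vw) = f"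
proof -
  obtain f g X Y vw where u: "u = (f, g, (X, Y, vw))" by (metis surj_pair)
  have "f \<in> Obj (total S) \<and> g \<in> Obj (total S) \<and> (X, Y, vw) \<in> Arr (Sp J) \<and>
      Src (Sp J) f = X \<and> Src (Sp J) g = Y \<and> g \<cdot>\<^bsub>Sp J\<^esub> (X, Y, vw) = f"
    using assms unfolding u slice_fib_simps(1) slice_simps fslice_simps(3,4) mem_Collect_eq by (elim conjE) (intro conjI, simp_all only:)
  then show ?thesis by (elim conjE) (rule that[OF u])
qed

lemma shriek_\<Phi>_omap: "f \<in> Obj (total S) \<Longrightarrow> omap (lower_shriek E t) (omap \<Phi> f) = Src (Sp J) f"
  by (erule S_objE) simp

lemma shriek_\<Phi>_amap:
  assumes "(f, g, u) \<in> Arr (total S)"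
  shows "amap (lower_shriek E t) (amap \<Phi> (f, g, u)) = u"
proof -
  from assms obtain X Y vw where u: "u = (X, Y, vw)" and f: "f \<in> Obj (total S)" "Src (Sp J) f = X"
      and g: "g \<in> Obj (total S)" "Src (Sp J) g = Y" by (elim S_arrE) simp
  from f(1) obtain a q v w where f': "f = ((a, q), (t', k'), (v, w))" "t \<cdot> (e \<cdot> v) = a" by (rule S_objE)
  from g(1) obtain a2 q2 v2 w2 where g': "g = ((a2, q2), (t', k'), (v2, w2))" "t \<cdot> (e \<cdot> v2) = a2" by (rule S_objE)
  have X: "X = (a, q)" "Y = (a2, q2)" using f(2) g(2) by (simp_all add: f'(1) g'(1))
  show ?thesis unfolding u f'(1) g'(1) X by (simp add: f'(2) g'(2))
qed

lemma fibered_\<Phi>: "fibered_functor E S (fslice E B) \<Phi>"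
proof -
  interpret F: fib_cat E "fslice E J" by unfold_locales (rule fibered_fslice)
  have arr: "amap \<Phi> u \<in> Arr (Sp B)" and src: "Src (Sp B) (amap \<Phi> u) = omap \<Phi> (Src (total S) u)"
      and tgt: "Tgt (Sp B) (amap \<Phi> u) = omap \<Phi> (Tgt (total S) u)" 
      if u: "u \<in> Arr (total S)" for u
  proof -
    from u obtain f g X Y vw where u': "u = (f, g, (X, Y, vw))" and f0: "f \<in> Obj (total S)" and g0: "g \<in> Obj (total S)"
      and XY: "(X, Y, vw) \<in> Arr (Sp J)" "Src (Sp J) f = X" "Src (Sp J) g = Y"
      and c: "g \<cdot>\<^bsub>Sp J\<^esub> (X, Y, vw) = f" by (rule S_arrE)
    from f0 obtain a q v w where f: "f = ((a, q), (t', k'), (v, w))" "a \<in> Arr E" "q \<in> Arr E" "Src E a = Src E q" "Tgt E a = J"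
      "v \<in> Arr E" "Src E v = Src E q" "Tgt E v = Src E k'" "w = term_arr E one (Tgt E q)" "t' \<cdot> v = a" "t \<cdot> (e \<cdot> v) = a" by (rule S_objE)
    from g0 obtain a2 q2 v2 w2 where g: "g = ((a2, q2), (t', k'), (v2, w2))" "a2 \<in> Arr E" "q2 \<in> Arr E" "Src E a2 = Src E q2" "Tgt E a2 = J"
      "v2 \<in> Arr E" "Src E v2 = Src E q2" "Tgt E v2 = Src E k'" "w2 = term_arr E one (Tgt E q2)" "t' \<cdot> v2 = a2" "t \<cdot> (e \<cdot> v2) = a2" by (rule S_objE)
    obtain v3 w3 where vw: "vw = (v3, w3)" by (cases vw)
    have X: "X = (a, q)" "Y = (a2, q2)" using XY f g by simp_all
    have 3: "v3 \<in> Arr E" "Src E v3 = Src E q" "Tgt E v3 = Src E q2" "w3 \<in> Arr E" "Src E w3 = Tgt E q" "Tgt E w3 = Tgt E q2" "q2 \<cdot> v3 = w3 \<cdot> q"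
      using XY(1) unfolding X vw by simp_all
    have "v2 \<cdot> v3 = v" using c unfolding X vw f(1) g(1) by simp
    then have "e \<cdot> (v2 \<cdot> v3) = e \<cdot> v" by simp
    then show "amap \<Phi> u \<in> Arr (Sp B)" unfolding u' f(1) g(1) vw X using f(2-) g(2-) 3 by simp
    show "Src (Sp B) (amap \<Phi> u) = omap \<Phi> (Src (total S) u)" "Tgt (Sp B) (amap \<Phi> u) = omap \<Phi> (Tgt (total S) u)"
      unfolding u' by simp_all
  qed
  show ?thesis unfolding fibered_functor_def is_functor_def
  proof (intro conjI ballI allI impI fibered_fslice F.fibered_slice_fib)
    fix f assume "f \<in> Obj (total S)"
    then obtain a q v w where f: "f = ((a, q), (t', k'), (v, w))" "a \<in> Arr E" "q \<in> Arr E" "Src E a = Src E q" "Tgt E a = J"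
      "v \<in> Arr E" "Src E v = Src E q" "Tgt E v = Src E k'" "w = term_arr E one (Tgt E q)" "t' \<cdot> v = a" "t \<cdot> (e \<cdot> v) = a" by (rule S_objE)
    show "omap \<Phi> f \<in> Obj (Sp B)" "omap (proj (fslice E B)) (omap \<Phi> f) = omap (proj S) f" 
      "amap \<Phi> (Ide (total S) f) = Ide (Sp B) (omap \<Phi> f)" using f by simp_all
  next
    fix u assume u: "u \<in> Arr (total S)"
    show "amap \<Phi> u \<in> Hom (Sp B) (omap \<Phi> (Src (total S) u)) (omap \<Phi> (Tgt (total S) u))"
      using arr[OF u] src[OF u] tgt[OF u] by (simp add: Hom_iff)
    from u obtain f g X Y vw where u': "u = (f, g, (X, Y, vw))" by (rule S_arrE)
    show "amap (proj (fslice E B)) (amap \<Phi> u) = amap (proj S) u" by (cases vw) (simp add: u')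
    fix z assume z: "z \<in> Arr (total S)" "Src (total S) z = Tgt (total S) u"
    from z(1) obtain f' g' X' Y' vw' where z': "z = (f', g', (X', Y', vw'))" by (rule S_arrE)
    have "f' = g" using z(2) by (simp add: u' z')
    then show "amap \<Phi> (z \<cdot>\<^bsub>total S\<^esub> u) = amap \<Phi> z \<cdot>\<^bsub>Sp B\<^esub> amap \<Phi> u"
      by (cases vw; cases vw') (simp add: u' z')
  next
    fix u assume c: "cartesian_arr E S u"
    then have u: "u \<in> Arr (total S)" by (simp add: cartesian_arr_def Let_def)
    from u obtain f g X Y vw where u': "u = (f, g, (X, Y, vw))" and f0: "f \<in> Obj (total S)" and g0: "g \<in> Obj (total S)"
      and XY: "(X, Y, vw) \<in> Arr (Sp J)" "Src (Sp J) f = X" "Src (Sp J) g = Y"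
      and c': "g \<cdot>\<^bsub>Sp J\<^esub> (X, Y, vw) = f" by (rule S_arrE)
    from f0 obtain a q v w where f: "f = ((a, q), (t', k'), (v, w))" by (rule S_objE)
    from g0 obtain a2 q2 v2 w2 where g: "g = ((a2, q2), (t', k'), (v2, w2))" by (rule S_objE)
    obtain v3 w3 where vw: "vw = (v3, w3)" by (cases vw)
    have X: "X = (a, q)" "Y = (a2, q2)" using XY f g by simp_all
    have "cartesian_arr E (fslice E J) ((a, q), (a2, q2), (v3, w3))"
      using F.cartesian_if_slice[OF c[unfolded u']] unfolding X vw .
    then have "is_pullback E q2 w3 v3 q" by (rule pullback_if_cartesian)
    then show "cartesian_arr E (fslice E B) (amap \<Phi> u)"
      using arr[OF u] unfolding u' f g vw X \<Phi>_simps by (intro cartesian_if_pullback)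
  qed
qed

lemma fibered_\<Psi>: "fibered_functor E (fslice E B) S \<Psi>"
proof -
  interpret F: fib_cat E "fslice E J" by unfold_locales (rule fibered_fslice)
  interpret sh: fib_functor E "fslice E B" "fslice E J" "lower_shriek E t"
    using fibered_lower_shriek[OF t(1)] by unfold_locales simp
  have obj: "omap \<Psi> X \<in> Obj (total S)" "Src (Sp J) (omap \<Psi> X) = omap (lower_shriek E t) X"
    if X: "X \<in> Obj (Sp B)" for X
  proof -
    from X obtain v q where x: "X = (v, q)" "v \<in> Arr E" "q \<in> Arr E" "Src E v = Src E q" "Tgt E v = B" by (rule fslice_objE)
    have "t' \<cdot> (e' \<cdot> v) = t \<cdot> v" using extend[of t e t' "e' \<cdot> v"] extend[OF ee'(1), of v] x by simp
    moreover have "k' \<cdot> (e' \<cdot> v) = term_arr E one (Tgt E q) \<cdot> q" by (rule term_eq) (use x in simp_all)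
    ultimately show "omap \<Psi> X \<in> Obj (total S)" "Src (Sp J) (omap \<Psi> X) = omap (lower_shriek E t) X"
      using x by simp_all
  qed
  have arr: "amap \<Psi> u \<in> Arr (total S)" if u: "u \<in> Arr (Sp B)" for u
  proof -
    from u obtain p' q' p q v w where u': "u = ((p', q'), (p, q), (v, w))" and
      pq': "p' \<in> Arr E" "q' \<in> Arr E" "Src E p' = Src E q'" "Tgt E p' = B" and
      pq: "p \<in> Arr E" "q \<in> Arr E" "Src E p = Src E q" "Tgt E p = B" and
      vw: "v \<in> Arr E" "Src E v = Src E q'" "Tgt E v = Src E q"
      "w \<in> Arr E" "Src E w = Tgt E q'" "Tgt E w = Tgt E q"
      "p \<cdot> v = p'" "q \<cdot> v = w \<cdot> q'" by (rule fslice_arrE)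
    have o: "omap \<Psi> (p', q') \<in> Obj (total S)" "omap \<Psi> (p, q) \<in> Obj (total S)" by (rule obj; use pq pq' in simp)+
    have s: "amap (lower_shriek E t) ((p', q'), (p, q), (v, w)) \<in> Arr (Sp J)"
      by (rule sh.f.amap_Arr) (use u u' in blast)
    have "(e' \<cdot> p) \<cdot> v = e' \<cdot> p'" using pq pq' vw by simp
    moreover have "term_arr E one (Tgt E q) \<cdot> w = term_arr E one (Tgt E q')" by (rule term_eq) (use pq pq' vw in simp_all)
    ultimately have "omap \<Psi> (p, q) \<cdot>\<^bsub>Sp J\<^esub> amap (lower_shriek E t) ((p', q'), (p, q), (v, w)) = omap \<Psi> (p', q')"
      using pq by simp
    then show ?thesis using o s unfolding u' \<Psi>_simps(2) by simp
  qed
  show ?thesis unfolding fibered_functor_def is_functor_def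
  proof (intro conjI ballI allI impI fibered_fslice F.fibered_slice_fib obj(1))
    fix X assume X: "X \<in> Obj (Sp B)"
    show "omap (proj S) (omap \<Psi> X) = omap (proj (fslice E B)) X" using obj(2)[OF X] sh.proj_omap[OF X] by simp
    from X obtain v q where x: "X = (v, q)" "v \<in> Arr E" "q \<in> Arr E" "Src E v = Src E q" "Tgt E v = B" by (rule fslice_objE)
    show "amap \<Psi> (Ide (Sp B) X) = Ide (total S) (omap \<Psi> X)" using x by simp
  next
    fix u assume u: "u \<in> Arr (Sp B)"
    from u obtain X Y vw where u': "u = (X, Y, vw)" by (elim fslice_arrE) simp
    show "amap \<Psi> u \<in> Hom (total S) (omap \<Psi> (Src (Sp B) u)) (omap \<Psi> (Tgt (Sp B) u))"
      using arr[OF u] unfolding u' by (simp add: Hom_iff)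
    show "amap (proj S) (amap \<Psi> u) = amap (proj (fslice E B)) u"
      using sh.proj_amap[OF u] by (simp add: u')
    fix z assume z: "z \<in> Arr (Sp B)" "Src (Sp B) z = Tgt (Sp B) u"
    from z(1) obtain X' Y' vw' where z': "z = (X', Y', vw')" by (elim fslice_arrE) simp
    have "X' = Y" using z(2) by (simp add: u' z')
    then show "amap \<Psi> (z \<cdot>\<^bsub>Sp B\<^esub> u) = amap \<Psi> z \<cdot>\<^bsub>total S\<^esub> amap \<Psi> u"
      using sh.f.amap_Cmp[OF u z] by (cases vw; cases vw') (simp add: u' z')
  next
    fix u assume c: "cartesian_arr E (fslice E B) u"
    then have u: "u \<in> Arr (Sp B)" by (simp add: cartesian_arr_def Let_def)
    then obtain X Y vw where u': "u = (X, Y, vw)" by (elim fslice_arrE) simp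
    show "cartesian_arr E S (amap \<Psi> u)"
      using arr[OF u] sh.cartesian[OF c] unfolding u' \<Psi>_simps(2) by (intro F.slice_cartesian_if) simp_all
  qed
qed

lemma \<Psi>\<Phi>_omap: "f \<in> Obj (total S) \<Longrightarrow> omap \<Psi> (omap \<Phi> f) = f"
proof (erule S_objE)
  fix a q v w assume f: "f = ((a, q), (t', k'), (v, w))" "a \<in> Arr E" "q \<in> Arr E" "Src E a = Src E q" "Tgt E a = J"
    "v \<in> Arr E" "Src E v = Src E q" "Tgt E v = Src E k'" "w = term_arr E one (Tgt E q)" "t' \<cdot> v = a" "t \<cdot> (e \<cdot> v) = a"
  have "e' \<cdot> (e \<cdot> v) = v" using extend[OF ee'(2), of v] f by simp
  then show ?thesis using f by simp
qed

lemma \<Phi>\<Psi>_omap: "X \<in> Obj (Sp B) \<Longrightarrow> omap \<Phi> (omap \<Psi> X) = X"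
proof (erule fslice_objE)
  fix p q assume X: "X = (p, q)" "p \<in> Arr E" "q \<in> Arr E" "Src E p = Src E q" "Tgt E p = B"
  have "e \<cdot> (e' \<cdot> p) = p" using extend[OF ee'(1), of p] X by simp
  then show ?thesis using X by simp
qed

lemma \<Psi>\<Phi>_amap: 
  assumes u: "u \<in> Arr (total S)" shows "amap \<Psi> (amap \<Phi> u) = u"
proof -
  from u obtain f g X Y vw where u': "u = (f, g, (X, Y, vw))" and f0: "f \<in> Obj (total S)" and g0: "g \<in> Obj (total S)" by (rule S_arrE)
  show ?thesis using shriek_\<Phi>_amap[OF u[unfolded u']] by (simp add: u' \<Psi>\<Phi>_omap[OF f0] \<Psi>\<Phi>_omap[OF g0])
qed

lemma \<Phi>\<Psi>_amap:
  assumes u: "u \<in> Arr (Sp B)" shows "amap \<Phi> (amap \<Psi> u) = u"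
proof -
  from u obtain p' q' p q v w where u': "u = ((p', q'), (p, q), (v, w))" and o: "(p', q') \<in> Obj (Sp B)" "(p, q) \<in> Obj (Sp B)"
    by (elim fslice_arrE) simp
  show ?thesis using \<Phi>\<Psi>_omap[OF o(1)] \<Phi>\<Psi>_omap[OF o(2)] by (simp add: u' del: \<Psi>_simps(1) \<Phi>_simps(1))
qed

lemma \<Phi>\<Psi>_adj: "counit_adj E S (fslice E B) \<Phi> \<Psi> (Ide (Sp B))"
  by (intro strict_inverse_adj fibered_\<Phi> fibered_\<Psi> \<Psi>\<Phi>_omap \<Phi>\<Psi>_omap \<Psi>\<Phi>_amap \<Phi>\<Psi>_amap)

lemma \<Psi>\<Phi>_adj: "counit_adj E (fslice E B) S \<Psi> \<Phi> (Ide (total S))"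
  by (intro strict_inverse_adj fibered_\<Phi> fibered_\<Psi> \<Psi>\<Phi>_omap \<Phi>\<Psi>_omap \<Psi>\<Phi>_amap \<Phi>\<Psi>_amap)

end

section \<open>Polynomial functors are the local fibered right adjoints\<close>

lemma (in adj) terminal_right:
  assumes t: "terminal (total F) x"
  shows "terminal (total G) (omap R x)"
proof -
  have x: "x \<in> Obj (total F)" using t by (simp add: terminal_def)
  show ?thesis unfolding terminal_def
  proof (intro conjI ballI)
    fix y assume y: "y \<in> Obj (total G)"
    have h: "term_arr (total F) x (omap L y) \<in> Hom (total F) (omap L y) x"
      by (rule term_arr[OF t]) (use y in simp)
    obtain k where k: "k \<in> Arr (total G)" "Src (total G) k = y" "Tgt (total G) k = omap R x"
      by (rule transposeE[OF x y, of "term_arr (total F) x (omap L y)"]) (use h in \<open>simp_all add: Hom_iff\<close>)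
    show "\<exists>!f. f \<in> Hom (total G) y (omap R x)"
    proof (rule ex1I[of _ k])
      show "k \<in> Hom (total G) y (omap R x)" using k by (simp add: Hom_iff)
      fix f assume f: "f \<in> Hom (total G) y (omap R x)"
      show "f = k"
      proof (rule transpose_eqI[OF _ x])
        show "\<epsilon> x \<cdot>\<^bsub>total F\<^esub> amap L f = \<epsilon> x \<cdot>\<^bsub>total F\<^esub> amap L k"
          by (rule terminal_eq[OF t, where x = "omap L y"]) (use f k x y in \<open>simp_all add: Hom_iff\<close>)
      qed (use f k in \<open>simp_all add: Hom_iff\<close>)
    qed
  qed (use x in simp)
qed

context lccc
begin

lemma terminal_fslice:
  assumes I: "I \<in> Obj E"
  shows "terminal (Sp I) (fslice_one E one I)"
proof -
  have o: "term_arr E one x \<in> Arr E" "Src E (term_arr E one x) = x" "Tgt E (term_arr E one x) = one" if "x \<in> Obj E" for x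
    using term_arr[OF one that] by (simp_all add: Hom_iff)
  show ?thesis unfolding terminal_def fslice_one_def
  proof (intro conjI ballI)
    fix X assume "X \<in> Obj (Sp I)"
    then obtain p q where X: "X = (p, q)" "p \<in> Arr E" "q \<in> Arr E" "Src E p = Src E q" "Tgt E p = I" by (rule fslice_objE)
    let ?t = "term_arr E one"
    have sq: "?t I \<cdot> p = ?t (Tgt E q) \<cdot> q" by (rule term_eq) (use X I o in simp_all)
    show "\<exists>!f. f \<in> Hom (Sp I) X (Ide E I, ?t I)"
    proof (rule ex1I[of _ "((p, q), (Ide E I, ?t I), (p, ?t (Tgt E q)))"])
      show "((p, q), (Ide E I, ?t I), (p, ?t (Tgt E q))) \<in> Hom (Sp I) X (Ide E I, ?t I)"
        using X I o sq by (simp add: Hom_iff)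
      fix f assume "f \<in> Hom (Sp I) X (Ide E I, ?t I)"
      then have "f \<in> Arr (Sp I)" "Src (Sp I) f = (p, q)" "Tgt (Sp I) f = (Ide E I, ?t I)"
        by (simp_all add: Hom_iff X(1))
      then obtain v w where f: "f = ((p, q), (Ide E I, ?t I), (v, w))" and v: "v \<in> Arr E" "Tgt E v = I" "Ide E I \<cdot> v = p"
        and w: "w \<in> Arr E" "Src E w = Tgt E q" "Tgt E w = one"
        using I o by (elim fslice_arrE) simp
      have "v = p" using v by simp
      moreover have "w = ?t (Tgt E q)" by (rule term_eq) (use w o X in simp_all)
      ultimately show "f = ((p, q), (Ide E I, ?t I), (p, ?t (Tgt E q)))" using f by simp
    qed
  qed (use I o in simp)
qed

text \<open>Let \<open>P \<cong> t\<^sub>! Q\<close> with \<open>Q = p\<^sub>* s\<^sup>*\<close>. As a right adjoint \<open>Q\<close> preserves the terminal object, so the left leg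
  \<open>b\<close> of \<open>Q 1\<close> is invertible and \<open>P 1\<close> is isomorphic to the span with legs \<open>t\<close> and \<open>B \<rightarrow> 1\<close>. The given isomorphism
  itself then lifts to the slice over \<open>P 1\<close>, where it identifies the lift of \<open>P\<close> with \<open>\<Psi> Q\<close>, a composite
  of right adjoints.\<close>

lemma local_right_adjoint_if_polynomial:
  assumes I [simp]: "I \<in> Obj E" and P: "fibered_functor E (fslice E I) (fslice E J) P"
    and poly: "polynomial_functor E I J P"
  shows "local_fibered_right_adjoint E (fslice E I) (fslice_one E one I) (fslice E J) P"
proof -
  interpret P: fib_functor E "fslice E I" "fslice E J" P using P by (rule fib_functorI)
  obtain M B s p t where s: "s \<in> Hom E M I" and p: "p \<in> Hom E M B" and t0: "t \<in> Hom E B J"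
    and iso: "fibered_iso E (fslice E I) (fslice E J) P (lower_shriek E t \<odot> lower_star E p \<odot> upper_star E s)"
    using poly unfolding polynomial_functor_def by blast
  define Q where "Q = lower_star E p \<odot> upper_star E s"
  obtain \<alpha> where \<alpha>: "vertical_iso E (fslice E I) (fslice E J) P (lower_shriek E t \<odot> Q) \<alpha>"
    using iso unfolding fibered_iso_def vertical_iso_def Q_def by blast
  have t [simp]: "t \<in> Arr E" "Src E t = B" "Tgt E t = J" using t0 by (simp_all add: Hom_iff)
  have B [simp]: "B \<in> Obj E" using t(1,2) Src_Tgt_Obj(1) by blast
  obtain \<epsilon> where adj: "counit_adj E (fslice E B) (fslice E I) (lower_shriek E s \<odot> upper_star E p) Q \<epsilon>"
    using polynomial_adj[OF s p] unfolding Q_def by blast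
  interpret a: adj E "fslice E B" "fslice E I" "lower_shriek E s \<odot> upper_star E p" Q \<epsilon> using adj by (rule adjI)
  let ?F = "Sp I" and ?G = "Sp B" and ?H = "Sp J"
  let ?U = "fslice_one E one I"
  have one_I: "terminal ?F ?U" by (rule terminal_fslice) simp
  then have 1 [simp]: "?U \<in> Obj ?F" by (simp add: terminal_def)
  have p1: "omap (proj (fslice E I)) ?U = one" using term_arr[OF one I] by (simp add: fslice_one_def Hom_iff)
  have one_o: "term_arr E one B \<in> Arr E" "Src E (term_arr E one B) = B" "Tgt E (term_arr E one B) = one"
    using term_arr[OF one B] by (simp_all add: Hom_iff)

  obtain t' k' where P1: "omap P ?U = (t', k')" by (cases "omap P ?U")
  have t' [simp]: "t' \<in> Arr E" "k' \<in> Arr E" "Src E t' = Src E k'" "Tgt E t' = J" "Tgt E k' = one"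
    using P.f.omap_Obj[OF 1] P.proj_omap[OF 1] unfolding P1 p1 by simp_all
  obtain b k where Q1: "omap Q ?U = (b, k)" by (cases "omap Q ?U")
  have b [simp]: "b \<in> Arr E" "k \<in> Arr E" "Src E b = Src E k" "Tgt E b = B" "Tgt E k = one"
    using a.R.f.omap_Obj[OF 1] a.R.proj_omap[OF 1] unfolding Q1 p1 by simp_all

  have tQ: "terminal ?G (b, k)" using a.terminal_right[OF one_I] unfolding Q1 .
  have BO: "(Ide E B, term_arr E one B) \<in> Obj ?G" "(b, k) \<in> Obj ?G" using one_o by simp_all
  have "term_arr ?G (b, k) (Ide E B, term_arr E one B) \<in> Hom ?G (Ide E B, term_arr E one B) (b, k)"
    by (rule term_arr[OF tQ BO(1)])
  then have "term_arr ?G (b, k) (Ide E B, term_arr E one B) \<in> Arr ?G"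
    "Src ?G (term_arr ?G (b, k) (Ide E B, term_arr E one B)) = (Ide E B, term_arr E one B)"
    "Tgt ?G (term_arr ?G (b, k) (Ide E B, term_arr E one B)) = (b, k)" by (simp_all add: Hom_iff)
  then obtain c w where "((Ide E B, term_arr E one B), (b, k), (c, w)) \<in> Arr ?G"
    by (elim fslice_arrE) simp
  then have c [simp]: "c \<in> Arr E" "Src E c = B" "Tgt E c = Src E k" "b \<cdot> c = Ide E B" using one_o by simp_all
  have kcb: "k \<cdot> (c \<cdot> b) = Ide E one \<cdot> k" by (rule term_eq) simp_all
  have bcb: "b \<cdot> (c \<cdot> b) = b" using extend[OF c(4), of b] by simp
  have "((b, k), (b, k), (c \<cdot> b, Ide E one)) = ((b, k), (b, k), (Ide E (Src E k), Ide E one))"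
    by (rule terminal_eq[OF tQ _ _ BO(2)]) (use kcb bcb one in \<open>simp_all add: Hom_iff terminal_def\<close>)
  then have cb [simp]: "c \<cdot> b = Ide E (Src E k)" by simp

  have "\<alpha> ?U \<in> Arr ?H" "Src ?H (\<alpha> ?U) = (t', k')" "Tgt ?H (\<alpha> ?U) = (t \<cdot> b, k)"
    using vertical_isoD(1-3)[OF \<alpha> 1] by (simp_all add: P1 Q1)
  then obtain c1 w1 where \<alpha>1: "\<alpha> ?U = ((t', k'), (t \<cdot> b, k), (c1, w1))" and c1 [simp]: "c1 \<in> Arr E" "Src E c1 = Src E k'"
      "Tgt E c1 = Src E k" and tc1: "t \<cdot> (b \<cdot> c1) = t'" by (elim fslice_arrE) simp
  obtain \<beta> where \<beta>: "\<beta> \<in> Arr ?H" "Src ?H \<beta> = (t \<cdot> b, k)" "Tgt ?H \<beta> = (t', k')"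
     "\<beta> \<cdot>\<^bsub>?H\<^esub> \<alpha> ?U = Ide ?H (t', k')" "\<alpha> ?U \<cdot>\<^bsub>?H\<^esub> \<beta> = Ide ?H (t \<cdot> b, k)"
    using vertical_isoD(5)[OF \<alpha> 1] unfolding omap_compF P1 Q1 lower_shriek_simps by blast
  from \<beta>(1-3) obtain c2 w2 where \<beta>': "\<beta> = ((t \<cdot> b, k), (t', k'), (c2, w2))" and c2 [simp]: "c2 \<in> Arr E" "Src E c2 = Src E k" "Tgt E c2 = Src E k'"
    by (elim fslice_arrE) simp
  have c12 [simp]: "c2 \<cdot> c1 = Ide E (Src E k')" "c1 \<cdot> c2 = Ide E (Src E k)"
    using \<beta>(4,5) unfolding \<alpha>1 \<beta>' by simp_all
  \<comment> \<open>The isomorphism \<open>P 1 \<cong> t\<^sub>! (Q 1) \<cong> (t, B \<rightarrow> 1)\<close> on the middle objects; \<open>c\<close> inverts \<open>b\<close> and \<open>c2\<close> inverts \<open>c1\<close>.\<close>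
  define e where "e = b \<cdot> c1"
  define e' where "e' = c2 \<cdot> c"
  have "b \<cdot> (c1 \<cdot> (c2 \<cdot> c)) = Ide E B" using extend[OF c12(2), of c] by simp
  moreover have "c2 \<cdot> (c \<cdot> (b \<cdot> c1)) = Ide E (Src E k')" using extend[OF cb, of c1] by simp
  ultimately interpret ss: span_slice E one J B t' k' t e e'
    by unfold_locales (use tc1 in \<open>simp_all add: e_def e'_def\<close>)

  let ?P = "slice_lift (fslice E I) ?U P"
  have fP: "fibered_functor E (fslice E I) ss.S ?P"
    using fibered_slice_lift[OF P one_I] unfolding P1 .
  interpret Pb: fib_functor E "fslice E I" ss.S ?P using fP by (rule fib_functorI)
  interpret \<Psi>: fib_functor E "fslice E B" ss.S ss.\<Psi> using ss.fibered_\<Psi> by (rule fib_functorI)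
  have U_arr [simp]: "term_arr ?F ?U X \<in> Arr ?F" "Src ?F (term_arr ?F ?U X) = X" "Tgt ?F (term_arr ?F ?U X) = ?U"
    if "X \<in> Obj ?F" for X using term_arr[OF one_I that] by (simp_all add: Hom_iff)
  have Po: "omap ?P X = amap P (term_arr ?F ?U X)"
    and Pa: "amap ?P f = (omap ?P (Src ?F f), omap ?P (Tgt ?F f), amap P f)" for X f
    by (simp_all add: slice_lift_def Let_def)

  define \<theta> where "\<theta> X = (omap ?P X, omap ss.\<Psi> (omap Q X), \<alpha> X)" for X
  have \<theta>: "\<theta> X \<in> Arr (total ss.S)" if X: "X \<in> Obj ?F" for X
  proof -
    have o: "omap ?P X \<in> Obj (total ss.S)" "omap ss.\<Psi> (omap Q X) \<in> Obj (total ss.S)"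
      by (rule Pb.f.omap_Obj[OF X] \<Psi>.f.omap_Obj[OF a.R.f.omap_Obj[OF X]])+
    have PX: "Src ?H (omap ?P X) = omap P X" using X by (simp add: Po)
    obtain x y where QX: "omap Q X = (x, y)" by (cases "omap Q X")
    have xy [simp]: "x \<in> Arr E" "y \<in> Arr E" "Src E x = Src E y" "Tgt E x = B" "Tgt E y = omap (proj (fslice E I)) X"
      using a.R.f.omap_Obj[OF X] a.R.proj_omap[OF X] unfolding QX by simp_all
    from o(1) obtain m n v z where PX': "omap ?P X = ((m, n), (t', k'), (v, z))" and
      v [simp]: "m \<in> Arr E" "n \<in> Arr E" "Src E m = Src E n" "v \<in> Arr E" "Src E v = Src E n" "Tgt E v = Src E k'"
      and z: "z = term_arr E one (Tgt E n)" by (rule ss.S_objE)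
    have PX2: "omap P X = (m, n)" using PX unfolding PX' by simp
    have "Tgt E n = omap (proj (fslice E I)) X" using P.proj_omap[OF X] unfolding PX2 by simp
    then have ny: "Tgt E y = Tgt E n" by simp
    have "\<alpha> X \<in> Arr ?H" "Src ?H (\<alpha> X) = (m, n)" "Tgt ?H (\<alpha> X) = (t \<cdot> x, y)" "amap (proj (fslice E J)) (\<alpha> X) = Ide E (Tgt E n)"
      using vertical_isoD(1-4)[OF \<alpha> X] ny by (simp_all add: PX2 QX)
    then obtain u where \<alpha>X: "\<alpha> X = ((m, n), (t \<cdot> x, y), (u, Ide E (Tgt E n)))" and u [simp]: "u \<in> Arr E" "Src E u = Src E n" "Tgt E u = Src E y"
      by (elim fslice_arrE) simp
    let ?f = "term_arr ?F ?U X"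
    have "amap Q ?f \<in> Arr ?G" "Src ?G (amap Q ?f) = (x, y)" "Tgt ?G (amap Q ?f) = (b, k)"
      using X by (simp_all add: QX Q1)
    then obtain z1 z2 where Qf: "amap Q ?f = ((x, y), (b, k), (z1, z2))" and z1 [simp]: "z1 \<in> Arr E" "Src E z1 = Src E y" "Tgt E z1 = Src E k"
      and bz: "b \<cdot> z1 = x" by (elim fslice_arrE) simp
    \<comment> \<open>Naturality of \<open>\<alpha>\<close> at the arrow to the terminal object makes \<open>\<alpha> X\<close> an arrow of the slice.\<close>
    have "amap (lower_shriek E t \<odot> Q) ?f \<cdot>\<^bsub>?H\<^esub> \<alpha> X = \<alpha> ?U \<cdot>\<^bsub>?H\<^esub> amap P ?f"
      using vertical_iso_nat[OF \<alpha>, of ?f] X by simp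
    then have "z1 \<cdot> u = c1 \<cdot> v"
      unfolding Po[symmetric] PX' \<alpha>X \<alpha>1 amap_compF Qf by simp
    then have "b \<cdot> (z1 \<cdot> u) = e \<cdot> v" by (simp add: e_def)
    then have "x \<cdot> u = e \<cdot> v" using extend[OF bz, of u] by simp
    then have "e' \<cdot> (x \<cdot> u) = v" using extend[OF ss.ee'(2), of v] by simp
    moreover have "term_arr E one (Tgt E y) \<cdot> Ide E (Tgt E n) = z" using ny by (simp add: z)
    ultimately have "omap ss.\<Psi> (omap Q X) \<cdot>\<^bsub>?H\<^esub> \<alpha> X = omap ?P X"
      unfolding PX' \<alpha>X QX by simp
    moreover have "Src ?H (omap ss.\<Psi> (omap Q X)) = (t \<cdot> x, y)" unfolding QX by simp
    ultimately show ?thesis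
      using o PX vertical_isoD(1-3)[OF \<alpha> X] unfolding \<theta>_def by (simp add: PX2 QX)
  qed
  have "vertical_iso E (fslice E I) ss.S ?P (ss.\<Psi> \<odot> Q) \<theta>"
    unfolding vertical_iso_def fibered_nat_trans_def nat_trans_def
  proof (intro conjI ballI)
    fix X assume X: "X \<in> Obj ?F"
    show "\<theta> X \<in> Hom (total ss.S) (omap ?P X) (omap (ss.\<Psi> \<odot> Q) X)"
      using \<theta>[OF X] unfolding Hom_iff by (simp add: \<theta>_def)
    show "amap (proj ss.S) (\<theta> X) = Ide E (omap (proj (fslice E I)) X)"
      using vertical_isoD(4)[OF \<alpha> X] by (simp add: \<theta>_def)
    show "iso_arr (total ss.S) (\<theta> X)"
      using \<theta>[OF X] \<alpha> X unfolding \<theta>_def slice_fib_simps(1) vertical_iso_def by (intro P.G.T.iso_arr_slice) simp_all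
  next
    fix f assume f: "f \<in> Arr ?F"
    obtain X Y vw where Qf: "amap Q f = (X, Y, vw)" by (metis surj_pair)
    have XY: "X = omap Q (Src ?F f)" "Y = omap Q (Tgt ?F f)"
      using a.R.f.Src_amap[OF f] a.R.f.Tgt_amap[OF f] unfolding Qf by simp_all
    have "amap ss.\<Psi> (amap Q f) = (omap ss.\<Psi> X, omap ss.\<Psi> Y, amap (lower_shriek E t \<odot> Q) f)"
      unfolding Qf amap_compF ss.\<Psi>_simps(2) ..
    then show "amap (ss.\<Psi> \<odot> Q) f \<cdot>\<^bsub>total ss.S\<^esub> \<theta> (Src ?F f) = \<theta> (Tgt ?F f) \<cdot>\<^bsub>total ss.S\<^esub> amap ?P f"
      using vertical_iso_nat[OF \<alpha> f] by (simp add: \<theta>_def Pa XY del: amap_compF) simp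
  qed
  then have "counit_adj E ss.S (fslice E I) ((lower_shriek E s \<odot> upper_star E p) \<odot> ss.\<Phi>) ?P
     (\<lambda>x. (\<epsilon> x \<cdot>\<^bsub>?F\<^esub> amap (lower_shriek E s \<odot> upper_star E p) (Ide ?G (omap Q x))) \<cdot>\<^bsub>?F\<^esub> amap ((lower_shriek E s \<odot> upper_star E p) \<odot> ss.\<Phi>) (\<theta> x))"
    by (rule adj.transfer_right[OF adjI[OF counit_adj_comp[OF adj ss.\<Phi>\<Psi>_adj]] fP])
  then have "fibered_right_adjoint E (fslice E I) ss.S ?P"
    unfolding fibered_right_adjoint_iff by blast
  then show ?thesis
    unfolding local_fibered_right_adjoint_def P1 using P one_I by simp
qed

text \<open>The lift of \<open>P\<close> followed by \<open>\<Phi>\<close> is a right adjoint \<open>E|I \<rightarrow> E|B\<close>, where \<open>t : B \<rightarrow> J\<close> is the left leg of \<open>P 1\<close>. Its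
  left adjoint is \<open>s\<^sub>! p\<^sup>*\<close> for some \<open>s\<close> and \<open>p\<close>, so it is isomorphic to \<open>p\<^sub>* s\<^sup>*\<close> by uniqueness of right
  adjoints. After \<open>t\<^sub>!\<close> is applied, the former becomes \<open>P\<close> and
  the latter a polynomial functor.\<close>

lemma polynomial_if_local_right_adjoint:
  assumes I [simp]: "I \<in> Obj E" and P: "fibered_functor E (fslice E I) (fslice E J) P"
    and loc: "local_fibered_right_adjoint E (fslice E I) (fslice_one E one I) (fslice E J) P"
  shows "polynomial_functor E I J P"
proof -
  interpret P: fib_functor E "fslice E I" "fslice E J" P using P by (rule fib_functorI)
  let ?F = "Sp I" and ?H = "Sp J"
  let ?U = "fslice_one E one I"
  have one_I: "terminal ?F ?U" by (rule terminal_fslice) simp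
  then have 1 [simp]: "?U \<in> Obj ?F" by (simp add: terminal_def)
  have p1: "omap (proj (fslice E I)) ?U = one" using term_arr[OF one I] by (simp add: fslice_one_def Hom_iff)
  obtain t k where P1: "omap P ?U = (t, k)" by (cases "omap P ?U")
  have t [simp]: "t \<in> Arr E" "k \<in> Arr E" "Src E t = Src E k" "Tgt E t = J" "Tgt E k = one"
    using P.f.omap_Obj[OF 1] P.proj_omap[OF 1] unfolding P1 p1 by simp_all
  define B where "B = Src E k"
  have B [simp]: "B \<in> Obj E" "Src E k = B" by (simp_all add: B_def)
  interpret ss: span_slice E one J B t k t "Ide E B" "Ide E B"
    by unfold_locales simp_all
  let ?P = "slice_lift (fslice E I) ?U P"
  obtain L \<epsilon> where L: "counit_adj E ss.S (fslice E I) L ?P \<epsilon>"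
    using loc unfolding local_fibered_right_adjoint_def P1 fibered_right_adjoint_iff by blast
  interpret Pb: fib_functor E "fslice E I" ss.S ?P using L by (intro fib_functorI) (simp add: counit_adj_def)
  have L': "\<exists>\<epsilon>. counit_adj E (fslice E B) (fslice E I) (L \<odot> ss.\<Psi>) (ss.\<Phi> \<odot> ?P) \<epsilon>"
    using counit_adj_comp[OF L ss.\<Psi>\<Phi>_adj] by blast
  then obtain \<epsilon>' where \<epsilon>': "counit_adj E (fslice E B) (fslice E I) (L \<odot> ss.\<Psi>) (ss.\<Phi> \<odot> ?P) \<epsilon>'" by (elim exE)
  obtain M s p \<theta> where s: "s \<in> Hom E M I" and p: "p \<in> Hom E M B"
    and \<theta>: "vertical_iso E (fslice E B) (fslice E I) (lower_shriek E s \<odot> upper_star E p) (L \<odot> ss.\<Psi>) \<theta>"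
    using left_adjoint_polynomial[OF \<epsilon>'] B(1) by blast
  define Q where "Q = lower_star E p \<odot> upper_star E s"
  obtain \<epsilon>2 where Q: "counit_adj E (fslice E B) (fslice E I) (lower_shriek E s \<odot> upper_star E p) Q \<epsilon>2"
    using polynomial_adj[OF s p] unfolding Q_def by blast
  have fQ: "fibered_functor E (fslice E I) (fslice E B) Q" using Q by (simp add: counit_adj_def)
  have "fibered_functor E (fslice E B) (fslice E I) (lower_shriek E s \<odot> upper_star E p)" using Q by (simp add: counit_adj_def)
  from adj.transfer_left[OF adjI[OF \<epsilon>'] this \<theta>]
  obtain \<kappa> where \<kappa>: "vertical_iso E (fslice E I) (fslice E B) (ss.\<Phi> \<odot> ?P) Q \<kappa>"
    using right_adjoint_unique[OF _ Q] by blast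
  have fs: "fibered_functor E (fslice E B) (fslice E J) (lower_shriek E t)" using fibered_lower_shriek[OF t(1)] by simp
  interpret sh: fib_functor E "fslice E B" "fslice E J" "lower_shriek E t" using fs by (rule fib_functorI)
  have Po: "omap ?P X = amap P (term_arr ?F ?U X)"
    and Pa: "amap ?P f = (omap ?P (Src ?F f), omap ?P (Tgt ?F f), amap P f)" for X f
    by (simp_all add: slice_lift_def Let_def)
  have oP: "omap (lower_shriek E t) (omap ss.\<Phi> (omap ?P X)) = omap P X" if X: "X \<in> Obj ?F" for X
  proof -
    have "term_arr ?F ?U X \<in> Arr ?F" "Src ?F (term_arr ?F ?U X) = X" using term_arr[OF one_I X] by (simp_all add: Hom_iff)
    then show ?thesis using ss.shriek_\<Phi>_omap[OF Pb.f.omap_Obj[OF X]] by (simp add: Po)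
  qed
  have aP: "amap (lower_shriek E t) (amap ss.\<Phi> (amap ?P f)) = amap P f" if f: "f \<in> Arr ?F" for f
    using Pb.f.amap_Arr[OF f] unfolding Pa by (rule ss.shriek_\<Phi>_amap)
  have "fibered_nat_trans E (fslice E I) (fslice E J) P (lower_shriek E t \<odot> Q) (\<lambda>X. amap (lower_shriek E t) (\<kappa> X))"
    unfolding fibered_nat_trans_def nat_trans_def
  proof (intro conjI ballI)
    fix X assume X: "X \<in> Obj ?F"
    note k = vertical_isoD(1-4)[OF \<kappa> X]
    show "amap (lower_shriek E t) (\<kappa> X) \<in> Hom ?H (omap P X) (omap (lower_shriek E t \<odot> Q) X)"
      using k oP[OF X] by (simp add: Hom_iff)
    show "amap (proj (fslice E J)) (amap (lower_shriek E t) (\<kappa> X)) = Ide E (omap (proj (fslice E I)) X)"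
      using k by simp
  next
    fix f assume f: "f \<in> Arr ?F"
    interpret Q: fib_functor E "fslice E I" "fslice E B" Q using fQ by (rule fib_functorI)
    interpret \<Phi>: fib_functor E ss.S "fslice E B" ss.\<Phi> using ss.fibered_\<Phi> by (rule fib_functorI)
    have o: "Src ?F f \<in> Obj ?F" "Tgt ?F f \<in> Obj ?F" using f by simp_all
    note k = vertical_isoD(1-3)[OF \<kappa> o(1)] vertical_isoD(1-3)[OF \<kappa> o(2)]
    have Pf: "amap ss.\<Phi> (amap ?P f) \<in> Arr (Sp B)" "Tgt (Sp B) (amap ss.\<Phi> (amap ?P f)) = omap ss.\<Phi> (omap ?P (Tgt ?F f))"
      using \<Phi>.f.amap_Arr[OF Pb.f.amap_Arr[OF f]] \<Phi>.f.Tgt_amap[OF Pb.f.amap_Arr[OF f]] Pb.f.Tgt_amap[OF f] by simp_all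
    have "amap (lower_shriek E t) (amap Q f \<cdot>\<^bsub>Sp B\<^esub> \<kappa> (Src ?F f)) =
        amap (lower_shriek E t) (\<kappa> (Tgt ?F f) \<cdot>\<^bsub>Sp B\<^esub> amap ss.\<Phi> (amap ?P f))"
      using vertical_iso_nat[OF \<kappa> f] by simp
    then show "amap (lower_shriek E t \<odot> Q) f \<cdot>\<^bsub>?H\<^esub> amap (lower_shriek E t) (\<kappa> (Src ?F f)) =
        amap (lower_shriek E t) (\<kappa> (Tgt ?F f)) \<cdot>\<^bsub>?H\<^esub> amap P f"
      using f k Pf by (simp add: aP)
  qed
  moreover have "iso_arr ?H (amap (lower_shriek E t) (\<kappa> X))" if "X \<in> Obj ?F" for X
    using \<kappa> that by (intro sh.f.iso_arr_amap) (simp add: vertical_iso_def)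
  ultimately have "fibered_iso E (fslice E I) (fslice E J) P (lower_shriek E t \<odot> Q)"
    unfolding fibered_iso_def using P fibered_functor_comp[OF fQ fs] by blast
  then show ?thesis
    unfolding polynomial_functor_def Q_def using s p
    by (intro exI[of _ M] exI[of _ B] exI[of _ s] exI[of _ p] exI[of _ t]) (simp add: Hom_iff)
qed

end

theorem mainTheorem1:
  fixes E :: "('o, 'm) cat" and one I J :: 'o
    and P :: "('m span, 'm span_arr, 'm span, 'm span_arr) fun_data"
  assumes "locally_cartesian_closed E"
    and "terminal E one"
    and "I \<in> Obj E" and "J \<in> Obj E"
    and "fibered_functor E (fslice E I) (fslice E J) P"
  shows "polynomial_functor E I J P \<longleftrightarrow>
    local_fibered_right_adjoint E (fslice E I) (fslice_one E one I) (fslice E J) P"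
proof -
  interpret lccc E one
    using assms(1,2) by (simp add: lccc_def lccc_axioms_def locally_cartesian_closed_def)
  show ?thesis
    using local_right_adjoint_if_polynomial[OF assms(3,5)] polynomial_if_local_right_adjoint[OF assms(3,5)] by blast
qed

end
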